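(* Let $(\Omega,\sigma)$ be minimal, let $f\in C^{0,2}(\Omega\times\mathbb{R},\mathbb{R})$ be $(\mathrm{SDC})$ and $(\mathrm{Co})$, and assume that the flow $\tau$ on $\Omega\times\mathbb{R}$ defined by $x'=f(\omega\cdot t,x)$, $\omega\in\Omega$, admits at least two (different) minimal sets $\mathcal{M}_1$ and $\mathcal{M}_2$. (i) If the Sacker and Sell spectrum of $f_x$ on $\mathcal{M}_1$ is contained in $[0,\infty)$, then $\mathcal{M}_2$ is hyperbolic attractive. (ii) If the Sacker and Sell spectrum of $f_x$ on one of the minimal sets $\mathcal{M}_1,\mathcal{M}_2$ reduces to a point, then either $\mathcal{M}_1$ or $\mathcal{M}_2$ is hyperbolic attractive. (iii) If $(\Omega,\sigma)$ is uniquely ergodic, then either $\mathcal{M}_1$ or $\mathcal{M}_2$ is hyperbolic attractive. (Here "either ... or" is inclusive.)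
   Context: $\Omega$ is a compact metric space with a continuous flow $\sigma:\mathbb{R}\times\Omega\to\Omega$, $\sigma(t,\omega)=\omega\cdot t$; minimal means every $\sigma$-orbit is dense; uniquely ergodic means that there is exactly one normalized $\sigma$-invariant Borel measure on $\Omega$. $C^{0,k}(\Omega\times\mathbb{R},\mathbb{R})$: functions $f$ such that $f$ and its $x$-derivatives up to order $k$ exist and are jointly continuous. $t\mapsto u(t,\omega,x_0)$ is the maximal solution of $x'=f(\omega\cdot t,x)$ with $u(0,\omega,x_0)=x_0$; $\tau(t,\omega,x_0)=(\omega\cdot t,u(t,\omega,x_0))$. A $\tau$-minimal set is a nonempty compact $\tau$-invariant subset of $\Omega\times\mathbb{R}$ containing properly no other such set. It is hyperbolic attractive if it is uniformly exponentially asymptotically stable at $+\infty$: there are $\delta>0,k\ge1,\gamma>0$ such that if $(\omega,x)$ is in the set and $|y-x|<\delta$ then $|u(t,\omega,y)-u(t,\omega,x)|\le ke^{-\gamma t}|y-x|$ for all $t\ge0$. For a continuous flow on a compact metric space $Y$ (written $y\cdot t$) and a continuous $a:Y\to\mathbb{R}$, the family $x'=a(y\cdot t)x$ has exponential dichotomy over $Y$ if there are $k\ge1,\delta>0$ such that either $\exp\int_0^ta(y\cdot s)ds\le ke^{-\delta t}$ for all $y\in Y,t\ge0$, or $\exp\int_0^ta(y\cdot s)ds\le ke^{\delta t}$ for all $y\in Y,t\le0$. The Sacker and Sell spectrum of $a$ is the set of $\lambda\in\mathbb{R}$ such that $x'=(a(y\cdot t)-\lambda)x$ does not have exponential dichotomy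 over $Y$. The Sacker and Sell spectrum of $f_x$ on a compact $\tau$-invariant set $\mathcal{K}$ is that of $f_x:\mathcal{K}\to\mathbb{R}$ over the flow $(\mathcal{K},\tau)$. $f$ is $(\mathrm{Co})$ if $\lim_{|x|\to\infty}f(\omega,x)/x=-\infty$ uniformly on $\Omega$. $f$ is $(\mathrm{DC})$ if $f_x(\omega,\cdot)$ is concave on $\mathbb{R}$ for all $\omega$. For a compact nondegenerate interval $J$ of length $l(J)$ and $\epsilon\in[0,l(J)]$, $b_{J,\epsilon}(\omega)=\frac{\epsilon}{4l(J)^2}\min_{x\in J_\epsilon}\{2f_x(\omega,x)-f_x(\omega,x-\epsilon/2)-f_x(\omega,x+\epsilon/2)\}$ with $J_\epsilon=\{x:[x-\epsilon/2,x+\epsilon/2]\subseteq J\}$. $f$ is $(\mathrm{SDC})$ if it is (DC) and, for every compact nondegenerate interval $J$, every $\epsilon\in(0,l(J)/2]$ and every $\sigma$-ergodic normalized Borel measure $m$ on $\Omega$, $m(\{b_{J,\epsilon}>0\})>0$. *)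

theory Defs
  imports "HOL-Probability.Probability"
begin

text \<open>
  The base space is a whole type \<open>'a\<close>, intended to be a metric space with
  \<open>compact (UNIV :: 'a set)\<close>. The point \<open>\<omega>\<cdot>t\<close> is written \<open>\<sigma> t \<omega>\<close>, and the right-hand
  side is curried, \<open>f \<omega> x\<close>.
\<close>

definition continuous_flow :: "(real \<Rightarrow> 'a::topological_space \<Rightarrow> 'a) \<Rightarrow> bool" where
  "continuous_flow \<sigma> \<longleftrightarrow>
     (\<forall>\<omega>. \<sigma> 0 \<omega> = \<omega>) \<and> (\<forall>s t \<omega>. \<sigma> (s + t) \<omega> = \<sigma> s (\<sigma> t \<omega>)) \<and>
     continuous_on UNIV (\<lambda>(t, \<omega>). \<sigma> t \<omega>)"

definition minimal_flow :: "(real \<Rightarrow> 'a::topological_space \<Rightarrow> 'a) \<Rightarrow> bool" where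
  "minimal_flow \<sigma> \<longleftrightarrow> (\<forall>\<omega>. closure (range (\<lambda>t. \<sigma> t \<omega>)) = UNIV)"

definition invariant_measure ::
  "(real \<Rightarrow> 'a::topological_space \<Rightarrow> 'a) \<Rightarrow> 'a measure \<Rightarrow> bool" where
  "invariant_measure \<sigma> m \<longleftrightarrow>
     prob_space m \<and> sets m = sets borel \<and>
     (\<forall>t. \<forall>B\<in>sets borel. emeasure m (\<sigma> t ` B) = emeasure m B)"

definition ergodic_measure ::
  "(real \<Rightarrow> 'a::topological_space \<Rightarrow> 'a) \<Rightarrow> 'a measure \<Rightarrow> bool" where
  "ergodic_measure \<sigma> m \<longleftrightarrow>
     invariant_measure \<sigma> m \<and>
     (\<forall>B\<in>sets borel. (\<forall>t. \<sigma> t ` B = B) \<longrightarrow> measure m B = 0 \<or> measure m B = 1)"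

definition uniquely_ergodic :: "(real \<Rightarrow> 'a::topological_space \<Rightarrow> 'a) \<Rightarrow> bool" where
  "uniquely_ergodic \<sigma> \<longleftrightarrow> (\<exists>!m. invariant_measure \<sigma> m)"

definition C0k :: "nat \<Rightarrow> ('a::topological_space \<Rightarrow> real \<Rightarrow> real) \<Rightarrow> bool" where
  "C0k k f \<longleftrightarrow>
     (\<forall>j<k. \<forall>\<omega> x. (deriv ^^ j) (f \<omega>) differentiable (at x)) \<and>
     (\<forall>j\<le>k. continuous_on UNIV (\<lambda>(\<omega>, x). (deriv ^^ j) (f \<omega>) x))"

definition fx :: "('a \<Rightarrow> real \<Rightarrow> real) \<Rightarrow> 'a \<Rightarrow> real \<Rightarrow> real" where
  "fx f \<omega> x = deriv (f \<omega>) x"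

definition solves ::
  "(real \<Rightarrow> 'a \<Rightarrow> 'a) \<Rightarrow> ('a \<Rightarrow> real \<Rightarrow> real) \<Rightarrow> 'a \<Rightarrow> real \<Rightarrow> real set \<Rightarrow> (real \<Rightarrow> real) \<Rightarrow> bool"
where
  "solves \<sigma> f \<omega> x0 I v \<longleftrightarrow>
     open I \<and> is_interval I \<and> 0 \<in> I \<and> v 0 = x0 \<and>
     (\<forall>t\<in>I. (v has_real_derivative f (\<sigma> t \<omega>) (v t)) (at t))"

text \<open>
  The maximal solution \<open>t \<mapsto> u(t,\<omega>,x0)\<close> is obtained by gluing all solutions on open
  intervals around \<open>0\<close>; uniqueness holds when \<open>f\<close> and \<open>f\<^sub>x\<close> are continuous. Outside the
  domain \<open>max_interval\<close> its value is unspecified.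
\<close>

definition max_interval ::
  "(real \<Rightarrow> 'a \<Rightarrow> 'a) \<Rightarrow> ('a \<Rightarrow> real \<Rightarrow> real) \<Rightarrow> 'a \<Rightarrow> real \<Rightarrow> real set" where
  "max_interval \<sigma> f \<omega> x0 = \<Union>{I. \<exists>v. solves \<sigma> f \<omega> x0 I v}"

definition max_sol ::
  "(real \<Rightarrow> 'a \<Rightarrow> 'a) \<Rightarrow> ('a \<Rightarrow> real \<Rightarrow> real) \<Rightarrow> real \<Rightarrow> 'a \<Rightarrow> real \<Rightarrow> real" where
  "max_sol \<sigma> f t \<omega> x0 = (THE y. \<exists>I v. solves \<sigma> f \<omega> x0 I v \<and> t \<in> I \<and> y = v t)"

definition skew_flow ::
  "(real \<Rightarrow> 'a \<Rightarrow> 'a) \<Rightarrow> ('a \<Rightarrow> real \<Rightarrow> real) \<Rightarrow> real \<Rightarrow> 'a \<times> real \<Rightarrow> 'a \<times> real" where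
  "skew_flow \<sigma> f t = (\<lambda>(\<omega>, x). (\<sigma> t \<omega>, max_sol \<sigma> f t \<omega> x))"

text \<open>The skew-product flow is only local, so invariance includes global existence.\<close>

definition skew_invariant ::
  "(real \<Rightarrow> 'a \<Rightarrow> 'a) \<Rightarrow> ('a \<Rightarrow> real \<Rightarrow> real) \<Rightarrow> ('a \<times> real) set \<Rightarrow> bool" where
  "skew_invariant \<sigma> f K \<longleftrightarrow>
     (\<forall>(\<omega>, x)\<in>K. max_interval \<sigma> f \<omega> x = UNIV) \<and> (\<forall>t. skew_flow \<sigma> f t ` K = K)"

definition minimal_set ::
  "(real \<Rightarrow> 'a::topological_space \<Rightarrow> 'a) \<Rightarrow> ('a \<Rightarrow> real \<Rightarrow> real) \<Rightarrow> ('a \<times> real) set \<Rightarrow> bool" where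
  "minimal_set \<sigma> f M \<longleftrightarrow>
     M \<noteq> {} \<and> compact M \<and> skew_invariant \<sigma> f M \<and>
     \<not> (\<exists>K. K \<subset> M \<and> K \<noteq> {} \<and> compact K \<and> skew_invariant \<sigma> f K)"

definition hyperbolic_attractive ::
  "(real \<Rightarrow> 'a \<Rightarrow> 'a) \<Rightarrow> ('a \<Rightarrow> real \<Rightarrow> real) \<Rightarrow> ('a \<times> real) set \<Rightarrow> bool" where
  "hyperbolic_attractive \<sigma> f M \<longleftrightarrow>
     (\<exists>\<delta>>0. \<exists>k\<ge>1. \<exists>\<gamma>>0. \<forall>(\<omega>, x)\<in>M. \<forall>y. \<bar>y - x\<bar> < \<delta> \<longrightarrow>
        (\<forall>t\<ge>0. t \<in> max_interval \<sigma> f \<omega> y \<and>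
           \<bar>max_sol \<sigma> f t \<omega> y - max_sol \<sigma> f t \<omega> x\<bar> \<le> k * exp (- \<gamma> * t) * \<bar>y - x\<bar>))"

text \<open>
  Here \<open>\<phi>\<close> is only required to be a flow on the set \<open>Y\<close>. The interval integral is
  oriented: for \<open>t < 0\<close> it is minus the integral over \<open>(t, 0)\<close>.
\<close>

definition exp_dichotomy :: "'y set \<Rightarrow> (real \<Rightarrow> 'y \<Rightarrow> 'y) \<Rightarrow> ('y \<Rightarrow> real) \<Rightarrow> bool" where
  "exp_dichotomy Y \<phi> a \<longleftrightarrow>
     (\<exists>k\<ge>1. \<exists>\<delta>>0.
        (\<forall>y\<in>Y. \<forall>t\<ge>0. exp (LBINT s=ereal 0..ereal t. a (\<phi> s y)) \<le> k * exp (- \<delta> * t)) \<or>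
        (\<forall>y\<in>Y. \<forall>t\<le>0. exp (LBINT s=ereal 0..ereal t. a (\<phi> s y)) \<le> k * exp (\<delta> * t)))"

definition sacker_sell_spectrum ::
  "'y set \<Rightarrow> (real \<Rightarrow> 'y \<Rightarrow> 'y) \<Rightarrow> ('y \<Rightarrow> real) \<Rightarrow> real set" where
  "sacker_sell_spectrum Y \<phi> a = {l. \<not> exp_dichotomy Y \<phi> (\<lambda>y. a y - l)}"

definition fx_spectrum ::
  "(real \<Rightarrow> 'a \<Rightarrow> 'a) \<Rightarrow> ('a \<Rightarrow> real \<Rightarrow> real) \<Rightarrow> ('a \<times> real) set \<Rightarrow> real set" where
  "fx_spectrum \<sigma> f K = sacker_sell_spectrum K (skew_flow \<sigma> f) (\<lambda>(\<omega>, x). fx f \<omega> x)"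

definition Co :: "('a \<Rightarrow> real \<Rightarrow> real) \<Rightarrow> bool" where
  "Co f \<longleftrightarrow> (\<forall>r. \<forall>\<^sub>F x in at_infinity. \<forall>\<omega>. f \<omega> x / x < r)"

definition DC :: "('a \<Rightarrow> real \<Rightarrow> real) \<Rightarrow> bool" where
  "DC f \<longleftrightarrow> (\<forall>\<omega>. concave_on UNIV (fx f \<omega>))"

text \<open>
  The function \<open>b\<^bsub>J,\<epsilon>\<^esub>\<close> for \<open>J = [c, d]\<close>. The infimum is a minimum when \<open>f\<^sub>x(\<omega>,\<cdot>)\<close> is
  continuous and \<open>0 \<le> \<epsilon> \<le> d - c\<close>, the index set being then compact and nonempty.
\<close>

definition b_fun ::
  "('a \<Rightarrow> real \<Rightarrow> real) \<Rightarrow> real \<Rightarrow> real \<Rightarrow> real \<Rightarrow> 'a \<Rightarrow> real" where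
  "b_fun f c d \<epsilon> \<omega> =
     \<epsilon> / (4 * (d - c)\<^sup>2) *
     (INF x\<in>{x. {x - \<epsilon> / 2..x + \<epsilon> / 2} \<subseteq> {c..d}}.
        2 * fx f \<omega> x - fx f \<omega> (x - \<epsilon> / 2) - fx f \<omega> (x + \<epsilon> / 2))"

definition SDC ::
  "(real \<Rightarrow> 'a::topological_space \<Rightarrow> 'a) \<Rightarrow> ('a \<Rightarrow> real \<Rightarrow> real) \<Rightarrow> bool" where
  "SDC \<sigma> f \<longleftrightarrow>
     DC f \<and>
     (\<forall>c d \<epsilon> m. c < d \<and> 0 < \<epsilon> \<and> \<epsilon> \<le> (d - c) / 2 \<and> ergodic_measure \<sigma> m \<longrightarrow>
        measure m {\<omega>. b_fun f c d \<epsilon> \<omega> > 0} > 0)"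

end

theory Submission
  imports Defs
begin

text \<open>
Two distinct minimal sets are disjoint compact sets that both lie over the whole base. So over a base point
\<open>\<omega>\<close> there are \<open>x\<close> in the fibre of the first and \<open>y\<close> in the fibre of the second, and the distance of the
two orbits stays between two positive constants for all time. Along such a pair the derivative of
\<open>ln \<bar>x - y\<bar>\<close> is \<open>(f(\<omega>\<cdot>t,x) - f(\<omega>\<cdot>t,y)) / (x - y)\<close>, the mean value of \<open>f\<^sub>x\<close> on the segment from \<open>x\<close> to \<open>y\<close>.
Since \<open>f\<^sub>x\<close> is concave, this mean is at least the trapezoidal mean \<open>(f\<^sub>x(\<omega>\<cdot>t,x) + f\<^sub>x(\<omega>\<cdot>t,y)) / 2\<close>; the excess is
nonnegative, (SDC) makes it positive near some base point, and by minimality every orbit of the base returns there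
with bounded gaps. As \<open>ln \<bar>x - y\<bar>\<close> is bounded, the integrals of \<open>f\<^sub>x\<close> along the two orbits must together
decrease linearly in time, uniformly in the pair: this is \<open>exponent_sum_estimate\<close>.

A minimal set is hyperbolic attractive as soon as the integrals of \<open>f\<^sub>x\<close> along its orbits decrease linearly and
uniformly (\<open>hyperbolic_attractive_of_decay\<close>). In (i) the spectral hypothesis says that the integrals over
the first set do not decrease at any linear rate, so those over the second one do. In (ii) a negative single spectral
point gives the decrease on the set itself, and a nonnegative one leads back to (i). In (iii) the largest
integrals over the two sets may be attained over different base points. At a large time \<open>T\<close>,
\<open>continuous_separation\<close> inserts a continuous function \<open>g\<close> on the base above the integrals over the first set
such that \<open>- g - 1\<close> is above those over the second. Unique ergodicity makes the upper orbit mean an odd functional,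
so that \<open>g\<close> or \<open>- g - 1\<close> has negative upper mean, and the corresponding integrals decrease.

Measures on the base occur in the strict part of (SDC), which speaks about ergodic measures and says something only if
there is one, and in unique ergodicity. Both are reached through one sublinear functional on continuous functions, the upper
orbit mean. The linear functionals below it are the invariant means; the Riesz representation turns them into
invariant measures, an extreme one into an ergodic measure (\<open>ergodic_measure_exists\<close>), and uniqueness of
the measure forces the sublinear functional to be odd (\<open>uniquely_ergodic_upper_mean_neg\<close>).
\<close>

section \<open>Extreme linear functionals below a sublinear functional\<close>

definition sublinear :: "('v::real_vector \<Rightarrow> real) \<Rightarrow> bool" where
  "sublinear p \<longleftrightarrow> (\<forall>u v. p (u + v) \<le> p u + p v) \<and> (\<forall>c>0. \<forall>v. p (c *\<^sub>R v) \<le> c * p v)"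

lemma sublinearD:
  assumes "sublinear p"
  shows "p (u + v) \<le> p u + p v" and "c > 0 \<Longrightarrow> p (c *\<^sub>R v) \<le> c * p v"
  using assms by (auto simp: sublinear_def)

lemma sublinear_zero:
  assumes "sublinear p" shows "p 0 = 0"
  using sublinearD(2)[OF assms, of 2 0] sublinearD(2)[OF assms, of "1/2" 0] by simp

lemma sublinear_neg:
  assumes "sublinear p" shows "- p (- v) \<le> p v"
  using sublinearD(1)[OF assms, of v "- v"] sublinear_zero[OF assms] by simp

text \<open>
Oddness turns subadditivity and subhomogeneity into equalities by passing to opposite vectors.
\<close>

lemma sublinear_odd_imp_linear:
  assumes p: "sublinear p" and odd: "\<And>v. p (- v) = - p v"
  shows "linear p"
proof (rule linearI)
  fix u v
  have "p (- u + - v) \<le> - p u + - p v"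
    using sublinearD(1)[OF p, of "- u" "- v"] by (simp add: odd)
  moreover have "p (- u + - v) = - p (u + v)"
    using odd[of "u + v"] by (simp add: add.commute)
  ultimately show "p (u + v) = p u + p v"
    using sublinearD(1)[OF p, of u v] by simp
next
  have pos: "p (c *\<^sub>R v) = c * p v" if "c > 0" for c v
  proof (rule antisym)
    show "p (c *\<^sub>R v) \<le> c * p v" by (rule sublinearD(2)[OF p that])
    have "p (inverse c *\<^sub>R (c *\<^sub>R v)) \<le> inverse c * p (c *\<^sub>R v)"
      using that by (intro sublinearD(2)[OF p]) auto
    then show "c * p v \<le> p (c *\<^sub>R v)"
      using that by (simp add: field_simps)
  qed
  fix c v
  show "p (c *\<^sub>R v) = c *\<^sub>R p v"
  proof (cases c "0 :: real" rule: linorder_cases)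
    case less
    have "p (c *\<^sub>R v) = - p ((- c) *\<^sub>R v)" using odd[of "(- c) *\<^sub>R v"] by simp
    then show ?thesis using pos[of "- c" v] less by simp
  qed (auto simp: pos sublinear_zero[OF p])
qed

text \<open>
The one-sided derivative of \<open>p\<close> at \<open>g\<close> in the direction \<open>h\<close>: by homogeneity the difference quotient of step
\<open>1/s\<close> is \<open>p (h + s *\<^sub>R g) - s * p g\<close>, which decreases in \<open>s\<close>.
\<close>

definition tangent :: "('v::real_vector \<Rightarrow> real) \<Rightarrow> 'v \<Rightarrow> 'v \<Rightarrow> real" where
  "tangent p g h = (INF s\<in>{0..}. p (h + s *\<^sub>R g) - s * p g)"

lemma tangent_bdd:
  assumes p: "sublinear p"
  shows "bdd_below ((\<lambda>s. p (h + s *\<^sub>R g) - s * p g) ` {0..})"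
proof (rule bdd_belowI2)
  fix s :: real assume s: "s \<in> {0..}"
  have "p (s *\<^sub>R g) = s * p g"
  proof (cases "s = 0")
    case False
    then have s0: "s > 0" using s by simp
    have "p (inverse s *\<^sub>R (s *\<^sub>R g)) \<le> inverse s * p (s *\<^sub>R g)"
      using s0 by (intro sublinearD(2)[OF p]) auto
    then have "s * p g \<le> p (s *\<^sub>R g)" using s0 by (simp add: field_simps)
    then show ?thesis using sublinearD(2)[OF p s0, of g] by simp
  qed (simp add: sublinear_zero[OF p])
  then show "- p (- h) \<le> p (h + s *\<^sub>R g) - s * p g"
    using sublinearD(1)[OF p, of "h + s *\<^sub>R g" "- h"] by simp
qed

lemma tangent_le:
  assumes "sublinear p" "s \<ge> 0"
  shows "tangent p g h \<le> p (h + s *\<^sub>R g) - s * p g"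
  unfolding tangent_def using assms(2) by (intro cINF_lower tangent_bdd[OF assms(1)]) auto

lemma tangent_geI:
  assumes "\<And>s. s \<ge> 0 \<Longrightarrow> c \<le> p (h + s *\<^sub>R g) - s * p g"
  shows "c \<le> tangent p g h"
  unfolding tangent_def using assms by (intro cINF_greatest) auto

lemma tangent_le_self: "sublinear p \<Longrightarrow> tangent p g h \<le> p h"
  using tangent_le[of p 0 g h] by simp

text \<open>
Together with \<open>tangent_le_self\<close>, this makes the tangent linear on the line spanned by \<open>g\<close>.
\<close>

lemma tangent_neg: "sublinear p \<Longrightarrow> tangent p g (- g) \<le> - p g"
  using tangent_le[of p 1 g "- g"] sublinear_zero[of p] by simp

lemma sublinear_tangent:
  assumes p: "sublinear p"
  shows "sublinear (tangent p g)"
  unfolding sublinear_def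
proof (intro conjI allI impI)
  fix u v
  have "tangent p g (u + v) - (p (v + t *\<^sub>R g) - t * p g) \<le> tangent p g u" if t: "t \<ge> 0" for t
  proof (rule tangent_geI)
    fix s :: real assume s: "s \<ge> 0"
    have "tangent p g (u + v) \<le> p (u + v + (s + t) *\<^sub>R g) - (s + t) * p g"
      using s t by (intro tangent_le[OF p]) auto
    moreover have "p (u + v + (s + t) *\<^sub>R g) \<le> p (u + s *\<^sub>R g) + p (v + t *\<^sub>R g)"
      using sublinearD(1)[OF p, of "u + s *\<^sub>R g" "v + t *\<^sub>R g"] by (simp add: algebra_simps)
    ultimately show "tangent p g (u + v) - (p (v + t *\<^sub>R g) - t * p g) \<le> p (u + s *\<^sub>R g) - s * p g"
      by (simp add: algebra_simps)
  qed
  then have "tangent p g (u + v) - tangent p g u \<le> tangent p g v"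
    by (intro tangent_geI) (simp add: algebra_simps)
  then show "tangent p g (u + v) \<le> tangent p g u + tangent p g v" by simp
next
  fix c :: real and v assume c: "c > 0"
  have "tangent p g (c *\<^sub>R v) / c \<le> tangent p g v"
  proof (rule tangent_geI)
    fix s :: real assume s: "s \<ge> 0"
    have "tangent p g (c *\<^sub>R v) \<le> p (c *\<^sub>R v + (c * s) *\<^sub>R g) - (c * s) * p g"
      using s c by (intro tangent_le[OF p]) auto
    also have "p (c *\<^sub>R v + (c * s) *\<^sub>R g) \<le> c * p (v + s *\<^sub>R g)"
      using sublinearD(2)[OF p c, of "v + s *\<^sub>R g"] by (simp add: scaleR_add_right)
    finally show "tangent p g (c *\<^sub>R v) / c \<le> p (v + s *\<^sub>R g) - s * p g"
      using c by (simp add: field_simps)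
  qed
  then show "tangent p g (c *\<^sub>R v) \<le> c * tangent p g v"
    using c by (simp add: field_simps)
qed

text \<open>
In terms of convexity, the linear functionals below \<open>q\<close> form a face of the convex set of those below \<open>p\<close>.
\<close>

definition facial :: "('v::real_vector \<Rightarrow> real) \<Rightarrow> ('v \<Rightarrow> real) \<Rightarrow> bool" where
  "facial p q \<longleftrightarrow> (\<forall>L1 L2 a. linear L1 \<and> linear L2 \<and> L1 \<le> p \<and> L2 \<le> p \<and> 0 < a \<and> a < 1 \<and>
     (\<forall>v. a * L1 v + (1 - a) * L2 v \<le> q v) \<longrightarrow> L1 \<le> q \<and> L2 \<le> q)"

lemma linear_le_imp_eq:
  assumes "linear L" "linear L'" "L \<le> (L' :: 'v::real_vector \<Rightarrow> real)"
  shows "L = L'"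
proof
  fix v
  have "L v \<le> L' v" "L (- v) \<le> L' (- v)" using assms(3) by (auto simp: le_fun_def)
  then show "L v = L' v" using assms by (simp add: linear_neg)
qed

text \<open>
A functional below the tangent of \<open>q\<close> at \<open>g\<close> is a functional below \<open>q\<close> that attains the value \<open>q g\<close> at \<open>g\<close>. If a proper
convex combination attains this maximal value, then so do both of its terms.
\<close>

lemma facial_tangent:
  assumes q: "sublinear q" "facial p q"
  shows "facial p (tangent q g)"
  unfolding facial_def
proof (intro allI impI)
  fix L1 L2 a
  assume *: "linear L1 \<and> linear L2 \<and> L1 \<le> p \<and> L2 \<le> p \<and> 0 < a \<and> a < 1 \<and>
     (\<forall>v. a * L1 v + (1 - a) * L2 v \<le> tangent q g v)"
  then have l: "linear L1" "linear L2" and a: "0 < a" "a < 1"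
    and le: "\<And>v. a * L1 v + (1 - a) * L2 v \<le> tangent q g v" by auto
  have "\<And>v. a * L1 v + (1 - a) * L2 v \<le> q v"
    using le tangent_le_self[OF q(1)] by (meson order_trans)
  then have Lq: "L1 \<le> q" "L2 \<le> q" using q(2) * unfolding facial_def by blast+
  have "a * L1 (- g) + (1 - a) * L2 (- g) \<le> - q g"
    using le[of "- g"] tangent_neg[OF q(1), of g] by linarith
  then have sum: "a * (q g - L1 g) + (1 - a) * (q g - L2 g) \<le> 0"
    using l by (simp add: linear_neg algebra_simps)
  have nn: "q g - L1 g \<ge> 0" "q g - L2 g \<ge> 0" using Lq by (auto simp: le_fun_def)
  have "a * (q g - L1 g) \<ge> 0" "(1 - a) * (q g - L2 g) \<ge> 0" using nn a by auto
  then have "a * (q g - L1 g) = 0" "(1 - a) * (q g - L2 g) = 0" using sum by linarith+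
  then have eq: "L1 g = q g" "L2 g = q g" using a by auto
  have "L \<le> tangent q g" if "linear L" "L \<le> q" "L g = q g" for L
  proof (rule le_funI, rule tangent_geI)
    fix v and s :: real assume "s \<ge> 0"
    have "L v = L (v + s *\<^sub>R g) - s * q g"
      using that by (simp add: linear_add linear_cmul)
    also have "\<dots> \<le> q (v + s *\<^sub>R g) - s * q g" using that(2) by (simp add: le_fun_def)
    finally show "L v \<le> q (v + s *\<^sub>R g) - s * q g" .
  qed
  then show "L1 \<le> tangent q g \<and> L2 \<le> tangent q g" using l Lq eq by blast
qed

text \<open>
The lower bound required by Zorn's lemma. The infimum is subadditive because any two members of the chain can be
replaced by the smaller one of them.
\<close>

lemma facial_chain_Inf:
  assumes ne: "C \<noteq> {}"
    and C: "\<And>q. q \<in> C \<Longrightarrow> sublinear q \<and> q \<le> p \<and> facial p q"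
    and chain: "\<And>q r. q \<in> C \<Longrightarrow> r \<in> C \<Longrightarrow> q \<le> r \<or> r \<le> q"
  defines "i \<equiv> \<lambda>v. INF q\<in>C. q v"
  shows "sublinear i" "i \<le> p" "facial p i" "\<And>q. q \<in> C \<Longrightarrow> i \<le> q"
proof -
  have bdd: "bdd_below ((\<lambda>q. q v) ` C)" for v
  proof (rule bdd_belowI2)
    fix q assume "q \<in> C"
    then have "sublinear q" "q (- v) \<le> p (- v)" using C by (auto simp: le_fun_def)
    then show "- p (- v) \<le> q v" using sublinear_neg[of q v] by linarith
  qed
  have lower: "i v \<le> q v" if "q \<in> C" for q v
    unfolding i_def using that bdd by (intro cINF_lower) auto
  have greatest: "c \<le> i v" if "\<And>q. q \<in> C \<Longrightarrow> c \<le> q v" for c v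
    unfolding i_def using that ne by (intro cINF_greatest) auto
  show iq: "i \<le> q" if "q \<in> C" for q using lower[OF that] by (simp add: le_fun_def)
  obtain q0 where q0: "q0 \<in> C" using ne by auto
  show "i \<le> p" using iq[OF q0] C[OF q0] by (meson order_trans)
  show "sublinear i"
    unfolding sublinear_def
  proof (intro conjI allI impI)
    fix u v
    have "i (u + v) - q u \<le> i v" if q: "q \<in> C" for q
    proof (rule greatest)
      fix r assume r: "r \<in> C"
      obtain s where s: "s \<in> C" "s \<le> q" "s \<le> r" using chain[OF q r] q r by blast
      have "i (u + v) \<le> s u + s v"
        using lower[OF s(1), of "u + v"] C[OF s(1)] sublinearD(1)[of s u v] by linarith
      also have "\<dots> \<le> q u + r v" using s by (intro add_mono) (auto simp: le_fun_def)
      finally show "i (u + v) - q u \<le> r v" by simp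
    qed
    then have "i (u + v) - i v \<le> i u" by (intro greatest) (simp add: algebra_simps)
    then show "i (u + v) \<le> i u + i v" by simp
  next
    fix c :: real and v assume c: "c > 0"
    have "i (c *\<^sub>R v) / c \<le> i v"
    proof (rule greatest)
      fix q assume q: "q \<in> C"
      have "i (c *\<^sub>R v) \<le> c * q v"
        using lower[OF q, of "c *\<^sub>R v"] C[OF q] sublinearD(2)[of q c v] c by linarith
      then show "i (c *\<^sub>R v) / c \<le> q v" using c by (simp add: field_simps)
    qed
    then show "i (c *\<^sub>R v) \<le> c * i v" using c by (simp add: field_simps)
  qed
  show "facial p i"
    unfolding facial_def
  proof (intro allI impI)
    fix L1 L2 a
    assume *: "linear L1 \<and> linear L2 \<and> L1 \<le> p \<and> L2 \<le> p \<and> 0 < a \<and> a < 1 \<and>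
       (\<forall>v. a * L1 v + (1 - a) * L2 v \<le> i v)"
    have "L1 \<le> q \<and> L2 \<le> q" if q: "q \<in> C" for q
    proof -
      have "\<forall>v. a * L1 v + (1 - a) * L2 v \<le> q v" using * lower[OF q] by (meson order_trans)
      then show ?thesis using * C[OF q] unfolding facial_def by blast
    qed
    then show "L1 \<le> i \<and> L2 \<le> i" by (auto simp: le_fun_def intro!: greatest)
  qed
qed

text \<open>
Hahn-Banach and Krein-Milman in one application of Zorn's lemma to the facial sublinear functionals below \<open>p\<close>.
A minimal one coincides with all its tangents, so it is odd and therefore linear; that it is facial then says that it is
an extreme point.
\<close>

theorem extreme_dominated_functional:
  fixes p :: "'v::real_vector \<Rightarrow> real"
  assumes p: "sublinear p"
  obtains L where "linear L" "L \<le> p"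
    "\<And>L1 L2 a. linear L1 \<Longrightarrow> linear L2 \<Longrightarrow> L1 \<le> p \<Longrightarrow> L2 \<le> p \<Longrightarrow> 0 < a \<Longrightarrow> a < 1 \<Longrightarrow>
      (\<And>v. L v = a * L1 v + (1 - a) * L2 v) \<Longrightarrow> L1 = L \<and> L2 = L"
proof -
  define Q where "Q = {q. sublinear q \<and> q \<le> p \<and> facial p q}"
  have pQ: "p \<in> Q" using p by (auto simp: Q_def facial_def)
  have "\<exists>m\<in>Q. \<forall>q\<in>Q. q \<le> m \<longrightarrow> q = m"
  proof (rule predicate_Zorn)
    show "partial_order_on Q (relation_of (\<ge>) Q)"
      by (rule partial_order_on_relation_ofI) auto
    fix C assume C: "C \<in> Chains (relation_of (\<ge>) Q)"
    then have CQ: "C \<subseteq> Q" by (auto simp: Chains_def relation_of_def)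
    have chain: "q \<le> r \<or> r \<le> q" if "q \<in> C" "r \<in> C" for q r
      using C that by (auto simp: Chains_def relation_of_def)
    show "\<exists>u\<in>Q. \<forall>q\<in>C. u \<le> q"
    proof (cases "C = {}")
      case False
      have "\<And>q. q \<in> C \<Longrightarrow> sublinear q \<and> q \<le> p \<and> facial p q" using CQ by (auto simp: Q_def)
      from facial_chain_Inf[OF False this chain] show ?thesis
        by (intro bexI[of _ "\<lambda>v. INF q\<in>C. q v"]) (auto simp: Q_def)
    qed (use pQ in auto)
  qed
  then obtain L where L: "L \<in> Q" and min: "\<And>q. q \<in> Q \<Longrightarrow> q \<le> L \<Longrightarrow> q = L" by blast
  have sL: "sublinear L" and Lp: "L \<le> p" and fL: "facial p L" using L by (auto simp: Q_def)
  have "tangent L g = L" for g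
  proof (rule min)
    show le: "tangent L g \<le> L" using tangent_le_self[OF sL] by (simp add: le_fun_def)
    show "tangent L g \<in> Q"
      using sublinear_tangent[OF sL] facial_tangent[OF sL fL] le Lp by (auto simp: Q_def)
  qed
  then have "L (- v) = - L v" for v
    using tangent_neg[OF sL, of v] sublinear_neg[OF sL, of v] by simp
  then have lin: "linear L" by (intro sublinear_odd_imp_linear sL)
  show thesis
  proof (rule that[OF lin Lp])
    fix L1 L2 :: "'v \<Rightarrow> real" and a :: real
    assume l: "linear L1" "linear L2" "L1 \<le> p" "L2 \<le> p" "0 < a" "a < 1"
      and eq: "\<And>v. L v = a * L1 v + (1 - a) * L2 v"
    have "L1 \<le> L \<and> L2 \<le> L" using fL l eq unfolding facial_def
      by (metis order_refl)
    then show "L1 = L \<and> L2 = L" using l lin linear_le_imp_eq by blast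
  qed
qed

text \<open>
Any linear functional below the tangent of \<open>p\<close> at \<open>g\<close> has the required value.
\<close>

lemma attaining_dominated_functional:
  assumes p: "sublinear p"
  obtains L where "linear L" "L \<le> p" "L g = p g"
proof -
  obtain L where L: "linear L" "L \<le> tangent p g"
    using extreme_dominated_functional[OF sublinear_tangent[OF p, of g]] by metis
  have le: "tangent p g \<le> p" using tangent_le_self[OF p] by (simp add: le_fun_def)
  have "- L g \<le> - p g"
    using L tangent_neg[OF p, of g] le_funD[OF L(2), of "- g"] by (simp add: linear_neg)
  moreover have "L g \<le> p g" using le_funD[OF L(2), of g] le_funD[OF le, of g] by simp
  ultimately show thesis using that[OF L(1)] L(2) le by (simp add: order_trans)
qed

section \<open>Riesz representation of means on a compact metric space\<close>

text \<open>
Comparison with constants from above encodes positivity and total mass one at the same time.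
\<close>

definition mean :: "(('a::metric_space \<Rightarrow>\<^sub>C real) \<Rightarrow> real) \<Rightarrow> bool" where
  "mean L \<longleftrightarrow> linear L \<and> (\<forall>g c. (\<forall>x. apply_bcontfun g x \<le> c) \<longrightarrow> L g \<le> c)"

lemma mean_linear: "mean L \<Longrightarrow> linear L"
  by (simp add: mean_def)

lemma mean_le: "mean L \<Longrightarrow> (\<And>x. apply_bcontfun g x \<le> c) \<Longrightarrow> L g \<le> c"
  by (simp add: mean_def)

lemmas mean_simps = linear_add[OF mean_linear] linear_diff[OF mean_linear] linear_neg[OF mean_linear]
  linear_cmul[OF mean_linear] linear_0[OF mean_linear] linear_sum[OF mean_linear]

lemma apply_Bcontfun_compact:
  fixes g :: "'a::metric_space \<Rightarrow> real"
  assumes "compact (UNIV :: 'a set)" "continuous_on UNIV g"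
  shows "apply_bcontfun (Bcontfun g) = g"
  by (rule Bcontfun_inverse)
     (use assms in \<open>auto simp: bcontfun_def intro!: compact_imp_bounded compact_continuous_image\<close>)

lemma mean_mono:
  assumes "mean L" "\<And>x. apply_bcontfun g x \<le> apply_bcontfun h x"
  shows "L g \<le> L h"
proof -
  have "L (g - h) \<le> 0" by (rule mean_le[OF assms(1)]) (use assms(2) in simp)
  then show ?thesis using assms(1) by (simp add: mean_simps)
qed

lemma mean_nonneg:
  assumes "mean L" "\<And>x. 0 \<le> apply_bcontfun g x"
  shows "0 \<le> L g"
  using mean_mono[of L 0 g] assms by (simp add: mean_simps)

lemma mean_const:
  assumes "mean L" shows "L (const_bcontfun c) = c"
proof (rule antisym)
  show "L (const_bcontfun c) \<le> c"
    by (rule mean_le[OF assms]) (simp add: const_bcontfun.rep_eq)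
  have "L (- const_bcontfun c) \<le> - c"
    by (rule mean_le[OF assms]) (simp add: const_bcontfun.rep_eq)
  then show "c \<le> L (const_bcontfun c)" using assms by (simp add: mean_simps)
qed

lemma le_indicator_pos: "a \<le> indicator A x \<Longrightarrow> 0 < a \<Longrightarrow> x \<in> A" for a :: real
  by (cases "x \<in> A") auto

lemma below_indicator_nonempty:
  "{g :: 'a::metric_space \<Rightarrow>\<^sub>C real. \<forall>x. 0 \<le> apply_bcontfun g x \<and> apply_bcontfun g x \<le> indicator A x} \<noteq> {}"
  (is "?S \<noteq> {}")
proof
  assume e: "?S = {}"
  have "0 \<in> ?S" by simp
  then show False unfolding e by (rule emptyE)
qed

text \<open>
The measure that an open set must have if \<open>L\<close> is integration: the supremum over continuous functions below its
indicator. The value is an extended real so that suprema and series need no side conditions.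
\<close>

definition inner_content :: "(('a::metric_space \<Rightarrow>\<^sub>C real) \<Rightarrow> real) \<Rightarrow> 'a set \<Rightarrow> ennreal" where
  "inner_content L U = (SUP g\<in>{g. \<forall>x. 0 \<le> apply_bcontfun g x \<and> apply_bcontfun g x \<le> indicator U x}. ennreal (L g))"

definition riesz_outer :: "(('a::metric_space \<Rightarrow>\<^sub>C real) \<Rightarrow> real) \<Rightarrow> 'a set \<Rightarrow> ennreal" where
  "riesz_outer L A = (INF U\<in>{U. open U \<and> A \<subseteq> U}. inner_content L U)"

definition riesz_measure :: "(('a::metric_space \<Rightarrow>\<^sub>C real) \<Rightarrow> real) \<Rightarrow> 'a measure" where
  "riesz_measure L = measure_of UNIV (sets borel) (riesz_outer L)"

lemma inner_content_upper:
  assumes "\<And>x. 0 \<le> apply_bcontfun g x" "\<And>x. apply_bcontfun g x \<le> indicator U x"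
  shows "ennreal (L g) \<le> inner_content L U"
  unfolding inner_content_def using assms by (intro SUP_upper) auto

lemma inner_content_least:
  assumes "\<And>g. (\<And>x. 0 \<le> apply_bcontfun g x) \<Longrightarrow> (\<And>x. apply_bcontfun g x \<le> indicator U x) \<Longrightarrow> ennreal (L g) \<le> c"
  shows "inner_content L U \<le> c"
  unfolding inner_content_def using assms by (intro SUP_least) auto

lemma inner_content_mono:
  assumes "U \<subseteq> V" shows "inner_content L U \<le> inner_content L V"
proof (rule inner_content_least, rule inner_content_upper)
  fix g :: "'a \<Rightarrow>\<^sub>C real" and x
  assume g: "\<And>x. 0 \<le> apply_bcontfun g x" "\<And>x. apply_bcontfun g x \<le> indicator U x"
  show "0 \<le> apply_bcontfun g x" by (rule g)
  have "indicator U x \<le> (indicator V x :: real)" using assms by (auto simp: indicator_def)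
  then show "apply_bcontfun g x \<le> indicator V x" using g(2)[of x] by linarith
qed

lemma riesz_outer_open: "open U \<Longrightarrow> riesz_outer L U = inner_content L U"
  unfolding riesz_outer_def
  by (intro antisym INF_greatest INF_lower) (auto intro: inner_content_mono)

lemma riesz_outer_mono: "A \<subseteq> B \<Longrightarrow> riesz_outer L A \<le> riesz_outer L B"
  unfolding riesz_outer_def by (intro INF_superset_mono) auto

lemma riesz_outer_le: "open U \<Longrightarrow> A \<subseteq> U \<Longrightarrow> riesz_outer L A \<le> inner_content L U"
  unfolding riesz_outer_def by (intro INF_lower) auto

lemma inner_content_empty:
  assumes "mean L" shows "inner_content L {} = 0"
proof -
  have "inner_content L {} \<le> 0"
  proof (rule inner_content_least)
    fix g :: "'a \<Rightarrow>\<^sub>C real" assume "\<And>x. apply_bcontfun g x \<le> indicator {} x"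
    then have "L g \<le> 0" by (intro mean_le[OF assms]) (simp add: indicator_def)
    then show "ennreal (L g) \<le> 0" by (simp add: ennreal_neg)
  qed
  then show ?thesis by simp
qed

lemma inner_content_UNIV:
  assumes "mean L" shows "inner_content L UNIV = 1"
proof (rule antisym)
  show "inner_content L UNIV \<le> 1"
  proof (rule inner_content_least)
    fix g :: "'a \<Rightarrow>\<^sub>C real" assume "\<And>x. apply_bcontfun g x \<le> indicator UNIV x"
    then have "L g \<le> 1" by (intro mean_le[OF assms]) (simp add: indicator_def)
    then show "ennreal (L g) \<le> 1" by simp
  qed
  have "ennreal (L (const_bcontfun 1)) \<le> inner_content L UNIV"
    by (rule inner_content_upper) (auto simp: const_bcontfun.rep_eq)
  then show "1 \<le> inner_content L UNIV" by (simp add: mean_const[OF assms])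
qed

text \<open>
Removing the part of a function below the level \<open>e\<close> lowers its mean by at most \<open>e\<close> and confines its support to a
closed, hence compact, set.
\<close>

definition cutoff :: "real \<Rightarrow> ('a::metric_space \<Rightarrow>\<^sub>C real) \<Rightarrow> 'a \<Rightarrow>\<^sub>C real" where
  "cutoff e g = Bcontfun (\<lambda>x. max 0 (apply_bcontfun g x - e))"

lemma cutoff_apply:
  assumes "compact (UNIV :: 'a::metric_space set)"
  shows "apply_bcontfun (cutoff e g) (x :: 'a) = max 0 (apply_bcontfun g x - e)"
  unfolding cutoff_def
  by (subst apply_Bcontfun_compact) (auto intro!: assms continuous_intros)

lemma mean_cutoff:
  assumes "compact (UNIV :: 'a::metric_space set)" and L: "mean L"
  shows "L (g :: 'a \<Rightarrow>\<^sub>C real) \<le> L (cutoff e g) + e"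
proof -
  have "L g \<le> L (cutoff e g + const_bcontfun e)"
    by (rule mean_mono[OF L]) (auto simp: cutoff_apply[OF assms(1)] const_bcontfun.rep_eq)
  also have "\<dots> = L (cutoff e g) + e" using L by (simp add: mean_simps mean_const)
  finally show ?thesis .
qed

text \<open>
Partition of unity: the pieces are weighted by the distances to the complements of the sets of the cover.
\<close>

lemma partition_subordinate:
  fixes g :: "'a::metric_space \<Rightarrow>\<^sub>C real"
  assumes cpt: "compact (UNIV :: 'a set)" and fin: "finite I" and op: "\<And>i. i \<in> I \<Longrightarrow> open (U i)"
    and g: "\<And>x. 0 \<le> apply_bcontfun g x" "\<And>x. apply_bcontfun g x \<le> 1"
    and cov: "{x. e \<le> apply_bcontfun g x} \<subseteq> (\<Union>i\<in>I. U i)" and e: "e > 0"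
  obtains h where "\<And>i x. i \<in> I \<Longrightarrow> 0 \<le> apply_bcontfun (h i) x"
    "\<And>i x. i \<in> I \<Longrightarrow> apply_bcontfun (h i) x \<le> indicator (U i) x"
    "cutoff e g = (\<Sum>i\<in>I. h i)"
proof -
  define d where "d i x = (if U i = UNIV then 1 else infdist x (- U i))" for i and x :: 'a
  have d_cont: "continuous_on UNIV (d i)" for i
    unfolding d_def by (cases "U i = UNIV") (auto intro!: continuous_intros)
  have d_nn: "d i x \<ge> 0" for i x by (simp add: d_def infdist_nonneg)
  have d_pos: "d i x > 0 \<longleftrightarrow> x \<in> U i" if "i \<in> I" for i x
  proof (cases "U i = UNIV")
    case False
    have "closed (- U i)" using op[OF that] by auto
    then have "x \<in> - U i \<longleftrightarrow> infdist x (- U i) = 0"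
      using False by (intro in_closed_iff_infdist_zero) auto
    then show ?thesis using False infdist_nonneg[of x "- U i"] by (auto simp: d_def)
  qed (simp add: d_def)
  define s where "s x = (\<Sum>i\<in>I. d i x)" for x
  have s_cont: "continuous_on UNIV s" unfolding s_def by (intro continuous_intros d_cont)
  define K where "K = {x. e \<le> apply_bcontfun g x}"
  have "closed K" unfolding K_def by (intro closed_Collect_le continuous_intros continuous_on_apply_bcontfun)
  then have K: "compact K" using compact_Int_closed[OF cpt] by (metis Int_UNIV_left)
  have sK: "s x > 0" if x: "x \<in> K" for x
  proof -
    obtain i where "i \<in> I" "x \<in> U i" using cov x unfolding K_def by blast
    then show ?thesis unfolding s_def using fin d_nn d_pos by (intro sum_pos2) auto
  qed
  obtain \<delta> where \<delta>: "\<delta> > 0" "\<And>x. x \<in> K \<Longrightarrow> \<delta> \<le> s x"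
  proof (cases "K = {}")
    case False
    then obtain x where "x \<in> K" "\<And>y. y \<in> K \<Longrightarrow> s x \<le> s y"
      using continuous_attains_inf[OF K, of s] s_cont by (meson continuous_on_subset subset_UNIV)
    then show thesis using sK that by blast
  qed (use that[of 1] in auto)
  \<comment> \<open>The lower bound \<open>\<delta>\<close> in the denominator keeps the quotient continuous where all weights vanish; on \<open>K\<close> it has no effect.\<close>
  define h where "h i = Bcontfun (\<lambda>x. max 0 (apply_bcontfun g x - e) * d i x / max \<delta> (s x))" for i
  have h: "apply_bcontfun (h i) x = max 0 (apply_bcontfun g x - e) * d i x / max \<delta> (s x)" for i x
    unfolding h_def using \<delta>
    by (subst apply_Bcontfun_compact[OF cpt])
       (auto intro!: continuous_intros d_cont s_cont dest: less_max_iff_disj[THEN iffD2, THEN less_imp_neq])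
  have di: "d i x \<le> s x" if "i \<in> I" for i x
    unfolding s_def using that fin d_nn by (intro member_le_sum) auto
  show thesis
  proof (rule that)
    fix i x assume i: "i \<in> I"
    show "0 \<le> apply_bcontfun (h i) x" using d_nn[of i x] \<delta> by (auto simp: h)
    have q: "d i x / max \<delta> (s x) \<le> 1" using di[OF i, of x] \<delta>(1) by (simp add: divide_le_eq le_max_iff_disj)
    show "apply_bcontfun (h i) x \<le> indicator (U i) x"
    proof (cases "x \<in> U i")
      case True
      have "max 0 (apply_bcontfun g x - e) * (d i x / max \<delta> (s x)) \<le> 1 * 1"
        using g(2)[of x] q e d_nn[of i x] \<delta> by (intro mult_mono) auto
      then show ?thesis using True by (simp add: h)
    next
      case False
      then have "d i x = 0" using d_pos[OF i, of x] d_nn[of i x] by auto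
      then show ?thesis using False by (simp add: h)
    qed
  next
    show "cutoff e g = (\<Sum>i\<in>I. h i)"
    proof (rule bcontfun_eqI)
      fix x
      have "apply_bcontfun (\<Sum>i\<in>I. h i) x = (\<Sum>i\<in>I. apply_bcontfun (h i) x)"
        using fin by (induction I rule: finite_induct) auto
      also have "\<dots> = max 0 (apply_bcontfun g x - e) * s x / max \<delta> (s x)"
        by (simp add: h s_def sum_distrib_left sum_divide_distrib)
      also have "\<dots> = max 0 (apply_bcontfun g x - e)"
      proof (cases "x \<in> K")
        case True
        then have "max \<delta> (s x) = s x" "s x > 0" using \<delta>(2) sK by (auto simp: max_absorb2)
        then show ?thesis by simp
      qed (simp add: K_def)
      finally show "apply_bcontfun (cutoff e g) x = apply_bcontfun (\<Sum>i\<in>I. h i) x"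
        by (simp add: cutoff_apply[OF cpt])
    qed
  qed
qed

text \<open>
After a cutoff, compactness leaves finitely many of the sets, and the function splits into pieces below their
indicators.
\<close>

lemma inner_content_countably_subadditive:
  fixes L :: "('a::metric_space \<Rightarrow>\<^sub>C real) \<Rightarrow> real" and U :: "nat \<Rightarrow> 'a set"
  assumes cpt: "compact (UNIV :: 'a set)" and L: "mean L" and op: "\<And>i. open (U i)"
  shows "inner_content L (\<Union>i. U i) \<le> (\<Sum>i. inner_content L (U i))"
proof (rule inner_content_least)
  fix g :: "'a \<Rightarrow>\<^sub>C real"
  assume g: "\<And>x. 0 \<le> apply_bcontfun g x" "\<And>x. apply_bcontfun g x \<le> indicator (\<Union>i. U i) x"
  show "ennreal (L g) \<le> (\<Sum>i. inner_content L (U i))"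
  proof (rule ennreal_le_epsilon)
    fix e :: real assume e: "0 < e"
    have g1: "apply_bcontfun g x \<le> 1" for x using order_trans[OF g(2)[of x] indicator_le_1] .
    define K where "K = {x. e \<le> apply_bcontfun g x}"
    have "closed K" unfolding K_def by (intro closed_Collect_le continuous_intros continuous_on_apply_bcontfun)
    then have K: "compact K" using compact_Int_closed[OF cpt] by (metis Int_UNIV_left)
    have "K \<subseteq> (\<Union>i\<in>UNIV. U i)"
    proof
      fix x assume "x \<in> K"
      then have "apply_bcontfun g x > 0" using e by (simp add: K_def)
      with g(2)[of x] show "x \<in> (\<Union>i\<in>UNIV. U i)" by (rule le_indicator_pos)
    qed
    then obtain I where I: "finite I" "K \<subseteq> (\<Union>i\<in>I. U i)"
      by (rule compactE_image[OF K op])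
    obtain h where h: "\<And>i x. i \<in> I \<Longrightarrow> 0 \<le> apply_bcontfun (h i) x"
       "\<And>i x. i \<in> I \<Longrightarrow> apply_bcontfun (h i) x \<le> indicator (U i) x"
       "cutoff e g = (\<Sum>i\<in>I. h i)"
      using partition_subordinate[OF cpt I(1) op g(1) g1 I(2)[unfolded K_def] e] by metis
    have Lh: "0 \<le> L (h i)" if "i \<in> I" for i
      by (rule mean_nonneg[OF L]) (rule h(1)[OF that])
    have "L g \<le> (\<Sum>i\<in>I. L (h i)) + e"
      using mean_cutoff[OF cpt L, of g e] h(3) L by (simp add: mean_simps)
    then have "ennreal (L g) \<le> ennreal ((\<Sum>i\<in>I. L (h i)) + e)" by (rule ennreal_leI)
    also have "\<dots> = (\<Sum>i\<in>I. ennreal (L (h i))) + ennreal e"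
      using e Lh by (subst ennreal_plus) (auto intro!: sum_nonneg simp: sum_ennreal)
    also have "(\<Sum>i\<in>I. ennreal (L (h i))) \<le> (\<Sum>i\<in>I. inner_content L (U i))"
      using h by (intro sum_mono inner_content_upper) auto
    also have "\<dots> \<le> (\<Sum>i. inner_content L (U i))"
      using I by (intro sum_le_suminf) auto
    finally show "ennreal (L g) \<le> (\<Sum>i. inner_content L (U i)) + ennreal e" by (simp add: add_right_mono)
  qed
qed

lemma riesz_outer_measure_space:
  fixes L :: "('a::metric_space \<Rightarrow>\<^sub>C real) \<Rightarrow> real"
  assumes cpt: "compact (UNIV :: 'a set)" and L: "mean L"
  shows "outer_measure_space (Pow UNIV) (riesz_outer L)"
  unfolding outer_measure_space_def
proof (intro conjI)
  show "positive (Pow UNIV) (riesz_outer L)"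
    by (simp add: positive_def riesz_outer_open inner_content_empty[OF L])
  show "increasing (Pow UNIV) (riesz_outer L)"
    by (simp add: increasing_def riesz_outer_mono)
  show "countably_subadditive (Pow UNIV) (riesz_outer L)"
    unfolding countably_subadditive_def
  proof (intro allI impI)
    fix A :: "nat \<Rightarrow> 'a set"
    show "riesz_outer L (\<Union>i. A i) \<le> (\<Sum>i. riesz_outer L (A i))"
    proof (rule ennreal_le_epsilon)
      fix e :: real assume e: "0 < e" and fin: "(\<Sum>i. riesz_outer L (A i)) < top"
      have "\<exists>U. open U \<and> A i \<subseteq> U \<and> inner_content L U \<le> riesz_outer L (A i) + ennreal (e * (1/2) ^ Suc i)" for i
      proof -
        have "riesz_outer L (A i) \<noteq> top"
          using riesz_outer_le[of UNIV "A i" L] inner_content_UNIV[OF L]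
          by (metis ennreal_one_less_top leD open_UNIV subset_UNIV)
        then have "riesz_outer L (A i) < riesz_outer L (A i) + ennreal (e * (1/2) ^ Suc i)"
          using e by (simp add: ennreal_add_left_cancel_less)
        then show ?thesis
          unfolding riesz_outer_def[of L "A i"] INF_less_iff by (auto intro: less_imp_le)
      qed
      then obtain U where U: "\<And>i. open (U i)" "\<And>i. A i \<subseteq> U i"
        "\<And>i. inner_content L (U i) \<le> riesz_outer L (A i) + ennreal (e * (1/2) ^ Suc i)" by metis
      have "riesz_outer L (\<Union>i. A i) \<le> inner_content L (\<Union>i. U i)"
        using U by (intro riesz_outer_le) auto
      also have "\<dots> \<le> (\<Sum>i. inner_content L (U i))"
        by (rule inner_content_countably_subadditive[OF cpt L U(1)])
      also have "\<dots> \<le> (\<Sum>i. riesz_outer L (A i) + ennreal (e * (1/2) ^ Suc i))"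
        by (intro suminf_le U) auto
      also have "\<dots> = (\<Sum>i. riesz_outer L (A i)) + (\<Sum>i. ennreal (e * (1/2) ^ Suc i))"
        by (intro suminf_add[symmetric]) auto
      also have "(\<Sum>i. ennreal (e * (1/2) ^ Suc i)) = ennreal e"
      proof -
        have "(\<lambda>i. e * (1/2) ^ Suc i) sums (e * 1)"
          by (intro sums_mult power_half_series)
        then show ?thesis using e by (subst suminf_ennreal_eq) auto
      qed
      finally show "riesz_outer L (\<Union>i. A i) \<le> (\<Sum>i. riesz_outer L (A i)) + ennreal e" .
    qed
  qed
qed

text \<open>
The inequality behind the Caratheodory condition for \<open>U\<close>. A cutoff of a function below the indicator of \<open>V \<inter> U\<close>
lives on a closed subset \<open>K\<close> of \<open>V \<inter> U\<close>, so it can be added to any function below the indicator of \<open>V - K\<close>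
without exceeding the indicator of \<open>V\<close>.
\<close>

lemma inner_content_superadditive:
  fixes L :: "('a::metric_space \<Rightarrow>\<^sub>C real) \<Rightarrow> real"
  assumes cpt: "compact (UNIV :: 'a set)" and L: "mean L" and U: "open U" and V: "open V"
  shows "inner_content L (V \<inter> U) + riesz_outer L (V - U) \<le> inner_content L V"
proof -
  have "ennreal (L g) + riesz_outer L (V - U) \<le> inner_content L V"
    if g: "\<And>x. 0 \<le> apply_bcontfun g x" "\<And>x. apply_bcontfun g x \<le> indicator (V \<inter> U) x" for g
  proof (rule ennreal_le_epsilon)
    fix e :: real assume e: "0 < e"
    define K where "K = {x. e \<le> apply_bcontfun g x}"
    have "closed K" unfolding K_def by (intro closed_Collect_le continuous_intros continuous_on_apply_bcontfun)
    then have "open (V - K)" using V by auto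
    have KU: "x \<in> V \<inter> U" if "x \<in> K" for x
      by (rule le_indicator_pos[OF g(2)]) (use that e in \<open>auto simp: K_def\<close>)
    have "riesz_outer L (V - U) \<le> inner_content L (V - K)"
      using KU \<open>open (V - K)\<close> by (intro riesz_outer_le) auto
    also have "ennreal (L (cutoff e g)) + inner_content L (V - K) \<le> inner_content L V"
    proof -
      have ne: "{h :: 'a \<Rightarrow>\<^sub>C real. \<forall>x. 0 \<le> apply_bcontfun h x \<and> apply_bcontfun h x \<le> indicator (V - K) x} \<noteq> {}"
        by (rule below_indicator_nonempty)
      have "ennreal (L (cutoff e g)) + ennreal (L h) \<le> inner_content L V"
        if h: "\<forall>x. 0 \<le> apply_bcontfun h x \<and> apply_bcontfun h x \<le> indicator (V - K) x" for h
      proof -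
        have c0: "0 \<le> apply_bcontfun (cutoff e g) x" for x by (simp add: cutoff_apply[OF cpt])
        have "ennreal (L (cutoff e g)) + ennreal (L h) = ennreal (L (cutoff e g + h))"
          using h c0 L by (simp add: mean_simps mean_nonneg flip: ennreal_plus)
        also have "\<dots> \<le> inner_content L V"
        proof (rule inner_content_upper)
          fix x
          show "0 \<le> apply_bcontfun (cutoff e g + h) x" using c0 h by simp
          have hx: "apply_bcontfun h x \<le> indicator (V - K) x" using h by blast
          show "apply_bcontfun (cutoff e g + h) x \<le> indicator V x"
          proof (cases "x \<in> K")
            case True
            then have "x \<in> V" "x \<in> U" using KU by auto
            then show ?thesis using hx g(2)[of x] True e by (simp add: cutoff_apply[OF cpt])
          next
            case False
            then show ?thesis using hx
              by (auto simp: cutoff_apply[OF cpt] K_def indicator_def split: if_splits)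
          qed
        qed
        finally show ?thesis .
      qed
      then show ?thesis
        unfolding inner_content_def[of L "V - K"]
        by (subst ennreal_SUP_add_right[OF ne]) (auto intro!: SUP_least)
    qed
    finally have *: "ennreal (L (cutoff e g)) + riesz_outer L (V - U) \<le> inner_content L V"
      by (simp add: add_left_mono)
    have "ennreal (L g) \<le> ennreal (L (cutoff e g) + e)"
      by (intro ennreal_leI mean_cutoff cpt L)
    also have "\<dots> = ennreal (L (cutoff e g)) + ennreal e"
      using e by (intro ennreal_plus mean_nonneg[OF L]) (auto simp: cutoff_apply[OF cpt])
    finally have "ennreal (L g) + riesz_outer L (V - U) \<le>
        (ennreal (L (cutoff e g)) + ennreal e) + riesz_outer L (V - U)" by (rule add_right_mono)
    also have "\<dots> = (ennreal (L (cutoff e g)) + riesz_outer L (V - U)) + ennreal e"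
      by (simp add: ac_simps)
    also have "\<dots> \<le> inner_content L V + ennreal e" using * by (rule add_right_mono)
    finally show "ennreal (L g) + riesz_outer L (V - U) \<le> inner_content L V + ennreal e" .
  qed
  moreover have "{h :: 'a \<Rightarrow>\<^sub>C real. \<forall>x. 0 \<le> apply_bcontfun h x \<and> apply_bcontfun h x \<le> indicator (V \<inter> U) x} \<noteq> {}"
    by (rule below_indicator_nonempty)
  ultimately show ?thesis
    unfolding inner_content_def[of L "V \<inter> U"]
    by (subst ennreal_SUP_add_left[symmetric]) (auto intro!: SUP_least)
qed

lemma open_in_riesz_lambda_system:
  fixes L :: "('a::metric_space \<Rightarrow>\<^sub>C real) \<Rightarrow> real"
  assumes cpt: "compact (UNIV :: 'a set)" and L: "mean L" and U: "open U"
  shows "U \<in> lambda_system UNIV (Pow UNIV) (riesz_outer L)"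
proof -
  note oms = riesz_outer_measure_space[OF cpt L]
  interpret sigma_algebra "UNIV :: 'a set" "Pow UNIV" by (rule sigma_algebra_Pow)
  have "riesz_outer L (U \<inter> A) + riesz_outer L ((UNIV - U) \<inter> A) = riesz_outer L A" for A
  proof (rule antisym)
    have "subadditive (Pow UNIV) (riesz_outer L)"
      by (rule countably_subadditive_subadditive)
         (rule oms[unfolded outer_measure_space_def, THEN conjunct1]
            oms[unfolded outer_measure_space_def, THEN conjunct2, THEN conjunct2])+
    then have "riesz_outer L ((U \<inter> A) \<union> ((UNIV - U) \<inter> A)) \<le> riesz_outer L (U \<inter> A) + riesz_outer L ((UNIV - U) \<inter> A)"
      by (rule subadditiveD) auto
    moreover have "(U \<inter> A) \<union> ((UNIV - U) \<inter> A) = A" by auto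
    ultimately show "riesz_outer L A \<le> riesz_outer L (U \<inter> A) + riesz_outer L ((UNIV - U) \<inter> A)" by simp
    show "riesz_outer L (U \<inter> A) + riesz_outer L ((UNIV - U) \<inter> A) \<le> riesz_outer L A"
      unfolding riesz_outer_def[of L A]
    proof (rule INF_greatest)
      fix V assume "V \<in> {U. open U \<and> A \<subseteq> U}"
      then have V: "open V" "A \<subseteq> V" by auto
      have "riesz_outer L (U \<inter> A) \<le> inner_content L (V \<inter> U)"
        using V U by (intro riesz_outer_le) auto
      moreover have "riesz_outer L ((UNIV - U) \<inter> A) \<le> riesz_outer L (V - U)"
        using V by (intro riesz_outer_mono) auto
      ultimately have "riesz_outer L (U \<inter> A) + riesz_outer L ((UNIV - U) \<inter> A) \<le>
          inner_content L (V \<inter> U) + riesz_outer L (V - U)" by (rule add_mono)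
      also have "\<dots> \<le> inner_content L V" by (rule inner_content_superadditive[OF cpt L U V(1)])
      finally show "riesz_outer L (U \<inter> A) + riesz_outer L ((UNIV - U) \<inter> A) \<le> inner_content L V" .
    qed
  qed
  then show ?thesis unfolding lambda_system_def by auto
qed

lemma sets_riesz_measure [simp]: "sets (riesz_measure L) = sets borel"
  and space_riesz_measure [simp]: "space (riesz_measure L) = UNIV"
proof -
  have "sigma_algebra UNIV (sets (borel :: 'a measure))"
    using sets.sigma_algebra_axioms[of "borel :: 'a measure"] by simp
  then show "sets (riesz_measure L) = sets borel"
    unfolding riesz_measure_def
    by (simp add: sigma_algebra.sigma_sets_eq)
qed (simp add: riesz_measure_def space_measure_of_conv)

lemma emeasure_riesz_measure:
  fixes L :: "('a::metric_space \<Rightarrow>\<^sub>C real) \<Rightarrow> real"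
  assumes cpt: "compact (UNIV :: 'a set)" and L: "mean L" and B: "B \<in> sets borel"
  shows "emeasure (riesz_measure L) B = riesz_outer L B"
proof -
  have ms: "measure_space UNIV (lambda_system UNIV (Pow UNIV) (riesz_outer L)) (riesz_outer L)"
    by (rule sigma_algebra.caratheodory_lemma[OF sigma_algebra_Pow riesz_outer_measure_space[OF cpt L]])
  have sa: "sigma_algebra UNIV (sets (borel :: 'a measure))"
    using sets.sigma_algebra_axioms[of "borel :: 'a measure"] by simp
  have "sigma_algebra UNIV (lambda_system UNIV (Pow UNIV) (riesz_outer L))"
    using ms by (simp add: measure_space_def)
  then have "sigma_sets UNIV {U::'a set. open U} \<subseteq> lambda_system UNIV (Pow UNIV) (riesz_outer L)"
    using open_in_riesz_lambda_system[OF cpt L]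
    by (intro sigma_algebra.sigma_sets_subset) auto
  then have "sets (borel :: 'a measure) \<subseteq> lambda_system UNIV (Pow UNIV) (riesz_outer L)"
    by (simp add: borel_def)
  then have m: "measure_space UNIV (sets (borel :: 'a measure)) (riesz_outer L)"
    by (rule measure_down[OF ms sa])
  have "emeasure (measure_of UNIV (sets (borel :: 'a measure)) (riesz_outer L)) B = riesz_outer L B"
    using m B by (intro emeasure_measure_of_sigma) (auto simp: measure_space_def)
  then show ?thesis by (simp add: riesz_measure_def)
qed

lemma prob_space_riesz:
  fixes L :: "('a::metric_space \<Rightarrow>\<^sub>C real) \<Rightarrow> real"
  assumes cpt: "compact (UNIV :: 'a set)" and L: "mean L"
  shows "prob_space (riesz_measure L)"
  by (rule prob_spaceI)
     (simp add: emeasure_riesz_measure[OF cpt L] riesz_outer_open inner_content_UNIV[OF L])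

lemma bcontfun_boundedE:
  fixes g :: "'a::metric_space \<Rightarrow>\<^sub>C real"
  obtains B where "B > 0" "\<And>x. \<bar>apply_bcontfun g x\<bar> \<le> B"
proof -
  obtain B where "\<And>x. \<bar>apply_bcontfun g x\<bar> \<le> B"
    using bounded_apply_bcontfun[of g] unfolding bounded_iff by auto
  then show thesis by (intro that[of "max B 1"]) (simp_all add: le_max_iff_disj)
qed

lemma bcontfun_integrable:
  fixes g :: "'a::metric_space \<Rightarrow>\<^sub>C real"
  assumes "finite_measure M" "sets M = sets borel"
  shows "integrable M (apply_bcontfun g)"
proof -
  interpret finite_measure M by fact
  obtain B where B: "\<And>x. \<bar>apply_bcontfun g x\<bar> \<le> B"
    using bcontfun_boundedE[of g] by metis
  show ?thesis
  proof (rule integrable_const_bound[of _ B])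
    show "apply_bcontfun g \<in> borel_measurable M"
      unfolding measurable_cong_sets[OF assms(2) refl] by (intro borel_measurable_continuous_onI) auto
  qed (use B in auto)
qed

text \<open>
Slice \<open>g\<close> into \<open>N\<close> layers of height \<open>1 / N\<close>. A layer multiplied by \<open>N\<close> is below the indicator of the open set
where \<open>g\<close> exceeds the bottom of the layer, so its mean is at most the measure of this set; and the indicators of these
sets add up to at most \<open>N * g + 1\<close>.
\<close>

lemma mean_le_integral_unit:
  fixes L :: "('a::metric_space \<Rightarrow>\<^sub>C real) \<Rightarrow> real"
  assumes cpt: "compact (UNIV :: 'a set)" and L: "mean L"
    and g: "\<And>x. 0 \<le> apply_bcontfun g x" "\<And>x. apply_bcontfun g x \<le> 1"
  shows "L g \<le> integral\<^sup>L (riesz_measure L) (apply_bcontfun g)"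
proof (rule field_le_epsilon)
  fix e :: real assume e: "e > 0"
  interpret prob_space "riesz_measure L" by (rule prob_space_riesz[OF cpt L])
  obtain n where n: "inverse (real (Suc n)) < e" using reals_Archimedean[OF e] by blast
  define N where "N = Suc n"
  have N: "real N > 0" "1 / real N < e" using n by (auto simp: N_def field_simps)
  define s where "s i x = max 0 (min 1 (real N * apply_bcontfun g x - real i))" for i :: nat and x
  define h where "h i = Bcontfun (s i)" for i
  have h: "apply_bcontfun (h i) = s i" for i
    unfolding h_def s_def by (intro apply_Bcontfun_compact cpt continuous_intros continuous_on_apply_bcontfun)
  define A where "A i = {x. real i / real N < apply_bcontfun g x}" for i :: nat
  have Aopen: "open (A i)" for i unfolding A_def by (intro open_Collect_less continuous_intros continuous_on_apply_bcontfun)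
  have Lh: "L (h i) \<le> prob (A i)" for i
  proof -
    have "ennreal (L (h i)) \<le> inner_content L (A i)"
    proof (rule inner_content_upper)
      show "apply_bcontfun (h i) x \<le> indicator (A i) x" for x
        using N by (auto simp: h s_def A_def indicator_def field_simps)
    qed (simp add: h s_def)
    also have "\<dots> = emeasure (riesz_measure L) (A i)"
      using Aopen by (simp add: emeasure_riesz_measure[OF cpt L] riesz_outer_open)
    also have "\<dots> = ennreal (prob (A i))" by (rule emeasure_eq_measure)
    finally show ?thesis by simp
  qed
  have slice: "(\<Sum>i<k. max 0 (min 1 (y - real i))) = min y (real k)" if "y \<ge> 0" for y k
    using that by (induction k) (auto simp: max_def min_def)
  have "L g * real N = L (real N *\<^sub>R g)" using L by (simp add: mean_simps)
  also have "real N *\<^sub>R g = (\<Sum>i<N. h i)"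
  proof (rule bcontfun_eqI)
    fix x
    have "apply_bcontfun (\<Sum>i<k. h i) x = (\<Sum>i<k. s i x)" for k
      by (induction k) (auto simp: h)
    moreover have "(\<Sum>i<N. s i x) = real N * apply_bcontfun g x"
      unfolding s_def using g[of x] N by (subst slice) auto
    ultimately show "apply_bcontfun (real N *\<^sub>R g) x = apply_bcontfun (\<Sum>i<N. h i) x" by simp
  qed
  also have "L \<dots> = (\<Sum>i<N. L (h i))" using L by (simp add: mean_simps)
  also have "\<dots> \<le> (\<Sum>i<N. prob (A i))" by (intro sum_mono Lh)
  also have "\<dots> = (\<integral>x. (\<Sum>i<N. indicator (A i) x) \<partial>riesz_measure L)"
    using Aopen by (subst Bochner_Integration.integral_sum) (auto simp: less_top[symmetric] emeasure_eq_measure)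
  also have "\<dots> \<le> (\<integral>x. real N * apply_bcontfun g x + 1 \<partial>riesz_measure L)"
  proof (rule integral_mono)
    show "integrable (riesz_measure L) (\<lambda>x. \<Sum>i<N. indicator (A i) x :: real)"
      using Aopen by (auto simp: less_top[symmetric] emeasure_eq_measure)
    show "integrable (riesz_measure L) (\<lambda>x. real N * apply_bcontfun g x + 1)"
      using bcontfun_integrable[OF finite_measure_axioms, of g] by auto
    fix x
    have ind: "indicator (A i) x \<le> max 0 (min 1 (real N * apply_bcontfun g x + 1 - real i))" for i
      using N by (auto simp: A_def indicator_def field_simps)
    have "(\<Sum>i<N. indicator (A i) x) \<le> (\<Sum>i<N. max 0 (min 1 (real N * apply_bcontfun g x + 1 - real i)))"
      by (intro sum_mono ind)
    also have "\<dots> \<le> real N * apply_bcontfun g x + 1" using g[of x] by (subst slice) auto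
    finally show "(\<Sum>i<N. indicator (A i) x) \<le> real N * apply_bcontfun g x + 1" .
  qed
  also have "\<dots> = real N * (\<integral>x. apply_bcontfun g x \<partial>riesz_measure L) + 1"
    using bcontfun_integrable[OF finite_measure_axioms, of g] prob_space by simp
  finally have "L g \<le> (\<integral>x. apply_bcontfun g x \<partial>riesz_measure L) + 1 / real N"
    using N by (simp add: field_simps)
  then show "L g \<le> integral\<^sup>L (riesz_measure L) (apply_bcontfun g) + e" using N by linarith
qed

text \<open>
The inequality \<open>L g \<le> \<integral> g\<close> extends from functions with values in the unit interval to all \<open>g\<close> by an affine change, and
applied to \<open>- g\<close> it gives the reverse inequality.
\<close>

theorem riesz_representation:
  fixes L :: "('a::metric_space \<Rightarrow>\<^sub>C real) \<Rightarrow> real"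
  assumes cpt: "compact (UNIV :: 'a set)" and L: "mean L"
  shows "L g = integral\<^sup>L (riesz_measure L) (apply_bcontfun g)"
proof -
  interpret prob_space "riesz_measure L" by (rule prob_space_riesz[OF cpt L])
  note int = bcontfun_integrable[OF finite_measure_axioms sets_riesz_measure]
  have le: "L g \<le> integral\<^sup>L (riesz_measure L) (apply_bcontfun g)" for g
  proof -
    obtain C where C: "C > 0" "\<And>x. \<bar>apply_bcontfun g x\<bar> \<le> C"
      using bcontfun_boundedE[of g] by metis
    define h where "h = (1 / (2 * C)) *\<^sub>R (g + const_bcontfun C)"
    have h: "apply_bcontfun h x = (apply_bcontfun g x + C) / (2 * C)" for x
      by (simp add: h_def const_bcontfun.rep_eq)
    have "0 \<le> apply_bcontfun h x" "apply_bcontfun h x \<le> 1" for x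
      unfolding h using C(1) C(2)[of x] by (auto simp: field_simps abs_le_iff)
    then have "L h \<le> integral\<^sup>L (riesz_measure L) (apply_bcontfun h)"
      by (rule mean_le_integral_unit[OF cpt L])
    also have "\<dots> = ((\<integral>x. apply_bcontfun g x \<partial>riesz_measure L) + C) / (2 * C)"
      unfolding h using int[of g] prob_space by simp
    also have "L h = (L g + C) / (2 * C)"
      unfolding h_def using L by (simp add: mean_simps mean_const)
    finally show ?thesis using C(1) by (simp add: divide_le_cancel)
  qed
  have "- L g \<le> - integral\<^sup>L (riesz_measure L) (apply_bcontfun g)"
    using le[of "- g"] L by (simp add: mean_simps)
  then show ?thesis using le[of g] by simp
qed

section \<open>Invariant means and ergodic measures\<close>

lemma flow_zero: "continuous_flow \<sigma> \<Longrightarrow> \<sigma> 0 \<omega> = \<omega>"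
  and flow_add: "continuous_flow \<sigma> \<Longrightarrow> \<sigma> (s + t) \<omega> = \<sigma> s (\<sigma> t \<omega>)"
  by (simp_all add: continuous_flow_def)

lemma flow_inverse: "continuous_flow \<sigma> \<Longrightarrow> \<sigma> (- t) (\<sigma> t \<omega>) = \<omega>" "continuous_flow \<sigma> \<Longrightarrow> \<sigma> t (\<sigma> (- t) \<omega>) = \<omega>"
  using flow_add[of \<sigma> "- t" t \<omega>] flow_add[of \<sigma> t "- t" \<omega>] flow_zero[of \<sigma> \<omega>] by simp_all

lemma flow_cont_joint:
  assumes "continuous_flow \<sigma>" "continuous_on A p" "continuous_on A q"
  shows "continuous_on A (\<lambda>x. \<sigma> (p x) (q x))"
proof -
  have "continuous_on UNIV (\<lambda>(t, \<omega>). \<sigma> t \<omega>)" using assms(1) by (simp add: continuous_flow_def)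
  from continuous_on_compose2[OF this continuous_on_Pair[OF assms(2,3)]] show ?thesis by simp
qed

lemma flow_cont: "continuous_flow \<sigma> \<Longrightarrow> continuous_on UNIV (\<sigma> t)"
  using flow_cont_joint[of \<sigma> UNIV "\<lambda>_. t" "\<lambda>x. x"] by simp

lemma flow_image: "continuous_flow \<sigma> \<Longrightarrow> \<sigma> t ` B = \<sigma> (- t) -` B"
proof (intro set_eqI iffI)
  fix x assume *: "continuous_flow \<sigma>" "x \<in> \<sigma> (- t) -` B"
  then have "x = \<sigma> t (\<sigma> (- t) x)" by (simp add: flow_inverse)
  then show "x \<in> \<sigma> t ` B" using * by blast
qed (auto simp: flow_inverse)

definition flow_avg :: "(real \<Rightarrow> 'a \<Rightarrow> 'a) \<Rightarrow> real list \<Rightarrow> ('a \<Rightarrow> real) \<Rightarrow> 'a \<Rightarrow> real" where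
  "flow_avg \<sigma> ts g \<omega> = (\<Sum>t\<leftarrow>ts. g (\<sigma> t \<omega>)) / real (length ts)"

lemma flow_avg_le:
  assumes "ts \<noteq> []" "\<And>t. t \<in> set ts \<Longrightarrow> g (\<sigma> t \<omega>) \<le> c" shows "flow_avg \<sigma> ts g \<omega> \<le> c"
proof -
  have "(\<Sum>t\<leftarrow>ts. g (\<sigma> t \<omega>)) \<le> (\<Sum>t\<leftarrow>ts. c)" using assms(2) by (intro sum_list_mono) auto
  also have "\<dots> = c * real (length ts)" by (induction ts) (auto simp: algebra_simps)
  finally show ?thesis using assms(1) by (simp add: flow_avg_def divide_le_eq)
qed

lemma flow_avg_add: "flow_avg \<sigma> ts (\<lambda>x. g x + h x) \<omega> = flow_avg \<sigma> ts g \<omega> + flow_avg \<sigma> ts h \<omega>"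
  by (simp add: flow_avg_def sum_list_addf add_divide_distrib)

lemma flow_avg_cmult: "flow_avg \<sigma> ts (\<lambda>x. c * g x) \<omega> = c * flow_avg \<sigma> ts g \<omega>"
  by (simp add: flow_avg_def sum_list_const_mult)

lemma flow_avg_sums:
  "flow_avg \<sigma> (concat (map (\<lambda>t. map (\<lambda>s. s + t) ss) ts)) g \<omega> =
     (\<Sum>t\<leftarrow>ts. \<Sum>s\<leftarrow>ss. g (\<sigma> (s + t) \<omega>)) / (real (length ss) * real (length ts))"
proof -
  have "(\<Sum>u\<leftarrow>concat (map (\<lambda>t. map (\<lambda>s. s + t) ss) ts). g (\<sigma> u \<omega>)) = (\<Sum>t\<leftarrow>ts. \<Sum>s\<leftarrow>ss. g (\<sigma> (s + t) \<omega>))"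
    by (induction ts) (auto simp: o_def)
  moreover have "length (concat (map (\<lambda>t. map (\<lambda>s. s + t) ss) ts)) = length ss * length ts"
    by (induction ts) auto
  ultimately show ?thesis by (simp add: flow_avg_def)
qed

lemma sum_list_exchange:
  "(\<Sum>t\<leftarrow>ts. \<Sum>s\<leftarrow>ss. (h s t :: real)) = (\<Sum>s\<leftarrow>ss. \<Sum>t\<leftarrow>ts. h s t)"
  by (induction ts) (simp_all add: sum_list_addf)

text \<open>
Averaging over all sums of two times is averaging twice, and the order does not matter because time shifts commute.
\<close>

lemma flow_avg_iterate:
  assumes "continuous_flow \<sigma>"
  defines "us \<equiv> \<lambda>ss ts. concat (map (\<lambda>t. map (\<lambda>s. s + t) ss) ts)"
  shows "flow_avg \<sigma> (us ss ts) g \<omega> = flow_avg \<sigma> ts (flow_avg \<sigma> ss g) \<omega>"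
    and "flow_avg \<sigma> (us ss ts) g \<omega> = flow_avg \<sigma> ss (flow_avg \<sigma> ts g) \<omega>"
proof -
  show "flow_avg \<sigma> (us ss ts) g \<omega> = flow_avg \<sigma> ts (flow_avg \<sigma> ss g) \<omega>"
    unfolding us_def flow_avg_sums
    by (simp add: flow_avg_def flow_add[OF assms(1)] divide_inverse sum_list_mult_const mult.assoc)
  have "flow_avg \<sigma> (us ss ts) g \<omega> = (\<Sum>s\<leftarrow>ss. \<Sum>t\<leftarrow>ts. g (\<sigma> t (\<sigma> s \<omega>))) / (real (length ss) * real (length ts))"
    unfolding us_def flow_avg_sums sum_list_exchange[of _ ss ts]
    by (simp add: flow_add[OF assms(1), symmetric] add.commute)
  then show "flow_avg \<sigma> (us ss ts) g \<omega> = flow_avg \<sigma> ss (flow_avg \<sigma> ts g) \<omega>"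
    by (simp add: flow_avg_def divide_inverse sum_list_mult_const mult.assoc)
qed

text \<open>
Averages over finite lists of times replace time integrals: they stay within continuous functions and need no
exchange of integrals. Repetitions in the list provide rational weights.
\<close>

definition avg_bounds :: "(real \<Rightarrow> 'a::metric_space \<Rightarrow> 'a) \<Rightarrow> ('a \<Rightarrow>\<^sub>C real) \<Rightarrow> real set" where
  "avg_bounds \<sigma> g = {c. \<exists>ts. ts \<noteq> [] \<and> (\<forall>\<omega>. flow_avg \<sigma> ts (apply_bcontfun g) \<omega> \<le> c)}"

definition upper_mean :: "(real \<Rightarrow> 'a::metric_space \<Rightarrow> 'a) \<Rightarrow> ('a \<Rightarrow>\<^sub>C real) \<Rightarrow> real" where
  "upper_mean \<sigma> g = Inf (avg_bounds \<sigma> g)"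

lemma avg_bounds_I: "ts \<noteq> [] \<Longrightarrow> (\<And>\<omega>. flow_avg \<sigma> ts (apply_bcontfun g) \<omega> \<le> c) \<Longrightarrow> c \<in> avg_bounds \<sigma> g"
  by (auto simp: avg_bounds_def)

lemma avg_bounds_E:
  assumes "c \<in> avg_bounds \<sigma> g"
  obtains ts where "ts \<noteq> []" "\<And>\<omega>. flow_avg \<sigma> ts (apply_bcontfun g) \<omega> \<le> c"
  using assms by (auto simp: avg_bounds_def)

lemma avg_bounds_bdd: "bdd_below (avg_bounds \<sigma> g)"
proof -
  obtain B where B: "\<And>x. \<bar>apply_bcontfun g x\<bar> \<le> B" using bcontfun_boundedE[of g] by metis
  show ?thesis
  proof (rule bdd_belowI)
    fix c assume "c \<in> avg_bounds \<sigma> g"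
    then obtain ts where ts: "ts \<noteq> []" "\<And>\<omega>. flow_avg \<sigma> ts (apply_bcontfun g) \<omega> \<le> c" by (metis avg_bounds_E)
    have "flow_avg \<sigma> ts (\<lambda>x. - 1 * apply_bcontfun g x) undefined \<le> B"
      using B by (intro flow_avg_le ts) (simp add: abs_le_iff)
    then show "- B \<le> c" using ts(2)[of undefined] unfolding flow_avg_cmult by linarith
  qed
qed

lemma avg_bounds_const: "(\<And>x. apply_bcontfun g x \<le> c) \<Longrightarrow> c \<in> avg_bounds \<sigma> g"
  by (rule avg_bounds_I[of "[0]"]) (auto intro: flow_avg_le)

lemma avg_bounds_nonempty: "avg_bounds \<sigma> g \<noteq> {}"
proof -
  obtain B where "\<And>x. \<bar>apply_bcontfun g x\<bar> \<le> B" using bcontfun_boundedE[of g] by metis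
  then have "B \<in> avg_bounds \<sigma> g" by (intro avg_bounds_const) (simp add: abs_le_iff)
  then show ?thesis by auto
qed

lemma upper_mean_le: "c \<in> avg_bounds \<sigma> g \<Longrightarrow> upper_mean \<sigma> g \<le> c"
  unfolding upper_mean_def by (intro cInf_lower avg_bounds_bdd)

lemma upper_mean_ge: "(\<And>c. c \<in> avg_bounds \<sigma> g \<Longrightarrow> d \<le> c) \<Longrightarrow> d \<le> upper_mean \<sigma> g"
  unfolding upper_mean_def by (intro cInf_greatest avg_bounds_nonempty)

lemma upper_mean_negE:
  assumes "upper_mean \<sigma> g < 0"
  obtains ts c where "ts \<noteq> []" "c < 0" "\<And>\<omega>. flow_avg \<sigma> ts (apply_bcontfun g) \<omega> \<le> c"
proof -
  obtain c where "c \<in> avg_bounds \<sigma> g" "c < 0"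
    using assms unfolding upper_mean_def by (meson avg_bounds_nonempty cInf_lessD)
  then show thesis using that by (auto elim: avg_bounds_E)
qed

text \<open>
If the averages of \<open>g\<close> over \<open>ss\<close> and those of \<open>h\<close> over \<open>ts\<close> are bounded, then the averages over all sums of
times respect both bounds.
\<close>

lemma sublinear_upper_mean:
  assumes \<sigma>: "continuous_flow \<sigma>"
  shows "sublinear (upper_mean \<sigma>)"
  unfolding sublinear_def
proof (intro conjI allI impI)
  fix g h :: "'a \<Rightarrow>\<^sub>C real"
  have *: "c + d \<in> avg_bounds \<sigma> (g + h)" if c: "c \<in> avg_bounds \<sigma> g" and d: "d \<in> avg_bounds \<sigma> h" for c d
  proof -
    obtain ss where ss: "ss \<noteq> []" "\<And>\<omega>. flow_avg \<sigma> ss (apply_bcontfun g) \<omega> \<le> c" using c by (metis avg_bounds_E)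
    obtain ts where ts: "ts \<noteq> []" "\<And>\<omega>. flow_avg \<sigma> ts (apply_bcontfun h) \<omega> \<le> d" using d by (metis avg_bounds_E)
    define us where "us = concat (map (\<lambda>t. map (\<lambda>s. s + t) ss) ts)"
    have "flow_avg \<sigma> us (apply_bcontfun (g + h)) \<omega> \<le> c + d" for \<omega>
    proof -
      have "flow_avg \<sigma> us (apply_bcontfun g) \<omega> \<le> c"
        unfolding us_def flow_avg_iterate(1)[OF \<sigma>] by (intro flow_avg_le ts ss)
      moreover have "flow_avg \<sigma> us (apply_bcontfun h) \<omega> \<le> d"
        unfolding us_def flow_avg_iterate(2)[OF \<sigma>] by (intro flow_avg_le ts ss)
      moreover have "apply_bcontfun (g + h) = (\<lambda>x. apply_bcontfun g x + apply_bcontfun h x)"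
        by (simp add: fun_eq_iff)
      ultimately show ?thesis by (simp add: flow_avg_add)
    qed
    moreover have "us \<noteq> []" using ss(1) ts(1) by (cases ts) (auto simp: us_def)
    ultimately show ?thesis by (rule avg_bounds_I[rotated])
  qed
  have "upper_mean \<sigma> (g + h) - c \<le> upper_mean \<sigma> h" if c: "c \<in> avg_bounds \<sigma> g" for c
    by (rule upper_mean_ge) (use upper_mean_le[OF *[OF c]] in force)
  then have "upper_mean \<sigma> (g + h) - upper_mean \<sigma> h \<le> upper_mean \<sigma> g"
    by (intro upper_mean_ge) force
  then show "upper_mean \<sigma> (g + h) \<le> upper_mean \<sigma> g + upper_mean \<sigma> h" by simp
next
  fix a :: real and g :: "'a \<Rightarrow>\<^sub>C real" assume a: "a > 0"
  have "upper_mean \<sigma> (a *\<^sub>R g) / a \<le> upper_mean \<sigma> g"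
  proof (rule upper_mean_ge)
    fix c assume "c \<in> avg_bounds \<sigma> g"
    then obtain ts where ts: "ts \<noteq> []" "\<And>\<omega>. flow_avg \<sigma> ts (apply_bcontfun g) \<omega> \<le> c" by (metis avg_bounds_E)
    have "apply_bcontfun (a *\<^sub>R g) = (\<lambda>x. a * apply_bcontfun g x)" by (simp add: fun_eq_iff)
    then have "flow_avg \<sigma> ts (apply_bcontfun (a *\<^sub>R g)) \<omega> \<le> a * c" for \<omega>
      using ts(2) a by (simp add: flow_avg_cmult)
    then have "upper_mean \<sigma> (a *\<^sub>R g) \<le> a * c" by (intro upper_mean_le avg_bounds_I[OF ts(1)])
    then show "upper_mean \<sigma> (a *\<^sub>R g) / a \<le> c" using a by (simp add: field_simps)
  qed
  then show "upper_mean \<sigma> (a *\<^sub>R g) \<le> a * upper_mean \<sigma> g" using a by (simp add: field_simps)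
qed

definition flow_shift :: "(real \<Rightarrow> 'a::metric_space \<Rightarrow> 'a) \<Rightarrow> real \<Rightarrow> ('a \<Rightarrow>\<^sub>C real) \<Rightarrow> 'a \<Rightarrow>\<^sub>C real" where
  "flow_shift \<sigma> t g = Bcontfun (\<lambda>x. apply_bcontfun g (\<sigma> t x))"

lemma flow_shift_apply:
  assumes \<sigma>: "continuous_flow \<sigma>"
  shows "apply_bcontfun (flow_shift \<sigma> t g) x = apply_bcontfun g (\<sigma> t x)"
proof -
  have "(\<lambda>x. apply_bcontfun g (\<sigma> t x)) \<in> bcontfun"
  proof -
    obtain B where B: "\<And>x. \<bar>apply_bcontfun g x\<bar> \<le> B" using bcontfun_boundedE[of g] by metis
    have "continuous_on UNIV (\<lambda>x. apply_bcontfun g (\<sigma> t x))"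
      using continuous_on_compose2[OF continuous_on_apply_bcontfun[of UNIV g] flow_cont[OF \<sigma>, of t]] by simp
    then show ?thesis using B by (intro bcontfun_normI) auto
  qed
  then show ?thesis unfolding flow_shift_def by (simp add: Bcontfun_inverse)
qed

definition invariant_mean :: "(real \<Rightarrow> 'a::metric_space \<Rightarrow> 'a) \<Rightarrow> (('a \<Rightarrow>\<^sub>C real) \<Rightarrow> real) \<Rightarrow> bool" where
  "invariant_mean \<sigma> L \<longleftrightarrow> mean L \<and> (\<forall>t g. L (flow_shift \<sigma> t g) = L g)"

text \<open>
An invariant mean does not distinguish a function from its average over finitely many times.
\<close>

lemma invariant_mean_le_upper_mean:
  assumes \<sigma>: "continuous_flow \<sigma>" and L: "invariant_mean \<sigma> L"
  shows "L \<le> upper_mean \<sigma>"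
proof (rule le_funI, rule upper_mean_ge)
  fix g c assume "c \<in> avg_bounds \<sigma> g"
  then obtain ts where ts: "ts \<noteq> []" "\<And>\<omega>. flow_avg \<sigma> ts (apply_bcontfun g) \<omega> \<le> c" by (metis avg_bounds_E)
  have m: "mean L" and inv: "\<And>t g. L (flow_shift \<sigma> t g) = L g" using L by (auto simp: invariant_mean_def)
  define h where "h us = (\<Sum>t\<leftarrow>us. flow_shift \<sigma> t g)" for us
  have "apply_bcontfun (h us) x = (\<Sum>t\<leftarrow>us. apply_bcontfun g (\<sigma> t x))" for us x
    unfolding h_def by (induction us) (auto simp: flow_shift_apply[OF \<sigma>])
  then have "apply_bcontfun ((1 / real (length ts)) *\<^sub>R h ts) x \<le> c" for x
    using ts(2)[of x] by (simp add: flow_avg_def)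
  then have "L ((1 / real (length ts)) *\<^sub>R h ts) \<le> c" by (rule mean_le[OF m])
  moreover have "L (h us) = real (length us) * L g" for us
    unfolding h_def by (induction us) (auto simp: mean_simps[OF m] inv algebra_simps)
  ultimately show "L g \<le> c" using ts(1) by (simp add: mean_simps[OF m])
qed

text \<open>
The average of \<open>g \<circ> \<sigma> t - g\<close> over the times \<open>0, t, \<dots>, (n - 1) t\<close> telescopes and is of order \<open>1 / n\<close>, so the upper
mean of this difference is at most zero.
\<close>

lemma le_upper_mean_imp_invariant_mean:
  assumes \<sigma>: "continuous_flow \<sigma>" and lin: "linear L" and le: "L \<le> upper_mean \<sigma>"
  shows "invariant_mean \<sigma> L"
proof -
  have m: "mean L"
    unfolding mean_def
  proof (intro conjI lin allI impI)
    fix g :: "'a \<Rightarrow>\<^sub>C real" and c assume "\<forall>x. apply_bcontfun g x \<le> c"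
    then have "upper_mean \<sigma> g \<le> c" by (intro upper_mean_le avg_bounds_const) simp
    then show "L g \<le> c" using le_funD[OF le, of g] by linarith
  qed
  have half: "L (flow_shift \<sigma> t g) \<le> L g" for t and g :: "'a \<Rightarrow>\<^sub>C real"
  proof (rule field_le_epsilon)
    fix e :: real assume e: "e > 0"
    obtain B where B: "B > 0" "\<And>x. \<bar>apply_bcontfun g x\<bar> \<le> B" using bcontfun_boundedE[of g] by metis
    obtain n where n: "2 * B / e < real n" using reals_Archimedean2 by blast
    have "2 * B / e > 0" using B e by simp
    then have n0: "real n > 0" "n > 0" using n by linarith+
    define ts where "ts = map (\<lambda>i. real i * t) [0..<n]"
    have "(\<Sum>s\<leftarrow>map (\<lambda>i. real i * t) [0..<k]. apply_bcontfun (flow_shift \<sigma> t g - g) (\<sigma> s \<omega>)) =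
        apply_bcontfun g (\<sigma> (real k * t) \<omega>) - apply_bcontfun g \<omega>" for k \<omega>
      by (induction k)
         (auto simp: flow_shift_apply[OF \<sigma>] flow_zero[OF \<sigma>] flow_add[OF \<sigma>, symmetric] algebra_simps)
    then have "flow_avg \<sigma> ts (apply_bcontfun (flow_shift \<sigma> t g - g)) \<omega> =
        (apply_bcontfun g (\<sigma> (real n * t) \<omega>) - apply_bcontfun g \<omega>) / real n" for \<omega>
      by (simp add: flow_avg_def ts_def)
    moreover have "(apply_bcontfun g (\<sigma> (real n * t) \<omega>) - apply_bcontfun g \<omega>) / real n \<le> e" for \<omega>
    proof -
      have "apply_bcontfun g (\<sigma> (real n * t) \<omega>) - apply_bcontfun g \<omega> \<le> 2 * B"
        using B(2)[of "\<sigma> (real n * t) \<omega>"] B(2)[of \<omega>] by (simp add: abs_le_iff)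
      also have "\<dots> \<le> e * real n" using n e by (simp add: field_simps)
      finally show ?thesis using n0 by (simp add: divide_le_eq)
    qed
    ultimately have "flow_avg \<sigma> ts (apply_bcontfun (flow_shift \<sigma> t g - g)) \<omega> \<le> e" for \<omega> by simp
    then have "upper_mean \<sigma> (flow_shift \<sigma> t g - g) \<le> e"
      using n0 by (intro upper_mean_le avg_bounds_I[of ts]) (auto simp: ts_def)
    then show "L (flow_shift \<sigma> t g) \<le> L g + e"
      using le_funD[OF le, of "flow_shift \<sigma> t g - g"] by (simp add: mean_simps[OF m])
  qed
  have "flow_shift \<sigma> t (- g) = - flow_shift \<sigma> t g" for t and g :: "'a \<Rightarrow>\<^sub>C real"
    by (rule bcontfun_eqI) (simp add: flow_shift_apply[OF \<sigma>])
  then have "L g \<le> L (flow_shift \<sigma> t g)" for t g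
    using half[of t "- g"] by (simp add: mean_simps[OF m])
  then show ?thesis using half m by (auto simp: invariant_mean_def intro: antisym)
qed

text \<open>
Composition with \<open>\<sigma> (- t)\<close> carries the functions below the indicator of \<open>U\<close> to functions below that of its image under \<open>\<sigma> t\<close>.
Each comparison is proved in one direction only; the inverse time gives the other one.
\<close>

lemma invariant_measure_riesz:
  fixes \<sigma> :: "real \<Rightarrow> 'a::metric_space \<Rightarrow> 'a"
  assumes cpt: "compact (UNIV :: 'a set)" and \<sigma>: "continuous_flow \<sigma>" and L: "invariant_mean \<sigma> L"
  shows "invariant_measure \<sigma> (riesz_measure L)"
proof -
  have m: "mean L" and inv: "\<And>t g. L (flow_shift \<sigma> t g) = L g" using L by (auto simp: invariant_mean_def)
  have open_im: "open (\<sigma> t ` U)" if "open U" for t U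
    unfolding flow_image[OF \<sigma>] using open_vimage[OF that flow_cont[OF \<sigma>, of "- t"]] by simp
  have ic_le: "inner_content L U \<le> inner_content L (\<sigma> t ` U)" for t U
  proof (rule inner_content_least)
    fix g :: "'a \<Rightarrow>\<^sub>C real" assume g: "\<And>x. 0 \<le> apply_bcontfun g x" "\<And>x. apply_bcontfun g x \<le> indicator U x"
    have "ennreal (L (flow_shift \<sigma> (- t) g)) \<le> inner_content L (\<sigma> t ` U)"
    proof (rule inner_content_upper)
      fix x
      show "0 \<le> apply_bcontfun (flow_shift \<sigma> (- t) g) x" by (simp add: flow_shift_apply[OF \<sigma>] g)
      show "apply_bcontfun (flow_shift \<sigma> (- t) g) x \<le> indicator (\<sigma> t ` U) x"
        using g(2)[of "\<sigma> (- t) x"] by (simp add: flow_shift_apply[OF \<sigma>] flow_image[OF \<sigma>] indicator_def)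
    qed
    then show "ennreal (L g) \<le> inner_content L (\<sigma> t ` U)" by (simp add: inv)
  qed
  have ro_le: "riesz_outer L A \<le> riesz_outer L (\<sigma> t ` A)" for t A
    unfolding riesz_outer_def[of L "\<sigma> t ` A"]
  proof (rule INF_greatest)
    fix V assume "V \<in> {U. open U \<and> \<sigma> t ` A \<subseteq> U}"
    then have V: "open V" "\<sigma> t ` A \<subseteq> V" by auto
    have "A \<subseteq> \<sigma> (- t) ` V" using V(2) unfolding flow_image[OF \<sigma>, of "- t"] by auto
    then have "riesz_outer L A \<le> inner_content L (\<sigma> (- t) ` V)" by (intro riesz_outer_le open_im V)
    also have "\<dots> \<le> inner_content L (\<sigma> t ` \<sigma> (- t) ` V)" by (rule ic_le)
    also have "\<sigma> t ` \<sigma> (- t) ` V = V" by (simp add: image_image flow_inverse[OF \<sigma>])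
    finally show "riesz_outer L A \<le> inner_content L V" .
  qed
  have ro: "riesz_outer L (\<sigma> t ` A) = riesz_outer L A" for t A
  proof (rule antisym[OF _ ro_le])
    have "riesz_outer L (\<sigma> t ` A) \<le> riesz_outer L (\<sigma> (- t) ` \<sigma> t ` A)" by (rule ro_le)
    also have "\<sigma> (- t) ` \<sigma> t ` A = A" by (simp add: image_image flow_inverse[OF \<sigma>])
    finally show "riesz_outer L (\<sigma> t ` A) \<le> riesz_outer L A" .
  qed
  have "\<sigma> t ` B \<in> sets borel" if B: "B \<in> sets borel" for t B
  proof -
    have "\<sigma> (- t) \<in> borel_measurable borel" by (rule borel_measurable_continuous_onI[OF flow_cont[OF \<sigma>]])
    from measurable_sets[OF this B] show ?thesis by (simp add: flow_image[OF \<sigma>])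
  qed
  then show ?thesis
    unfolding invariant_measure_def
    by (simp add: prob_space_riesz[OF cpt m] emeasure_riesz_measure[OF cpt m] ro)
qed

lemma invariant_measure_integral:
  fixes \<sigma> :: "real \<Rightarrow> 'a::metric_space \<Rightarrow> 'a" and h :: "'a \<Rightarrow> real"
  assumes \<sigma>: "continuous_flow \<sigma>" and inv: "invariant_measure \<sigma> m" and h: "h \<in> borel_measurable borel"
  shows "(\<integral>x. h (\<sigma> t x) \<partial>m) = (\<integral>x. h x \<partial>m)"
proof -
  have sets: "sets m = sets borel" using inv by (simp add: invariant_measure_def)
  have meas: "\<sigma> t \<in> measurable m borel"
    unfolding measurable_cong_sets[OF sets refl] by (rule borel_measurable_continuous_onI[OF flow_cont[OF \<sigma>]])
  have "distr m borel (\<sigma> t) = m"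
  proof (rule measure_eqI)
    fix A assume "A \<in> sets (distr m borel (\<sigma> t))"
    then have A: "A \<in> sets borel" by simp
    have "emeasure (distr m borel (\<sigma> t)) A = emeasure m (\<sigma> t -` A \<inter> space m)"
      by (rule emeasure_distr[OF meas A])
    also have "space m = UNIV" using sets_eq_imp_space_eq[OF sets] by simp
    also have "\<sigma> t -` A \<inter> UNIV = \<sigma> (- t) ` A" by (simp add: flow_image[OF \<sigma>])
    also have "emeasure m \<dots> = emeasure m A" using inv A by (simp add: invariant_measure_def)
    finally show "emeasure (distr m borel (\<sigma> t)) A = emeasure m A" .
  qed (simp add: sets)
  then show ?thesis using integral_distr[OF meas, of h] h by simp
qed

text \<open>
Conditioning on an invariant set of positive measure gives an invariant mean again; the means of an invariant set and of
its complement decompose the original one.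
\<close>

lemma restricted_invariant_mean:
  fixes \<sigma> :: "real \<Rightarrow> 'a::metric_space \<Rightarrow> 'a"
  assumes \<sigma>: "continuous_flow \<sigma>" and inv: "invariant_measure \<sigma> m"
    and B: "B \<in> sets borel" "\<And>t. \<sigma> t ` B = B" and pos: "measure m B > 0"
  shows "invariant_mean \<sigma> (\<lambda>g :: 'a \<Rightarrow>\<^sub>C real. (\<integral>x. indicator B x * apply_bcontfun g x \<partial>m) / measure m B)"
proof -
  interpret prob_space m using inv by (simp add: invariant_measure_def)
  have sets: "sets m = sets borel" using inv by (simp add: invariant_measure_def)
  have Bm: "B \<in> sets m" using B sets by simp
  have int: "integrable m (\<lambda>x. indicator B x * apply_bcontfun g x)" for g :: "'a \<Rightarrow>\<^sub>C real"
    using integrable_mult_indicator[OF Bm bcontfun_integrable[OF finite_measure_axioms sets, of g]] by simp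
  have "mean (\<lambda>g :: 'a \<Rightarrow>\<^sub>C real. (\<integral>x. indicator B x * apply_bcontfun g x \<partial>m) / measure m B)"
    unfolding mean_def
  proof (intro conjI allI impI)
    show "linear (\<lambda>g :: 'a \<Rightarrow>\<^sub>C real. (\<integral>x. indicator B x * apply_bcontfun g x \<partial>m) / measure m B)"
    proof (rule linearI)
      fix g h :: "'a \<Rightarrow>\<^sub>C real"
      show "(\<integral>x. indicator B x * apply_bcontfun (g + h) x \<partial>m) / measure m B =
         (\<integral>x. indicator B x * apply_bcontfun g x \<partial>m) / measure m B + (\<integral>x. indicator B x * apply_bcontfun h x \<partial>m) / measure m B"
        by (simp add: distrib_left int add_divide_distrib)
    next
      fix c and g :: "'a \<Rightarrow>\<^sub>C real"
      have "(\<integral>x. indicator B x * apply_bcontfun (c *\<^sub>R g) x \<partial>m) = (\<integral>x. c * (indicator B x * apply_bcontfun g x) \<partial>m)"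
        by (intro Bochner_Integration.integral_cong) auto
      then show "(\<integral>x. indicator B x * apply_bcontfun (c *\<^sub>R g) x \<partial>m) / measure m B =
         c *\<^sub>R ((\<integral>x. indicator B x * apply_bcontfun g x \<partial>m) / measure m B)"
        by simp
    qed
    fix g :: "'a \<Rightarrow>\<^sub>C real" and c assume g: "\<forall>x. apply_bcontfun g x \<le> c"
    have "(\<integral>x. indicator B x * apply_bcontfun g x \<partial>m) \<le> (\<integral>x. indicator B x * c \<partial>m)"
    proof (rule integral_mono[OF int])
      show "integrable m (\<lambda>x. indicator B x * c)"
        using int[of "const_bcontfun c"] by (simp add: const_bcontfun.rep_eq)
    qed (use g in \<open>auto simp: indicator_def\<close>)
    also have "\<dots> = measure m B * c" using Bm by simp
    finally show "(\<integral>x. indicator B x * apply_bcontfun g x \<partial>m) / measure m B \<le> c"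
      using pos by (simp add: field_simps)
  qed
  moreover have "(\<integral>x. indicator B x * apply_bcontfun (flow_shift \<sigma> t g) x \<partial>m) = (\<integral>x. indicator B x * apply_bcontfun g x \<partial>m)" for t and g :: "'a \<Rightarrow>\<^sub>C real"
  proof -
    have "indicator B (\<sigma> t x) = (indicator B x :: real)" for x
    proof -
      have "\<sigma> (- t) -` B = B" using B(2)[of t] by (simp add: flow_image[OF \<sigma>])
      then have "\<sigma> t x \<in> B \<longleftrightarrow> x \<in> B"
        by (metis flow_inverse(1)[OF \<sigma>] vimage_eq)
      then show ?thesis by (simp add: indicator_def)
    qed
    then have "(\<integral>x. indicator B x * apply_bcontfun (flow_shift \<sigma> t g) x \<partial>m) = (\<integral>x. (\<lambda>y. indicator B y * apply_bcontfun g y) (\<sigma> t x) \<partial>m)"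
      by (simp add: flow_shift_apply[OF \<sigma>])
    also have "\<dots> = (\<integral>x. indicator B x * apply_bcontfun g x \<partial>m)"
    proof (rule invariant_measure_integral[OF \<sigma> inv])
      have "apply_bcontfun g \<in> borel_measurable borel" by (rule borel_measurable_continuous_onI) auto
      then show "(\<lambda>y. indicator B y * apply_bcontfun g y) \<in> borel_measurable borel"
        using B(1) by measurable
    qed
    finally show ?thesis .
  qed
  ultimately show ?thesis by (simp add: invariant_mean_def)
qed

text \<open>
The Riesz measure of an extreme invariant mean \<open>L\<close> is ergodic. Given an invariant set \<open>B\<close> of measure strictly
between 0 and 1, \<open>L\<close> is a proper convex combination of the means conditioned on \<open>B\<close> and on its complement, so
it equals the former. Then \<open>B\<close> is independent of all continuous functions and, by approximation, of itself,
which forces its measure to be 0 or 1.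
\<close>

theorem ergodic_measure_exists:
  fixes \<sigma> :: "real \<Rightarrow> 'a::metric_space \<Rightarrow> 'a"
  assumes cpt: "compact (UNIV :: 'a set)" and \<sigma>: "continuous_flow \<sigma>"
  shows "\<exists>m. ergodic_measure \<sigma> m"
proof -
  obtain L where L: "linear L" "L \<le> upper_mean \<sigma>"
    and extreme: "\<And>L1 L2 a. linear L1 \<Longrightarrow> linear L2 \<Longrightarrow> L1 \<le> upper_mean \<sigma> \<Longrightarrow> L2 \<le> upper_mean \<sigma> \<Longrightarrow>
      0 < a \<Longrightarrow> a < 1 \<Longrightarrow> (\<And>v. L v = a * L1 v + (1 - a) * L2 v) \<Longrightarrow> L1 = L \<and> L2 = L"
    using extreme_dominated_functional[OF sublinear_upper_mean[OF \<sigma>]] by metis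
  have iL: "invariant_mean \<sigma> L" by (rule le_upper_mean_imp_invariant_mean[OF \<sigma> L])
  then have mL: "mean L" by (simp add: invariant_mean_def)
  define m where "m = riesz_measure L"
  have inv: "invariant_measure \<sigma> m" unfolding m_def by (rule invariant_measure_riesz[OF cpt \<sigma> iL])
  interpret prob_space m using inv by (simp add: invariant_measure_def)
  have sets: "sets m = sets borel" and space: "space m = UNIV" by (simp_all add: m_def)
  have rep: "L g = (\<integral>x. apply_bcontfun g x \<partial>m)" for g
    unfolding m_def by (rule riesz_representation[OF cpt mL])
  note int0 = bcontfun_integrable[OF finite_measure_axioms sets]
  have "prob B = 0 \<or> prob B = 1" if B: "B \<in> sets borel" "\<And>t. \<sigma> t ` B = B" for B
  proof (rule ccontr)
    assume "\<not> ?thesis"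
    then have a: "0 < prob B" "prob B < 1" using measure_nonneg[of m B] prob_le_1[of B] by linarith+
    have Bm: "B \<in> sets m" "- B \<in> sets m" using B sets by (auto simp: Compl_eq_Diff_UNIV)
    have compl: "prob (- B) = 1 - prob B" using prob_compl[OF Bm(1)] space by (simp add: Compl_eq_Diff_UNIV)
    have Binv: "\<sigma> t ` (- B) = - B" for t
      using B(2)[of t] unfolding flow_image[OF \<sigma>] by auto
    define L1 where "L1 g = (\<integral>x. indicator B x * apply_bcontfun g x \<partial>m) / prob B" for g :: "'a \<Rightarrow>\<^sub>C real"
    define L2 where "L2 g = (\<integral>x. indicator (- B) x * apply_bcontfun g x \<partial>m) / prob (- B)" for g :: "'a \<Rightarrow>\<^sub>C real"
    have i1: "invariant_mean \<sigma> L1"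
      unfolding L1_def by (rule restricted_invariant_mean[OF \<sigma> inv B a(1)])
    have i2: "invariant_mean \<sigma> L2"
      unfolding L2_def using B(1) Binv a compl
      by (intro restricted_invariant_mean[OF \<sigma> inv]) (auto simp: Compl_eq_Diff_UNIV)
    have int: "integrable m (\<lambda>x. indicator A x * apply_bcontfun g x)" if "A \<in> sets m" for A and g :: "'a \<Rightarrow>\<^sub>C real"
      using integrable_mult_indicator[OF that int0[of g]] by simp
    have "L g = prob B * L1 g + (1 - prob B) * L2 g" for g
    proof -
      have "prob B * L1 g + (1 - prob B) * L2 g =
          (\<integral>x. indicator B x * apply_bcontfun g x \<partial>m) + (\<integral>x. indicator (- B) x * apply_bcontfun g x \<partial>m)"
        using a by (simp add: L1_def L2_def compl)
      also have "\<dots> = (\<integral>x. indicator B x * apply_bcontfun g x + indicator (- B) x * apply_bcontfun g x \<partial>m)"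
        by (intro Bochner_Integration.integral_add[symmetric] int Bm)
      also have "\<dots> = (\<integral>x. apply_bcontfun g x \<partial>m)"
        by (intro Bochner_Integration.integral_cong) (auto simp: indicator_def)
      finally show ?thesis by (simp add: rep)
    qed
    then have L1L: "L1 = L"
      using extreme[of L1 L2 "prob B"] a i1 i2 invariant_mean_le_upper_mean[OF \<sigma>]
      by (simp add: invariant_mean_def mean_linear)
    \<comment> \<open>Approximate \<open>B\<close> from outside by an open set and its indicator from below by a continuous \<open>g\<close>, and test \<open>L1 = L\<close> on \<open>g\<close>.\<close>
    have bound: "prob B - e \<le> prob B * (prob B + e)" if e: "e > 0" for e
    proof -
      have "riesz_outer L B < riesz_outer L B + ennreal e"
      proof -
        have "riesz_outer L B = ennreal (prob B)"
          using emeasure_riesz_measure[OF cpt mL B(1)] emeasure_eq_measure[of B] by (simp add: m_def)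
        then show ?thesis using e by (simp add: ennreal_less_iff flip: ennreal_plus)
      qed
      then obtain U where U: "open U" "B \<subseteq> U" "inner_content L U < riesz_outer L B + ennreal e"
        unfolding riesz_outer_def[of L B] INF_less_iff by auto
      have cU: "inner_content L U = ennreal (prob U)"
        using emeasure_riesz_measure[OF cpt mL, of U] emeasure_eq_measure[of U] U(1)
        by (simp add: m_def riesz_outer_open)
      have cB: "riesz_outer L B = ennreal (prob B)"
        using emeasure_riesz_measure[OF cpt mL B(1)] emeasure_eq_measure[of B] by (simp add: m_def)
      have Ule: "prob U \<le> prob B + e"
        using U(3) e unfolding cU cB by (simp add: ennreal_less_iff flip: ennreal_plus)
      have Um: "U \<in> sets m" using U(1) sets by simp
      have "prob U > 0" using finite_measure_mono[OF U(2) Um] a by linarith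
      then have "ennreal (prob U - e) < inner_content L U"
        using e by (cases "prob U - e \<ge> 0") (auto simp: cU ennreal_less_iff ennreal_neg)
      then obtain g :: "'a \<Rightarrow>\<^sub>C real" where g: "\<And>x. 0 \<le> apply_bcontfun g x" "\<And>x. apply_bcontfun g x \<le> indicator U x"
          "ennreal (prob U - e) < ennreal (L g)"
        unfolding inner_content_def less_SUP_iff by auto
      have Lg: "prob U - e \<le> L g"
      proof (rule ccontr)
        assume "\<not> ?thesis"
        then have "ennreal (L g) \<le> ennreal (prob U - e)" by (intro ennreal_leI) simp
        with g(3) show False by simp
      qed
      have "(\<integral>x. indicator B x - indicator B x * apply_bcontfun g x \<partial>m) \<le> (\<integral>x. indicator U x - apply_bcontfun g x \<partial>m)"
      proof (rule integral_mono)
        show "integrable m (\<lambda>x. indicator B x - indicator B x * apply_bcontfun g x)"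
          using Bm int by (intro Bochner_Integration.integrable_diff) (auto simp: less_top[symmetric] emeasure_eq_measure)
        show "integrable m (\<lambda>x. indicator U x - apply_bcontfun g x)"
          using Um int0 by (intro Bochner_Integration.integrable_diff) (auto simp: less_top[symmetric] emeasure_eq_measure)
        show "indicator B x - indicator B x * apply_bcontfun g x \<le> indicator U x - apply_bcontfun g x" for x
          using g(2)[of x] U(2) by (cases "x \<in> B") (auto simp: subsetD)
      qed
      then have "prob B - prob B * L1 g \<le> prob U - L g"
        using Bm Um int int0 a by (simp add: Bochner_Integration.integral_diff L1_def rep
            less_top[symmetric] emeasure_eq_measure)
      then have "prob B - e \<le> prob B * L g" using Lg by (simp add: L1L)
      also have "L g \<le> prob U"
      proof -
        have "L g \<le> (\<integral>x. indicator U x \<partial>m)" unfolding rep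
          using Um g(2) int0 by (intro integral_mono) (auto simp: less_top[symmetric] emeasure_eq_measure)
        then show ?thesis using Um by simp
      qed
      then have "prob B * L g \<le> prob B * (prob B + e)" using Ule a by (intro mult_left_mono) auto
      finally show ?thesis .
    qed
    \<comment> \<open>With this choice the bound would give \<open>4 e \<le> e + prob B * e \<le> 2 e\<close>.\<close>
    define e where "e = prob B * (1 - prob B) / 4"
    have e: "e > 0" unfolding e_def using a by simp
    have "prob B * e \<le> e" using a e by (simp add: mult_le_cancel_right1)
    moreover have "4 * e = prob B - prob B * prob B" by (simp add: e_def field_simps)
    moreover have "prob B - e \<le> prob B * prob B + prob B * e"
      using bound[OF e] by (simp only: distrib_left)
    ultimately show False using e by linarith
  qed
  then show ?thesis using inv unfolding ergodic_measure_def by blast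
qed

text \<open>
There are invariant means taking the largest possible value at \<open>g\<close> and at \<open>- g\<close>, respectively; since they have the same
Riesz measure, they agree at \<open>g\<close>.
\<close>

theorem uniquely_ergodic_upper_mean_neg:
  fixes \<sigma> :: "real \<Rightarrow> 'a::metric_space \<Rightarrow> 'a"
  assumes cpt: "compact (UNIV :: 'a set)" and \<sigma>: "continuous_flow \<sigma>" and ue: "uniquely_ergodic \<sigma>"
  shows "upper_mean \<sigma> (- g) = - upper_mean \<sigma> g"
proof -
  obtain L1 where L1: "linear L1" "L1 \<le> upper_mean \<sigma>" "L1 g = upper_mean \<sigma> g"
    by (rule attaining_dominated_functional[OF sublinear_upper_mean[OF \<sigma>]])
  obtain L2 where L2: "linear L2" "L2 \<le> upper_mean \<sigma>" "L2 (- g) = upper_mean \<sigma> (- g)"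
    by (rule attaining_dominated_functional[OF sublinear_upper_mean[OF \<sigma>]])
  have i: "invariant_mean \<sigma> L1" "invariant_mean \<sigma> L2"
    using L1 L2 le_upper_mean_imp_invariant_mean[OF \<sigma>] by blast+
  then have "riesz_measure L1 = riesz_measure L2"
    using invariant_measure_riesz[OF cpt \<sigma>] ue unfolding uniquely_ergodic_def by blast
  then have "L1 g = L2 g"
    using i riesz_representation[OF cpt, of L1 g] riesz_representation[OF cpt, of L2 g]
    by (simp add: invariant_mean_def)
  then show ?thesis using L1(3) L2(1,3) by (simp add: linear_neg)
qed

section \<open>Gronwall inequality and global Picard theorem\<close>

text \<open>
Squaring removes the absolute value, which need not be differentiable. The additional 1 in the exponent absorbs the mixed term
\<open>2 \<bar>e\<bar> \<eta> \<le> e\<^sup>2 + \<eta>\<^sup>2\<close>.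
\<close>

lemma gronwall_perturbed:
  fixes e e' :: "real \<Rightarrow> real"
  assumes der: "\<And>s. 0 \<le> s \<Longrightarrow> s \<le> t \<Longrightarrow> (e has_real_derivative e' s) (at s)"
    and bnd: "\<And>s. 0 \<le> s \<Longrightarrow> s \<le> t \<Longrightarrow> \<bar>e' s\<bar> \<le> L * \<bar>e s\<bar> + \<eta>"
    and t: "0 \<le> t" and L: "0 \<le> L"
  shows "(e t)\<^sup>2 \<le> ((e 0)\<^sup>2 + \<eta>\<^sup>2) * exp ((2 * L + 1) * t)"
proof -
  define K where "K = 2 * L + 1"
  define g where "g s = ((e s)\<^sup>2 + \<eta>\<^sup>2) * exp (- K * s)" for s
  have "g t \<le> g 0"
  proof (rule DERIV_nonpos_imp_nonincreasing[OF t])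
    fix s assume s: "0 \<le> s" "s \<le> t"
    have d: "(g has_real_derivative (2 * e s * e' s - K * ((e s)\<^sup>2 + \<eta>\<^sup>2)) * exp (- K * s)) (at s)"
      unfolding g_def by (auto intro!: derivative_eq_intros der[OF s] simp: algebra_simps)
    have "2 * e s * e' s \<le> 2 * \<bar>e s\<bar> * \<bar>e' s\<bar>"
      by (metis abs_ge_self abs_mult abs_numeral)
    also have "\<dots> \<le> 2 * \<bar>e s\<bar> * (L * \<bar>e s\<bar> + \<eta>)" using bnd[OF s] by (intro mult_left_mono) auto
    also have "\<dots> = 2 * L * (e s)\<^sup>2 + 2 * \<bar>e s\<bar> * \<eta>"
      by (simp add: algebra_simps power2_eq_square flip: abs_mult)
    also have "2 * \<bar>e s\<bar> * \<eta> \<le> (e s)\<^sup>2 + \<eta>\<^sup>2" using sum_squares_bound[of "\<bar>e s\<bar>" \<eta>] by simp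
    finally have "2 * e s * e' s - K * ((e s)\<^sup>2 + \<eta>\<^sup>2) \<le> - (2 * L * \<eta>\<^sup>2)"
      by (simp add: K_def algebra_simps)
    also have "\<dots> \<le> 0" using L by simp
    finally show "\<exists>y. (g has_real_derivative y) (at s) \<and> y \<le> 0"
      using d by (auto simp: mult_nonpos_nonneg)
  qed
  then have "((e t)\<^sup>2 + \<eta>\<^sup>2) * exp (- K * t) * exp (K * t) \<le> ((e 0)\<^sup>2 + \<eta>\<^sup>2) * exp (K * t)"
    by (intro mult_right_mono) (auto simp: g_def)
  then have "(e t)\<^sup>2 + \<eta>\<^sup>2 \<le> ((e 0)\<^sup>2 + \<eta>\<^sup>2) * exp (K * t)"
    by (simp add: mult.assoc flip: exp_add)
  then show ?thesis unfolding K_def using zero_le_power2[of \<eta>] by linarith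
qed

lemma gronwall_zero:
  fixes e e' :: "real \<Rightarrow> real"
  assumes der: "\<And>s. 0 \<le> s \<Longrightarrow> s \<le> t \<Longrightarrow> (e has_real_derivative e' s) (at s)"
    and bnd: "\<And>s. 0 \<le> s \<Longrightarrow> s \<le> t \<Longrightarrow> \<bar>e' s\<bar> \<le> L * \<bar>e s\<bar>"
    and t: "0 \<le> t" and L: "0 \<le> L" and e0: "e 0 = 0"
  shows "e t = 0"
  using gronwall_perturbed[OF der, of t L 0] bnd t L e0 by simp

lemma antiderivative_from_0:
  fixes g :: "real \<Rightarrow> real"
  assumes g: "continuous_on UNIV g"
  shows "((\<lambda>u. LBINT s=ereal 0..ereal u. g s) has_real_derivative g t) (at t)"
proof -
  define a where "a = - \<bar>t\<bar> - 1"
  define b where "b = \<bar>t\<bar> + 1"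
  have "((\<lambda>u. LBINT s=ereal 0..ereal u. g s) has_vector_derivative g t) (at t within {a..b})"
    by (rule interval_integral_FTC2) (auto simp: a_def b_def intro: continuous_on_subset[OF g])
  then have "((\<lambda>u. LBINT s=ereal 0..ereal u. g s) has_vector_derivative g t) (at t within {a<..<b})"
    by (rule has_vector_derivative_within_subset) auto
  then show ?thesis
    by (subst (asm) at_within_open) (auto simp: a_def b_def has_real_derivative_iff_has_vector_derivative)
qed

lemma antiderivative_exp_bound_forward:
  fixes G g :: "real \<Rightarrow> real"
  assumes der: "\<And>s. 0 \<le> s \<Longrightarrow> (G has_real_derivative g s) (at s)" and G0: "G 0 = 0"
    and bnd: "\<And>s. 0 \<le> s \<Longrightarrow> \<bar>g s\<bar> \<le> c * exp (K * s)" and K: "K > 0" and c: "c \<ge> 0" and t: "t \<ge> 0"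
  shows "\<bar>G t\<bar> \<le> c / K * exp (K * t)"
proof -
  have up: "G t \<le> c / K * exp (K * t)"
    if der: "\<And>s. 0 \<le> s \<Longrightarrow> (G has_real_derivative g s) (at s)" and G0: "G 0 = 0"
    and bnd: "\<And>s. 0 \<le> s \<Longrightarrow> \<bar>g s\<bar> \<le> c * exp (K * s)" for G g
  proof -
    have "c / K * exp (K * 0) - G 0 \<le> c / K * exp (K * t) - G t"
    proof (rule DERIV_nonneg_imp_nondecreasing[OF t])
      fix s assume s: "0 \<le> s" "s \<le> t"
      have "((\<lambda>s. c / K * exp (K * s) - G s) has_real_derivative c * exp (K * s) - g s) (at s)"
        using K by (auto intro!: derivative_eq_intros der[OF s(1)])
      then show "\<exists>y. ((\<lambda>s. c / K * exp (K * s) - G s) has_real_derivative y) (at s) \<and> 0 \<le> y"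
        using bnd[OF s(1)] by (intro exI conjI) (auto simp: abs_le_iff)
    qed
    moreover have "c / K \<ge> 0" using c K by simp
    ultimately show ?thesis using G0 by simp
  qed
  have "- G t \<le> c / K * exp (K * t)"
    by (rule up[of "\<lambda>s. - G s" "\<lambda>s. - g s"]) (auto intro!: derivative_eq_intros der simp: G0 bnd)
  with up[OF der G0 bnd] show ?thesis by (simp add: abs_le_iff)
qed

text \<open>
Integration gains the factor \<open>1 / K\<close> on functions of growth \<open>exp (K \<bar>t\<bar>)\<close>; this makes the Picard operator a contraction
on the whole line.
\<close>

lemma antiderivative_exp_bound:
  fixes G g :: "real \<Rightarrow> real"
  assumes der: "\<And>s. (G has_real_derivative g s) (at s)" and G0: "G 0 = 0"
    and bnd: "\<And>s. \<bar>g s\<bar> \<le> c * exp (K * \<bar>s\<bar>)" and K: "K > 0" and c: "c \<ge> 0"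
  shows "\<bar>G t\<bar> \<le> c / K * exp (K * \<bar>t\<bar>)"
proof (cases "t \<ge> 0")
  case True
  have b: "\<bar>g s\<bar> \<le> c * exp (K * s)" if "0 \<le> s" for s using bnd[of s] that by simp
  show ?thesis using antiderivative_exp_bound_forward[OF der G0 b K c True] True by simp
next
  case False
  have d: "((\<lambda>s. G (- s)) has_real_derivative - g (- s)) (at s)" for s
    using DERIV_chain2[where f = G and g = uminus and x = s, OF der DERIV_minus[OF DERIV_ident]] by simp
  have b: "\<bar>- g (- s)\<bar> \<le> c * exp (K * s)" if "0 \<le> s" for s using bnd[of "- s"] that by simp
  have "\<bar>G (- (- t))\<bar> \<le> c / K * exp (K * (- t))"
    by (rule antiderivative_exp_bound_forward[OF d _ b K c]) (use False G0 in auto)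
  then show ?thesis using False by simp
qed

text \<open>
Banach's fixed point theorem for bounded continuous functions. With unknown \<open>v\<close> and solution
\<open>x0 + exp (K \<bar>t\<bar>) * v t\<close>, the exponential weight makes the Picard operator a contraction on all of \<open>\<real>\<close>,
and no local solutions have to be glued.
\<close>

theorem picard_global:
  fixes h :: "real \<Rightarrow> real \<Rightarrow> real"
  assumes cont: "continuous_on UNIV (\<lambda>(t, x). h t x)"
    and bnd: "\<And>t x. \<bar>h t x\<bar> \<le> C"
    and lip: "\<And>t x y. \<bar>h t x - h t y\<bar> \<le> L * \<bar>x - y\<bar>"
  obtains v where "v 0 = x0" "\<And>t. (v has_real_derivative h t (v t)) (at t)"
proof -
  have C: "C \<ge> 0" using bnd[of 0 0] by linarith
  define M where "M = max L 1"
  have M: "M \<ge> 1" "\<bar>h t x - h t y\<bar> \<le> M * \<bar>x - y\<bar>" for t x y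
  proof -
    have "L * \<bar>x - y\<bar> \<le> M * \<bar>x - y\<bar>" by (intro mult_right_mono) (auto simp: M_def)
    then show "\<bar>h t x - h t y\<bar> \<le> M * \<bar>x - y\<bar>" using lip[of t x y] by linarith
  qed (simp add: M_def)
  \<comment> \<open>Twice the Lipschitz constant, for the contraction factor \<open>M / K = 1 / 2\<close>.\<close>
  define K where "K = 2 * M"
  have K: "K > 0" using M by (simp add: K_def)
  define w where "w v t = x0 + exp (K * \<bar>t\<bar>) * apply_bcontfun v t" for v :: "real \<Rightarrow>\<^sub>C real" and t
  have hc: "continuous_on UNIV (\<lambda>t. h t (w v t))" for v
  proof -
    have "continuous_on UNIV (\<lambda>t. (t, w v t))"
      unfolding w_def by (intro continuous_intros continuous_on_apply_bcontfun)
    from continuous_on_compose2[OF cont this] show ?thesis by simp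
  qed
  define A where "A v t = (LBINT s=ereal 0..ereal t. h s (w v s))" for v t
  have A0: "A v 0 = 0" for v by (simp add: A_def)
  have Ad: "(A v has_real_derivative h t (w v t)) (at t)" for v t
    unfolding A_def by (rule antiderivative_from_0[OF hc])
  have Ac: "continuous_on UNIV (A v)" for v
    by (rule DERIV_continuous_on[OF Ad])
  have Ab: "\<bar>A v t\<bar> \<le> C / K * exp (K * \<bar>t\<bar>)" for v t
  proof (rule antiderivative_exp_bound[OF Ad A0 _ K C])
    fix s
    have "C * 1 \<le> C * exp (K * \<bar>s\<bar>)" using C K by (intro mult_left_mono) auto
    then show "\<bar>h s (w v s)\<bar> \<le> C * exp (K * \<bar>s\<bar>)" using bnd[of s "w v s"] by linarith
  qed
  define P where "P v = Bcontfun (\<lambda>t. exp (- K * \<bar>t\<bar>) * A v t)" for v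
  have P: "apply_bcontfun (P v) t = exp (- K * \<bar>t\<bar>) * A v t" for v t
  proof -
    have "(\<lambda>t. exp (- K * \<bar>t\<bar>) * A v t) \<in> bcontfun"
    proof (rule bcontfun_normI)
      show "continuous_on UNIV (\<lambda>t. exp (- K * \<bar>t\<bar>) * A v t)" by (intro continuous_intros Ac)
      fix t
      have "exp (- K * \<bar>t\<bar>) * \<bar>A v t\<bar> \<le> exp (- K * \<bar>t\<bar>) * (C / K * exp (K * \<bar>t\<bar>))"
        by (intro mult_left_mono Ab) auto
      also have "\<dots> = C / K" by (simp add: exp_minus)
      finally show "norm (exp (- K * \<bar>t\<bar>) * A v t) \<le> C / K" by (simp add: abs_mult)
    qed
    then show ?thesis by (simp add: P_def Bcontfun_inverse)
  qed
  have "dist (P v) (P u) \<le> 1 / 2 * dist v u" for v u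
  proof (rule dist_bound)
    fix t
    have "\<bar>A v t - A u t\<bar> \<le> (M * dist v u) / K * exp (K * \<bar>t\<bar>)"
    proof (rule antiderivative_exp_bound[where g = "\<lambda>s. h s (w v s) - h s (w u s)", OF _ _ _ K])
      fix s
      show "((\<lambda>t. A v t - A u t) has_real_derivative h s (w v s) - h s (w u s)) (at s)"
        by (intro DERIV_diff Ad)
      have "w v s - w u s = exp (K * \<bar>s\<bar>) * (apply_bcontfun v s - apply_bcontfun u s)"
        by (simp add: w_def algebra_simps)
      then have "\<bar>w v s - w u s\<bar> = exp (K * \<bar>s\<bar>) * dist (apply_bcontfun v s) (apply_bcontfun u s)"
        by (simp add: abs_mult dist_real_def)
      also have "\<dots> \<le> exp (K * \<bar>s\<bar>) * dist v u" by (intro mult_left_mono dist_bounded) auto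
      finally have "M * \<bar>w v s - w u s\<bar> \<le> M * (exp (K * \<bar>s\<bar>) * dist v u)"
        using M by (intro mult_left_mono) auto
      then show "\<bar>h s (w v s) - h s (w u s)\<bar> \<le> M * dist v u * exp (K * \<bar>s\<bar>)"
        using M(2)[of s "w v s" "w u s"] by (simp add: mult_ac)
    qed (use M A0 in auto)
    then have "exp (- K * \<bar>t\<bar>) * \<bar>A v t - A u t\<bar> \<le> exp (- K * \<bar>t\<bar>) * ((M * dist v u) / K * exp (K * \<bar>t\<bar>))"
      by (intro mult_left_mono) auto
    also have "\<dots> = 1 / 2 * dist v u" using M by (simp add: K_def exp_minus)
    finally show "dist (apply_bcontfun (P v) t) (apply_bcontfun (P u) t) \<le> 1 / 2 * dist v u"
      by (simp add: P dist_real_def abs_mult flip: right_diff_distrib)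
  qed
  then have "\<exists>!v. P v = v" by (intro banach_fix_type[of "1/2"]) auto
  then obtain v where v: "P v = v" by blast
  have wA: "w v t = x0 + A v t" for t
  proof -
    have "apply_bcontfun v t = exp (- K * \<bar>t\<bar>) * A v t" using P[of v t] v by simp
    then show ?thesis by (simp add: w_def exp_minus)
  qed
  show thesis
  proof (rule that[of "w v"])
    show "w v 0 = x0" by (simp add: wA A0)
    have "((\<lambda>t. x0 + A v t) has_real_derivative h t (w v t)) (at t)" for t
      by (auto intro!: derivative_eq_intros Ad)
    then show "(w v has_real_derivative h t (w v t)) (at t)" for t by (simp add: wA[abs_def])
  qed
qed

section \<open>The skew-product flow and integrals of \<open>f\<^sub>x\<close> along its orbits\<close>

locale C1_skew_ode =
  fixes \<sigma> :: "real \<Rightarrow> 'a::metric_space \<Rightarrow> 'a" and f :: "'a \<Rightarrow> real \<Rightarrow> real"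
  assumes cpt: "compact (UNIV :: 'a set)" and flow: "continuous_flow \<sigma>"
    and f_deriv: "\<And>\<omega> x. (f \<omega> has_real_derivative fx f \<omega> x) (at x)"
    and f_cont: "continuous_on UNIV (\<lambda>(\<omega>, x). f \<omega> x)"
    and fx_cont: "continuous_on UNIV (\<lambda>(\<omega>, x). fx f \<omega> x)"
begin

lemma f_cont_compose:
  assumes "continuous_on A p" "continuous_on A q"
  shows "continuous_on A (\<lambda>x. f (p x) (q x))"
  using continuous_on_compose2[OF f_cont continuous_on_Pair[OF assms]] by simp

lemma fx_cont_compose:
  assumes "continuous_on A p" "continuous_on A q"
  shows "continuous_on A (\<lambda>x. fx f (p x) (q x))"
  using continuous_on_compose2[OF fx_cont continuous_on_Pair[OF assms]] by simp

lemma compact_strip: "compact ((UNIV :: 'a set) \<times> {- R..R :: real})"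
  by (intro compact_Times cpt compact_Icc)

lemma f_bounded: obtains C where "\<And>\<omega> x. \<bar>x\<bar> \<le> R \<Longrightarrow> \<bar>f \<omega> x\<bar> \<le> C"
proof -
  have "bounded ((\<lambda>(\<omega>, x). f \<omega> x) ` (UNIV \<times> {- R..R}))"
    by (intro compact_imp_bounded compact_continuous_image compact_strip continuous_on_subset[OF f_cont]) auto
  then obtain C where C: "\<And>y. y \<in> (\<lambda>(\<omega>, x). f \<omega> x) ` (UNIV \<times> {- R..R}) \<Longrightarrow> norm y \<le> C"
    unfolding bounded_iff by blast
  have "\<bar>f \<omega> x\<bar> \<le> C" if "\<bar>x\<bar> \<le> R" for \<omega> x
    using C[of "f \<omega> x"] that by (force simp: abs_le_iff)
  then show thesis by (rule that)
qed

lemma fx_bounded: obtains C where "C \<ge> 0" "\<And>\<omega> x. \<bar>x\<bar> \<le> R \<Longrightarrow> \<bar>fx f \<omega> x\<bar> \<le> C"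
proof -
  have "bounded ((\<lambda>(\<omega>, x). fx f \<omega> x) ` (UNIV \<times> {- R..R}))"
    by (intro compact_imp_bounded compact_continuous_image compact_strip continuous_on_subset[OF fx_cont]) auto
  then obtain C where C: "\<And>y. y \<in> (\<lambda>(\<omega>, x). fx f \<omega> x) ` (UNIV \<times> {- R..R}) \<Longrightarrow> norm y \<le> C"
    unfolding bounded_iff by blast
  have "\<bar>fx f \<omega> x\<bar> \<le> max C 0" if "\<bar>x\<bar> \<le> R" for \<omega> x
    using C[of "fx f \<omega> x"] that by (force simp: abs_le_iff)
  then show thesis by (intro that[of "max C 0"]) auto
qed

lemma f_lipschitz:
  obtains L where "L \<ge> 0" "\<And>\<omega> x y. \<bar>x\<bar> \<le> R \<Longrightarrow> \<bar>y\<bar> \<le> R \<Longrightarrow> \<bar>f \<omega> x - f \<omega> y\<bar> \<le> L * \<bar>x - y\<bar>"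
proof -
  obtain L where L: "L \<ge> 0" "\<And>\<omega> x. \<bar>x\<bar> \<le> R \<Longrightarrow> \<bar>fx f \<omega> x\<bar> \<le> L"
    using fx_bounded[of R] by metis
  have "\<bar>f \<omega> x - f \<omega> y\<bar> \<le> L * \<bar>x - y\<bar>" if "\<bar>x\<bar> \<le> R" "\<bar>y\<bar> \<le> R" for \<omega> x y
  proof -
    have "norm (f \<omega> x - f \<omega> y) \<le> L * norm (x - y)"
    proof (rule field_differentiable_bound[of "{- R..R}" "f \<omega>" "fx f \<omega>"])
      show "norm (fx f \<omega> z) \<le> L" if "z \<in> {- R..R}" for z
        using L(2)[of z] that by (simp add: abs_le_iff)
    qed (use that in \<open>auto simp: abs_le_iff intro: has_field_derivative_at_within[OF f_deriv]\<close>)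
    then show ?thesis by simp
  qed
  with L(1) show thesis by (rule that)
qed

text \<open>
On the compact interval between 0 and \<open>t\<close> both solutions are bounded, hence the field is Lipschitz along them. The sign
\<open>c\<close> reflects negative times to positive ones.
\<close>

lemma solves_unique:
  assumes v: "solves \<sigma> f \<omega> x I v" and w: "solves \<sigma> f \<omega> x J w" and t: "t \<in> I" "t \<in> J"
  shows "v t = w t"
proof -
  define c where "c = (if t \<ge> 0 then 1 else - 1 :: real)"
  have c: "c * \<bar>t\<bar> = t" "\<bar>c\<bar> = 1" by (auto simp: c_def)
  have I: "c * s \<in> I" "c * s \<in> J" if "0 \<le> s" "s \<le> \<bar>t\<bar>" for s
    using v w t that unfolding solves_def c_def
    by (auto split: if_splits intro: mem_is_interval_1_I[of I 0 t] mem_is_interval_1_I[of I t 0]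
        mem_is_interval_1_I[of J 0 t] mem_is_interval_1_I[of J t 0])
  have dv: "(v has_real_derivative f (\<sigma> s \<omega>) (v s)) (at s)" if "s \<in> I" for s
    using v that by (simp add: solves_def)
  have dw: "(w has_real_derivative f (\<sigma> s \<omega>) (w s)) (at s)" if "s \<in> J" for s
    using w that by (simp add: solves_def)
  have dv': "((\<lambda>s. v (c * s)) has_real_derivative c * f (\<sigma> (c * s) \<omega>) (v (c * s))) (at s)"
    if "0 \<le> s" "s \<le> \<bar>t\<bar>" for s
    using DERIV_chain2[where f = v and g = "\<lambda>s. c * s" and x = s, OF dv[OF I(1)[OF that]] DERIV_cmult_Id]
    by (simp add: mult.commute)
  have dw': "((\<lambda>s. w (c * s)) has_real_derivative c * f (\<sigma> (c * s) \<omega>) (w (c * s))) (at s)"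
    if "0 \<le> s" "s \<le> \<bar>t\<bar>" for s
    using DERIV_chain2[where f = w and g = "\<lambda>s. c * s" and x = s, OF dw[OF I(2)[OF that]] DERIV_cmult_Id]
    by (simp add: mult.commute)
  have "continuous_on {0..\<bar>t\<bar>} (\<lambda>s. v (c * s))" "continuous_on {0..\<bar>t\<bar>} (\<lambda>s. w (c * s))"
    by (auto intro!: continuous_at_imp_continuous_on DERIV_isCont[OF dv'] DERIV_isCont[OF dw'])
  then have "bounded ((\<lambda>s. v (c * s)) ` {0..\<bar>t\<bar>} \<union> (\<lambda>s. w (c * s)) ` {0..\<bar>t\<bar>})"
    by (simp add: compact_imp_bounded compact_continuous_image)
  then obtain R where R: "\<And>s. 0 \<le> s \<Longrightarrow> s \<le> \<bar>t\<bar> \<Longrightarrow> \<bar>v (c * s)\<bar> \<le> R \<and> \<bar>w (c * s)\<bar> \<le> R"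
    unfolding bounded_iff by fastforce
  obtain L where L: "L \<ge> 0" "\<And>\<omega> x y. \<bar>x\<bar> \<le> R \<Longrightarrow> \<bar>y\<bar> \<le> R \<Longrightarrow> \<bar>f \<omega> x - f \<omega> y\<bar> \<le> L * \<bar>x - y\<bar>"
    using f_lipschitz[of R] by metis
  have "v (c * \<bar>t\<bar>) - w (c * \<bar>t\<bar>) = 0"
  proof (rule gronwall_zero[where e = "\<lambda>s. v (c * s) - w (c * s)" and L = L])
    fix s assume s: "0 \<le> s" "s \<le> \<bar>t\<bar>"
    show "((\<lambda>s. v (c * s) - w (c * s)) has_real_derivative
        c * f (\<sigma> (c * s) \<omega>) (v (c * s)) - c * f (\<sigma> (c * s) \<omega>) (w (c * s))) (at s)"
      by (intro DERIV_diff dv'[OF s] dw'[OF s])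
    have "\<bar>c * f (\<sigma> (c * s) \<omega>) (v (c * s)) - c * f (\<sigma> (c * s) \<omega>) (w (c * s))\<bar> =
        \<bar>f (\<sigma> (c * s) \<omega>) (v (c * s)) - f (\<sigma> (c * s) \<omega>) (w (c * s))\<bar>"
      by (simp add: c(2) abs_mult flip: right_diff_distrib)
    also have "\<dots> \<le> L * \<bar>v (c * s) - w (c * s)\<bar>" using R[OF s] by (intro L(2)) auto
    finally show "\<bar>c * f (\<sigma> (c * s) \<omega>) (v (c * s)) - c * f (\<sigma> (c * s) \<omega>) (w (c * s))\<bar> \<le> L * \<bar>v (c * s) - w (c * s)\<bar>" .
  qed (use L v w in \<open>auto simp: solves_def\<close>)
  then show ?thesis by (simp add: c(1))
qed

lemma max_sol_eq:
  assumes "solves \<sigma> f \<omega> x I v" "t \<in> I"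
  shows "max_sol \<sigma> f t \<omega> x = v t"
  unfolding max_sol_def using assms solves_unique by (intro the_equality) blast+

lemma solves_imp_max_interval: "solves \<sigma> f \<omega> x I v \<Longrightarrow> t \<in> I \<Longrightarrow> t \<in> max_interval \<sigma> f \<omega> x"
  unfolding max_interval_def by blast

lemma max_sol_deriv:
  assumes "t \<in> max_interval \<sigma> f \<omega> x"
  shows "((\<lambda>s. max_sol \<sigma> f s \<omega> x) has_real_derivative f (\<sigma> t \<omega>) (max_sol \<sigma> f t \<omega> x)) (at t)"
proof -
  obtain I v where I: "solves \<sigma> f \<omega> x I v" "t \<in> I" using assms by (auto simp: max_interval_def)
  have "(v has_real_derivative f (\<sigma> t \<omega>) (v t)) (at t)" "open I" using I by (auto simp: solves_def)
  then have "((\<lambda>s. max_sol \<sigma> f s \<omega> x) has_real_derivative f (\<sigma> t \<omega>) (v t)) (at t)"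
    by (rule has_field_derivative_transform_within_open[OF _ _ I(2)]) (simp add: max_sol_eq[OF I(1)])
  then show ?thesis by (simp add: max_sol_eq[OF I])
qed

lemma max_sol_0:
  assumes "t \<in> max_interval \<sigma> f \<omega> x"
  shows "max_sol \<sigma> f 0 \<omega> x = x"
proof -
  obtain I v where I: "solves \<sigma> f \<omega> x I v" using assms by (auto simp: max_interval_def)
  then have "0 \<in> I" "v 0 = x" by (auto simp: solves_def)
  with max_sol_eq[OF I] show ?thesis by simp
qed

definition rate :: "'a \<times> real \<Rightarrow> real" where "rate z = fx f (fst z) (snd z)"

text \<open>
The integral of \<open>f\<^sub>x\<close> along the orbit of \<open>z\<close>: its exponential is the derivative of the solution with respect to the initial
value, and exponential dichotomy, the spectrum and attractivity are all statements about its growth.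
\<close>

definition expo :: "'a \<times> real \<Rightarrow> real \<Rightarrow> real" where
  "expo z t = (LBINT s=ereal 0..ereal t. rate (skew_flow \<sigma> f s z))"

lemma fst_skew_flow [simp]: "fst (skew_flow \<sigma> f t z) = \<sigma> t (fst z)"
  by (simp add: skew_flow_def split: prod.split)

lemma snd_skew_flow: "snd (skew_flow \<sigma> f t z) = max_sol \<sigma> f t (fst z) (snd z)"
  by (simp add: skew_flow_def split: prod.split)

lemma expo_0 [simp]: "expo z 0 = 0" by (simp add: expo_def)

context
  fixes M assumes M: "compact M" "skew_invariant \<sigma> f M"
begin

lemma invariant_full: "z \<in> M \<Longrightarrow> max_interval \<sigma> f (fst z) (snd z) = UNIV"
  using M(2) by (auto simp: skew_invariant_def)

lemma invariant_step: "z \<in> M \<Longrightarrow> skew_flow \<sigma> f t z \<in> M"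
  using M(2) imageI[of z M "skew_flow \<sigma> f t"] by (simp add: skew_invariant_def)

lemma skew_flow_0: "z \<in> M \<Longrightarrow> skew_flow \<sigma> f 0 z = z"
  using max_sol_0[of 0 "fst z" "snd z"] invariant_full[of z]
  by (intro prod_eqI) (auto simp: flow_zero[OF flow] snd_skew_flow)

lemma snd_skew_flow_deriv:
  "z \<in> M \<Longrightarrow> ((\<lambda>t. snd (skew_flow \<sigma> f t z)) has_real_derivative
     f (\<sigma> t (fst z)) (snd (skew_flow \<sigma> f t z))) (at t)"
  using max_sol_deriv[of t "fst z" "snd z"] invariant_full[of z] by (simp add: snd_skew_flow)

lemma snd_skew_flow_cont: "z \<in> M \<Longrightarrow> continuous_on A (\<lambda>t. snd (skew_flow \<sigma> f t z))"
  by (intro continuous_at_imp_continuous_on ballI DERIV_isCont[OF snd_skew_flow_deriv])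

lemma skew_flow_add:
  assumes z: "z \<in> M"
  shows "skew_flow \<sigma> f (s + t) z = skew_flow \<sigma> f s (skew_flow \<sigma> f t z)"
proof (rule prod_eqI)
  show "fst (skew_flow \<sigma> f (s + t) z) = fst (skew_flow \<sigma> f s (skew_flow \<sigma> f t z))"
    by (simp add: flow_add[OF flow])
  let ?w = "\<lambda>s. snd (skew_flow \<sigma> f (s + t) z)"
  have "(?w has_real_derivative f (\<sigma> s (\<sigma> t (fst z))) (?w s)) (at s)" for s
  proof -
    have "((\<lambda>s. s + t) has_real_derivative 1) (at s)" by (auto intro!: derivative_eq_intros)
    from DERIV_chain2[where g = "\<lambda>s. s + t" and x = s, OF snd_skew_flow_deriv[OF z] this]
    show ?thesis by (simp add: flow_add[OF flow])
  qed
  then have "solves \<sigma> f (\<sigma> t (fst z)) (snd (skew_flow \<sigma> f t z)) UNIV ?w"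
    by (auto simp: solves_def)
  from max_sol_eq[OF this, of s]
  show "snd (skew_flow \<sigma> f (s + t) z) = snd (skew_flow \<sigma> f s (skew_flow \<sigma> f t z))"
    by (simp add: snd_skew_flow)
qed

lemma bounded_fibres: obtains R where "\<And>z. z \<in> M \<Longrightarrow> \<bar>snd z\<bar> \<le> R"
proof -
  have "bounded (snd ` M)" by (intro compact_imp_bounded compact_continuous_image M continuous_intros)
  then obtain R where "\<forall>x\<in>snd ` M. norm x \<le> R" unfolding bounded_iff by blast
  then have "\<bar>snd z\<bar> \<le> R" if "z \<in> M" for z using that by simp
  then show thesis by (rule that)
qed

lemma rate_cont: "z \<in> M \<Longrightarrow> continuous_on A (\<lambda>s. rate (skew_flow \<sigma> f s z))"
  unfolding rate_def fst_skew_flow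
  by (intro fx_cont_compose snd_skew_flow_cont flow_cont_joint[OF flow] continuous_intros)

lemma expo_deriv: "z \<in> M \<Longrightarrow> (expo z has_real_derivative rate (skew_flow \<sigma> f t z)) (at t)"
  unfolding expo_def by (intro antiderivative_from_0 rate_cont)

lemma expo_add:
  assumes z: "z \<in> M"
  shows "expo z (t + s) = expo z t + expo (skew_flow \<sigma> f t z) s"
proof -
  have d: "\<forall>s. ((\<lambda>s. expo z (t + s) - expo (skew_flow \<sigma> f t z) s) has_real_derivative 0) (at s)"
  proof
    fix s
    have "((\<lambda>s. t + s) has_real_derivative 1) (at s)" by (auto intro!: derivative_eq_intros)
    from DERIV_chain2[where g = "\<lambda>s. t + s" and x = s, OF expo_deriv[OF z] this]
    have "((\<lambda>s. expo z (t + s)) has_real_derivative rate (skew_flow \<sigma> f (t + s) z) * 1) (at s)" .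
    moreover have "skew_flow \<sigma> f (t + s) z = skew_flow \<sigma> f s (skew_flow \<sigma> f t z)"
      using skew_flow_add[OF z, of s t] by (simp add: add.commute)
    ultimately have "((\<lambda>s. expo z (t + s)) has_real_derivative rate (skew_flow \<sigma> f s (skew_flow \<sigma> f t z))) (at s)"
      by simp
    from DERIV_diff[OF this expo_deriv[OF invariant_step[OF z, of t], of s]]
    show "((\<lambda>s. expo z (t + s) - expo (skew_flow \<sigma> f t z) s) has_real_derivative 0) (at s)"
      by simp
  qed
  show ?thesis using DERIV_isconst_all[OF d, of s 0] by simp
qed

lemma expo_lipschitz:
  obtains A where "A \<ge> 0" "\<And>z s t. z \<in> M \<Longrightarrow> \<bar>expo z t - expo z s\<bar> \<le> A * \<bar>t - s\<bar>"
proof -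
  obtain R where R: "\<And>z. z \<in> M \<Longrightarrow> \<bar>snd z\<bar> \<le> R" using bounded_fibres by metis
  obtain A where A: "A \<ge> 0" "\<And>\<omega> x. \<bar>x\<bar> \<le> R \<Longrightarrow> \<bar>fx f \<omega> x\<bar> \<le> A"
    using fx_bounded[of R] by metis
  have "\<bar>expo z t - expo z s\<bar> \<le> A * \<bar>t - s\<bar>" if z: "z \<in> M" for z s t
    using field_differentiable_bound[of UNIV "expo z" "\<lambda>t. rate (skew_flow \<sigma> f t z)" A t s]
      expo_deriv[OF z] A(2) R[OF invariant_step[OF z]] by (auto simp: rate_def)
  with A(1) show thesis by (rule that)
qed

end

end

section \<open>Attractivity by first approximation\<close>

lemma dissipative_bound_of_Co:
  assumes "Co f"
  obtains R where "R \<ge> R0" "R > 0" "\<And>\<omega>. f \<omega> R < 0" "\<And>\<omega>. f \<omega> (- R) > 0"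
proof -
  have "\<forall>\<^sub>F x in at_infinity. \<forall>\<omega>. f \<omega> x / x < 0" using assms by (simp add: Co_def)
  then obtain b where b: "\<And>x \<omega>. b \<le> norm x \<Longrightarrow> f \<omega> x / x < 0" unfolding eventually_at_infinity by blast
  define R where "R = max (max R0 b) 1"
  have R: "R \<ge> R0" "R > 0" "b \<le> R" by (auto simp: R_def)
  have "f \<omega> R < 0" "f \<omega> (- R) > 0" for \<omega>
    using b[of R \<omega>] b[of "- R" \<omega>] R by (auto simp: divide_less_0_iff zero_less_divide_iff)
  then show thesis using R that by blast
qed

text \<open>
If \<open>v\<close> exceeded \<open>R\<close>, its maximum on \<open>{0..t}\<close> would be attained at a positive time with negative derivative,
and slightly earlier values would be larger.
\<close>

lemma upper_barrier:
  fixes v v' :: "real \<Rightarrow> real"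
  assumes der: "\<And>t. t \<ge> 0 \<Longrightarrow> (v has_real_derivative v' t) (at t)" and v0: "v 0 \<le> R"
    and neg: "\<And>t. t \<ge> 0 \<Longrightarrow> v t > R \<Longrightarrow> v' t < 0" and t: "t \<ge> 0"
  shows "v t \<le> R"
proof (rule ccontr)
  assume "\<not> ?thesis"
  then have vt: "v t > R" by simp
  have "continuous_on {0..t} v"
    by (intro continuous_at_imp_continuous_on ballI DERIV_isCont[OF der]) auto
  then obtain s where s: "s \<in> {0..t}" "\<And>r. r \<in> {0..t} \<Longrightarrow> v r \<le> v s"
    using continuous_attains_sup[of "{0..t}" v] t by auto
  have vs: "v s > R" using s(2)[of t] vt t by simp
  then have s0: "s > 0" using v0 s(1) by (cases "s = 0") auto
  obtain d where d: "d > 0" "\<And>h. h > 0 \<Longrightarrow> h < d \<Longrightarrow> v s < v (s - h)"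
    using DERIV_neg_dec_left[OF der neg[OF _ vs]] s(1) by auto
  define h where "h = min (d / 2) s"
  have "h > 0" "h < d" "s - h \<in> {0..t}" using d(1) s0 s(1) by (auto simp: h_def)
  then show False using d(2)[of h] s(2)[of "s - h"] by simp
qed

context C1_skew_ode
begin

text \<open>
The field cut off outside \<open>{- R..R}\<close> is bounded and Lipschitz, so it has a global solution. Forward in time
the signs of \<open>f\<close> at \<open>R\<close> and \<open>- R\<close> keep it in \<open>{- R..R}\<close>, where the two fields agree. Backward in
time this holds at least on a short interval, because the initial value is an interior point.
\<close>

lemma forward_solution:
  assumes R: "R > 0" "\<And>\<omega>. f \<omega> R < 0" "\<And>\<omega>. f \<omega> (- R) > 0" and y: "\<bar>y\<bar> < R"
  obtains I v where "solves \<sigma> f \<omega> y I v" "{0..} \<subseteq> I"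
proof -
  define cl where "cl x = max (- R) (min R x)" for x :: real
  have cl: "\<bar>cl x\<bar> \<le> R" "\<bar>x\<bar> \<le> R \<Longrightarrow> cl x = x" "x > R \<Longrightarrow> cl x = R" "x < - R \<Longrightarrow> cl x = - R"
    "\<bar>cl x - cl x'\<bar> \<le> \<bar>x - x'\<bar>" for x x'
    using R(1) by (auto simp: cl_def max_def min_def)
  define h where "h t x = f (\<sigma> t \<omega>) (cl x)" for t x
  obtain C where C: "\<And>\<omega> x. \<bar>x\<bar> \<le> R \<Longrightarrow> \<bar>f \<omega> x\<bar> \<le> C" using f_bounded[of R] by metis
  obtain L where L: "L \<ge> 0" "\<And>\<omega> x y. \<bar>x\<bar> \<le> R \<Longrightarrow> \<bar>y\<bar> \<le> R \<Longrightarrow> \<bar>f \<omega> x - f \<omega> y\<bar> \<le> L * \<bar>x - y\<bar>"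
    using f_lipschitz[of R] by metis
  have "continuous_on UNIV (\<lambda>p. h (fst p) (snd p))"
    unfolding h_def cl_def by (intro f_cont_compose flow_cont_joint[OF flow] continuous_intros)
  then have 1: "continuous_on UNIV (\<lambda>(t, x). h t x)" by (simp add: case_prod_beta')
  have 2: "\<bar>h t x\<bar> \<le> C" for t x unfolding h_def by (intro C cl)
  have 3: "\<bar>h t x - h t x'\<bar> \<le> L * \<bar>x - x'\<bar>" for t x x'
  proof -
    have "\<bar>h t x - h t x'\<bar> \<le> L * \<bar>cl x - cl x'\<bar>" unfolding h_def by (intro L(2) cl)
    also have "\<dots> \<le> L * \<bar>x - x'\<bar>" by (intro mult_left_mono cl L(1))
    finally show ?thesis .
  qed
  obtain v where v: "v 0 = y" "\<And>t. (v has_real_derivative h t (v t)) (at t)"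
    using picard_global[OF 1 2 3, of y] by metis
  have up: "v t \<le> R" if "t \<ge> 0" for t
    by (rule upper_barrier[OF v(2)]) (use v(1) y R that in \<open>auto simp: h_def cl\<close>)
  have "- v t \<le> R" if "t \<ge> 0" for t
  proof (rule upper_barrier[where v = "\<lambda>t. - v t" and v' = "\<lambda>t. - h t (v t)"])
    show "((\<lambda>t. - v t) has_real_derivative - h t (v t)) (at t)" for t by (intro DERIV_minus v(2))
    show "- h t (v t) < 0" if "- v t > R" for t using that R cl(4)[of "v t"] by (simp add: h_def)
  qed (use v(1) y that in auto)
  with up have vR: "\<bar>v t\<bar> \<le> R" if "t \<ge> 0" for t using that by (simp add: abs_le_iff)
  have "isCont v 0" by (rule DERIV_isCont[OF v(2)])
  then have "\<forall>\<^sub>F t in at 0. \<bar>v t\<bar> < R"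
    unfolding isCont_def using y v(1) by (intro order_tendstoD(2)[of _ "\<bar>v 0\<bar>"] tendsto_rabs) auto
  then obtain d where d: "d > 0" "\<And>t. t \<noteq> 0 \<Longrightarrow> dist t 0 < d \<Longrightarrow> \<bar>v t\<bar> < R"
    unfolding eventually_at by blast
  have vR': "\<bar>v t\<bar> \<le> R" if "t > - d" for t
    using vR[of t] d(2)[of t] that by (cases "t \<ge> 0") (auto simp: dist_real_def)
  have "solves \<sigma> f \<omega> y {- d<..} v"
    unfolding solves_def
  proof (intro conjI ballI)
    fix t assume "t \<in> {- d<..}"
    then have "cl (v t) = v t" by (intro cl(2) vR') simp
    then show "(v has_real_derivative f (\<sigma> t \<omega>) (v t)) (at t)" using v(2)[of t] by (simp add: h_def)
  qed (use d(1) v(1) in \<open>auto simp: is_interval_1\<close>)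
  moreover have "{0..} \<subseteq> {- d<..}" using d(1) by auto
  ultimately show thesis by (rule that)
qed

lemma uniformly_continuous_strip:
  fixes F :: "real \<Rightarrow> 'a \<Rightarrow> real \<Rightarrow> real"
  assumes F: "continuous_on UNIV (\<lambda>(s, \<omega>, x). F s \<omega> x)" and e: "e > 0"
  obtains d where "d > 0" "\<And>s \<omega> \<omega>' x x'. 0 \<le> s \<Longrightarrow> s \<le> T \<Longrightarrow> \<bar>x\<bar> \<le> R \<Longrightarrow> \<bar>x'\<bar> \<le> R \<Longrightarrow>
    dist \<omega> \<omega>' < d \<Longrightarrow> \<bar>x - x'\<bar> < d \<Longrightarrow> \<bar>F s \<omega> x - F s \<omega>' x'\<bar> < e"
proof -
  have "compact ({0..T} \<times> (UNIV :: 'a set) \<times> {- R..R})"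
    by (intro compact_Times compact_strip compact_Icc)
  then have "uniformly_continuous_on ({0..T} \<times> (UNIV :: 'a set) \<times> {- R..R}) (\<lambda>(s, \<omega>, x). F s \<omega> x)"
    by (intro compact_uniformly_continuous continuous_on_subset[OF F]) auto
  then obtain d where d: "d > 0" "\<And>p q. p \<in> {0..T} \<times> (UNIV :: 'a set) \<times> {- R..R} \<Longrightarrow> q \<in> {0..T} \<times> UNIV \<times> {- R..R} \<Longrightarrow>
     dist q p < d \<Longrightarrow> dist ((\<lambda>(s, \<omega>, x). F s \<omega> x) q) ((\<lambda>(s, \<omega>, x). F s \<omega> x) p) < e"
    using e unfolding uniformly_continuous_on_def by metis
  have "\<bar>F s \<omega> x - F s \<omega>' x'\<bar> < e"
    if *: "0 \<le> s" "s \<le> T" "\<bar>x\<bar> \<le> R" "\<bar>x'\<bar> \<le> R" "dist \<omega> \<omega>' < d / 2" "\<bar>x - x'\<bar> < d / 2" for s \<omega> \<omega>' x x'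
  proof -
    have "dist (s, \<omega>, x) (s, \<omega>', x') \<le> dist \<omega> \<omega>' + \<bar>x - x'\<bar>"
      using sqrt_sum_squares_le_sum[of "dist \<omega> \<omega>'" "\<bar>x - x'\<bar>"] by (simp add: dist_Pair_Pair dist_real_def)
    also have "\<dots> < d" using * by linarith
    finally have lt: "dist (s, \<omega>, x) (s, \<omega>', x') < d" .
    have "(s, \<omega>', x') \<in> {0..T} \<times> (UNIV :: 'a set) \<times> {- R..R}" "(s, \<omega>, x) \<in> {0..T} \<times> (UNIV :: 'a set) \<times> {- R..R}"
      using * by (auto simp: abs_le_iff)
    from d(2)[OF this lt] show ?thesis by (simp add: dist_real_def)
  qed
  then show thesis using d(1) by (intro that[of "d / 2"]) auto
qed

text \<open>
By the mean value theorem the quotient of the differences is a value of \<open>f\<^sub>x\<close> between the two points.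
\<close>

lemma one_sided_linearization:
  assumes near: "\<And>\<xi>. \<bar>\<xi> - y\<bar> \<le> \<bar>x - y\<bar> \<Longrightarrow> fx f \<omega> \<xi> \<le> c"
  shows "(x - y) * (f \<omega> x - f \<omega> y) \<le> c * (x - y)\<^sup>2"
proof (cases x y rule: linorder_cases)
  case less
  obtain \<xi> where \<xi>: "x < \<xi>" "\<xi> < y" "f \<omega> y - f \<omega> x = (y - x) * fx f \<omega> \<xi>"
    using MVT2[OF less, of "f \<omega>" "fx f \<omega>"] f_deriv by blast
  have "f \<omega> x - f \<omega> y = (x - y) * fx f \<omega> \<xi>" using \<xi>(3) by (simp add: algebra_simps)
  then have "(x - y) * (f \<omega> x - f \<omega> y) = fx f \<omega> \<xi> * (x - y)\<^sup>2" by (simp add: power2_eq_square)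
  also have "\<dots> \<le> c * (x - y)\<^sup>2" using \<xi>(1,2) by (intro mult_right_mono near) auto
  finally show ?thesis .
next
  case greater
  obtain \<xi> where \<xi>: "y < \<xi>" "\<xi> < x" "f \<omega> x - f \<omega> y = (x - y) * fx f \<omega> \<xi>"
    using MVT2[OF greater, of "f \<omega>" "fx f \<omega>"] f_deriv by blast
  then have "(x - y) * (f \<omega> x - f \<omega> y) = fx f \<omega> \<xi> * (x - y)\<^sup>2" by (simp add: power2_eq_square)
  also have "\<dots> \<le> c * (x - y)\<^sup>2" using \<xi>(1,2) by (intro mult_right_mono near) auto
  finally show ?thesis .
qed simp

text \<open>
As long as \<open>\<bar>e\<bar> \<le> \<rho>\<close>, the function \<open>e\<^sup>2 exp (- 2 \<Phi> - \<delta> t)\<close> is nonincreasing, which bounds \<open>\<bar>e\<bar>\<close> by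
\<open>exp C * \<bar>e 0\<bar> < \<rho>\<close>. At the first time at which \<open>\<bar>e\<bar>\<close> reaches \<open>\<rho>\<close> this would be a contradiction.
\<close>

lemma first_approximation:
  fixes e a \<Phi> :: "real \<Rightarrow> real"
  assumes e: "\<And>t. t \<ge> 0 \<Longrightarrow> (e has_real_derivative e' t) (at t)"
    and \<Phi>: "\<And>t. t \<ge> 0 \<Longrightarrow> (\<Phi> has_real_derivative a t) (at t)" "\<Phi> 0 = 0"
    and lin: "\<And>t. t \<ge> 0 \<Longrightarrow> \<bar>e t\<bar> \<le> \<rho> \<Longrightarrow> e t * e' t \<le> (a t + \<delta> / 2) * (e t)\<^sup>2"
    and decay: "\<And>t. t \<ge> 0 \<Longrightarrow> \<Phi> t \<le> C - \<delta> * t"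
    and small: "exp C * \<bar>e 0\<bar> < \<rho>" and pos: "\<delta> > 0" "C \<ge> 0" and t: "t \<ge> 0"
  shows "\<bar>e t\<bar> \<le> exp C * exp (- (\<delta> / 2) * t) * \<bar>e 0\<bar>"
proof -
  have ec: "continuous_on {0..t} e" for t
    by (intro continuous_at_imp_continuous_on ballI DERIV_isCont[OF e]) auto
  have \<Phi>c: "continuous_on {0..t} \<Phi>" for t
    by (intro continuous_at_imp_continuous_on ballI DERIV_isCont[OF \<Phi>(1)]) auto
  have step: "\<bar>e t\<bar> \<le> exp C * exp (- (\<delta> / 2) * t) * \<bar>e 0\<bar>"
    if t: "t \<ge> 0" and le: "\<And>s. 0 < s \<Longrightarrow> s < t \<Longrightarrow> \<bar>e s\<bar> \<le> \<rho>" for t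
  proof -
    define g where "g s = (e s)\<^sup>2 * exp (- 2 * \<Phi> s - \<delta> * s)" for s
    have "g t \<le> g 0"
    proof (rule DERIV_nonpos_imp_decreasing_open[OF t])
      fix s assume s: "0 < s" "s < t"
      have "(g has_real_derivative 2 * (e s * e' s - (a s + \<delta> / 2) * (e s)\<^sup>2) * exp (- 2 * \<Phi> s - \<delta> * s)) (at s)"
        unfolding g_def using s by (auto intro!: derivative_eq_intros e \<Phi>(1) simp: field_simps)
      moreover have "2 * (e s * e' s - (a s + \<delta> / 2) * (e s)\<^sup>2) * exp (- 2 * \<Phi> s - \<delta> * s) \<le> 0"
        using lin[of s] le[OF s] s by (intro mult_nonpos_nonneg[OF _ exp_ge_zero]) auto
      ultimately show "\<exists>y. (g has_real_derivative y) (at s) \<and> y \<le> 0" by blast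
    qed (unfold g_def, intro continuous_intros ec \<Phi>c)
    then have "(e t)\<^sup>2 * exp (- 2 * \<Phi> t - \<delta> * t) * exp (2 * \<Phi> t + \<delta> * t) \<le> (e 0)\<^sup>2 * exp (2 * \<Phi> t + \<delta> * t)"
      by (intro mult_right_mono) (auto simp: g_def \<Phi>(2))
    then have "(e t)\<^sup>2 \<le> (e 0)\<^sup>2 * exp (2 * \<Phi> t + \<delta> * t)"
      by (simp add: mult.assoc flip: exp_add)
    also have "\<dots> \<le> (e 0)\<^sup>2 * exp (2 * (C - (\<delta> / 2) * t))"
      using decay[OF t] by (intro mult_left_mono) auto
    also have "\<dots> = (exp C * exp (- (\<delta> / 2) * t) * \<bar>e 0\<bar>)\<^sup>2"
      by (simp add: power_mult_distrib exp_double[symmetric] algebra_simps flip: exp_add)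
    finally show ?thesis by (intro power2_le_imp_le[of "\<bar>e t\<bar>"]) auto
  qed
  have small_all: "\<bar>e t\<bar> \<le> \<rho>" if t: "t \<ge> 0" for t
  proof (rule ccontr)
    assume large: "\<not> \<bar>e t\<bar> \<le> \<rho>"
    define S where "S = {s \<in> {0..t}. \<rho> \<le> \<bar>e s\<bar>}"
    have "closed S" unfolding S_def
      by (intro continuous_on_closed_Collect_le continuous_intros ec closed_atLeastAtMost)
    moreover have "S \<subseteq> {0..t}" by (auto simp: S_def)
    ultimately have "compact S"
      using compact_Int_closed[OF compact_Icc[of 0 t], of S] by (simp add: Int_absorb1)
    moreover have "t \<in> S" using large t by (auto simp: S_def)
    ultimately obtain t0 where t0: "t0 \<in> S" "\<And>s. s \<in> S \<Longrightarrow> t0 \<le> s"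
      using compact_attains_inf[of S] by auto
    have "\<bar>e t0\<bar> \<le> exp C * exp (- (\<delta> / 2) * t0) * \<bar>e 0\<bar>"
    proof (rule step)
      show "t0 \<ge> 0" using t0(1) by (auto simp: S_def)
      show "\<bar>e s\<bar> \<le> \<rho>" if "0 < s" "s < t0" for s
        using t0(2)[of s] that t0(1) by (force simp: S_def)
    qed
    also have "\<dots> \<le> exp C * 1 * \<bar>e 0\<bar>"
      using t0(1) pos by (intro mult_right_mono mult_left_mono) (auto simp: S_def)
    finally show False using small t0(1) by (simp add: S_def)
  qed
  show ?thesis by (rule step[OF t]) (simp add: small_all)
qed

text \<open>
The first approximation theorem: half of the exponential rate is given up to the variation of \<open>f\<^sub>x\<close> in a uniform
neighbourhood of the set.
\<close>

theorem hyperbolic_attractive_of_decay: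
  assumes M: "compact M" "skew_invariant \<sigma> f M" and Co: "Co f"
    and \<delta>: "\<delta> > 0" and decay: "\<And>z t. z \<in> M \<Longrightarrow> t \<ge> 0 \<Longrightarrow> expo z t \<le> C - \<delta> * t"
  shows "hyperbolic_attractive \<sigma> f M"
proof -
  obtain R0 where R0: "\<And>z. z \<in> M \<Longrightarrow> \<bar>snd z\<bar> \<le> R0" using bounded_fibres[OF M] by metis
  obtain R where R: "R \<ge> R0 + 1" "R > 0" "\<And>\<omega>. f \<omega> R < 0" "\<And>\<omega>. f \<omega> (- R) > 0"
    using dissipative_bound_of_Co[OF Co, of "R0 + 1"] by metis
  have "continuous_on UNIV (\<lambda>p. fx f (fst (snd p)) (snd (snd p)))" by (intro fx_cont_compose continuous_intros)
  then have "continuous_on UNIV (\<lambda>(s :: real, \<omega>, x). fx f \<omega> x)" by (simp add: case_prod_beta')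
  then obtain d where d: "d > 0" "\<And>\<omega> x x'. \<bar>x\<bar> \<le> R \<Longrightarrow> \<bar>x'\<bar> \<le> R \<Longrightarrow> \<bar>x - x'\<bar> < d \<Longrightarrow> \<bar>fx f \<omega> x - fx f \<omega> x'\<bar> < \<delta> / 2"
    using uniformly_continuous_strip[of "\<lambda>_ \<omega> x. fx f \<omega> x" "\<delta> / 2" 0 R] \<delta>
    by (metis dist_self half_gt_zero order_refl)
  define \<rho> where "\<rho> = min (d / 2) 1"
  have \<rho>: "\<rho> > 0" "\<rho> < d" "\<rho> \<le> 1" using d(1) by (auto simp: \<rho>_def)
  define C' where "C' = max C 0"
  \<comment> \<open>So small that the factor \<open>exp C'\<close> of the decay estimate does not lead out of the \<open>\<rho>\<close>-neighbourhood.\<close>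
  define \<delta>0 where "\<delta>0 = \<rho> * exp (- C')"
  have \<delta>0: "\<delta>0 > 0" using \<rho> by (simp add: \<delta>0_def)
  have "\<delta>0 \<le> \<rho> * 1" unfolding \<delta>0_def using \<rho> by (intro mult_left_mono) (auto simp: C'_def)
  then have \<delta>01: "\<delta>0 \<le> 1" using \<rho> by simp
  have main: "t \<in> max_interval \<sigma> f \<omega> y \<and> \<bar>max_sol \<sigma> f t \<omega> y - max_sol \<sigma> f t \<omega> x\<bar> \<le> exp C' * exp (- (\<delta> / 2) * t) * \<bar>y - x\<bar>"
    if z: "(\<omega>, x) \<in> M" and y: "\<bar>y - x\<bar> < \<delta>0" and t: "t \<ge> 0" for \<omega> x y t
  proof -
    have "\<bar>x\<bar> \<le> R0" using R0[OF z] by simp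
    then have "\<bar>y\<bar> < R" using y \<delta>01 R(1) by linarith
    then obtain I v where I: "solves \<sigma> f \<omega> y I v" "{0..} \<subseteq> I"
      using forward_solution[OF R(2-4)] by metis
    then have dom: "t \<in> max_interval \<sigma> f \<omega> y" if "t \<ge> 0" for t
      using that by (intro solves_imp_max_interval) auto
    define u where "u t = max_sol \<sigma> f t \<omega> y" for t
    define w where "w t = snd (skew_flow \<sigma> f t (\<omega>, x))" for t
    have w: "w t = max_sol \<sigma> f t \<omega> x" for t by (simp add: w_def skew_flow_def)
    have "w 0 = x" using skew_flow_0[OF M z] by (simp add: w_def)
    moreover have "u 0 = y" unfolding u_def using max_sol_0 dom[OF t] by blast
    ultimately have e0: "u 0 - w 0 = y - x" by simp
    have du: "(u has_real_derivative f (\<sigma> t \<omega>) (u t)) (at t)" if "t \<ge> 0" for t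
      unfolding u_def by (rule max_sol_deriv[OF dom[OF that]])
    have dw: "(w has_real_derivative f (\<sigma> t \<omega>) (w t)) (at t)" for t
      unfolding w_def using snd_skew_flow_deriv[OF M z, of t] by simp
    have wR: "\<bar>w t\<bar> \<le> R0" for t unfolding w_def by (rule R0[OF invariant_step[OF M z]])
    have "\<bar>u t - w t\<bar> \<le> exp C' * exp (- (\<delta> / 2) * t) * \<bar>u 0 - w 0\<bar>"
    proof (rule first_approximation[where \<Phi> = "expo (\<omega>, x)" and \<rho> = \<rho> and a = "\<lambda>t. fx f (\<sigma> t \<omega>) (w t)"
        and e' = "\<lambda>t. f (\<sigma> t \<omega>) (u t) - f (\<sigma> t \<omega>) (w t)"])
      fix t :: real assume t: "t \<ge> 0"
      show "((\<lambda>t. u t - w t) has_real_derivative f (\<sigma> t \<omega>) (u t) - f (\<sigma> t \<omega>) (w t)) (at t)"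
        by (intro DERIV_diff du dw t)
      show "(expo (\<omega>, x) has_real_derivative fx f (\<sigma> t \<omega>) (w t)) (at t)"
        using expo_deriv[OF M z, of t] by (simp add: rate_def w_def skew_flow_def)
      show "expo (\<omega>, x) t \<le> C' - \<delta> * t" using decay[OF z t] by (simp add: C'_def)
      assume small: "\<bar>u t - w t\<bar> \<le> \<rho>"
      show "(u t - w t) * (f (\<sigma> t \<omega>) (u t) - f (\<sigma> t \<omega>) (w t)) \<le> (fx f (\<sigma> t \<omega>) (w t) + \<delta> / 2) * (u t - w t)\<^sup>2"
      proof (rule one_sided_linearization)
        fix \<xi> assume "\<bar>\<xi> - w t\<bar> \<le> \<bar>u t - w t\<bar>"
        then have "\<bar>\<xi> - w t\<bar> \<le> \<rho>" using small by linarith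
        then have "\<bar>fx f (\<sigma> t \<omega>) \<xi> - fx f (\<sigma> t \<omega>) (w t)\<bar> < \<delta> / 2"
          using wR[of t] R(1) \<rho> by (intro d(2)) auto
        then show "fx f (\<sigma> t \<omega>) \<xi> \<le> fx f (\<sigma> t \<omega>) (w t) + \<delta> / 2" by linarith
      qed
    next
      show "exp C' * \<bar>u 0 - w 0\<bar> < \<rho>"
        using y unfolding e0 by (simp add: \<delta>0_def exp_minus field_simps)
    qed (use \<delta> t in \<open>auto simp: C'_def\<close>)
    then show ?thesis using dom[OF t] unfolding e0 by (simp add: u_def w)
  qed
  have "exp C' \<ge> 1" by (simp add: C'_def)
  then show ?thesis
    unfolding hyperbolic_attractive_def using \<delta>0 \<delta> main
    by (intro exI[of _ \<delta>0] exI[of _ "exp C'"] exI[of _ "\<delta> / 2"] conjI) auto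
qed

text \<open>
On a bounded time interval, solutions over nearby base points with nearby initial values stay close by Gronwall's inequality, so
the integrands are uniformly close.
\<close>

theorem expo_continuous:
  assumes M: "compact M" "skew_invariant \<sigma> f M" and T: "T \<ge> 0"
  shows "continuous_on M (\<lambda>z. expo z T)"
  unfolding continuous_on_iff
proof (intro ballI allI impI)
  fix z e assume z: "z \<in> M" and e: "(e :: real) > 0"
  obtain R where R: "\<And>z. z \<in> M \<Longrightarrow> \<bar>snd z\<bar> \<le> R" using bounded_fibres[OF M] by metis
  obtain L where L: "L \<ge> 0" "\<And>\<omega> x y. \<bar>x\<bar> \<le> R \<Longrightarrow> \<bar>y\<bar> \<le> R \<Longrightarrow> \<bar>f \<omega> x - f \<omega> y\<bar> \<le> L * \<bar>x - y\<bar>"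
    using f_lipschitz[of R] by metis
  define r where "r = e / (2 * (T + 1))"
  have "e * T < e * (2 * (T + 1))" using e T by (intro mult_strict_left_mono) auto
  then have r: "r > 0" "r * T < e" using e T by (auto simp: r_def divide_less_eq)
  have "continuous_on UNIV (\<lambda>p. fx f (\<sigma> (fst p) (fst (snd p))) (snd (snd p)))"
    by (intro fx_cont_compose flow_cont_joint[OF flow] continuous_intros)
  then have "continuous_on UNIV (\<lambda>(s, \<omega>, x). fx f (\<sigma> s \<omega>) x)" by (simp add: case_prod_beta')
  from uniformly_continuous_strip[OF this r(1)]
  obtain d2 where d2: "d2 > 0" "\<And>s \<omega> \<omega>' x x'. 0 \<le> s \<Longrightarrow> s \<le> T \<Longrightarrow> \<bar>x\<bar> \<le> R \<Longrightarrow> \<bar>x'\<bar> \<le> R \<Longrightarrow>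
    dist \<omega> \<omega>' < d2 \<Longrightarrow> \<bar>x - x'\<bar> < d2 \<Longrightarrow> \<bar>fx f (\<sigma> s \<omega>) x - fx f (\<sigma> s \<omega>') x'\<bar> < r" by metis
  define E where "E = exp ((2 * L + 1) * T)"
  have E: "E \<ge> 1" unfolding E_def using L T by simp
  \<comment> \<open>Gronwall's bound for the squared distance is then \<open>2 \<eta>\<^sup>2 E = d2\<^sup>2 / (2 E) < d2\<^sup>2\<close>.\<close>
  define \<eta> where "\<eta> = d2 / (2 * E)"
  have \<eta>: "\<eta> > 0" using d2 E by (simp add: \<eta>_def)
  have "continuous_on UNIV (\<lambda>p. f (\<sigma> (fst p) (fst (snd p))) (snd (snd p)))"
    by (intro f_cont_compose flow_cont_joint[OF flow] continuous_intros)
  then have "continuous_on UNIV (\<lambda>(s, \<omega>, x). f (\<sigma> s \<omega>) x)" by (simp add: case_prod_beta')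
  from uniformly_continuous_strip[OF this \<eta>]
  obtain d1 where d1: "d1 > 0" "\<And>s \<omega> \<omega>' x x'. 0 \<le> s \<Longrightarrow> s \<le> T \<Longrightarrow> \<bar>x\<bar> \<le> R \<Longrightarrow> \<bar>x'\<bar> \<le> R \<Longrightarrow>
    dist \<omega> \<omega>' < d1 \<Longrightarrow> \<bar>x - x'\<bar> < d1 \<Longrightarrow> \<bar>f (\<sigma> s \<omega>) x - f (\<sigma> s \<omega>') x'\<bar> < \<eta>" by metis
  define d where "d = min d1 (min d2 \<eta>)"
  have d: "d > 0" "d \<le> d1" "d \<le> d2" "d \<le> \<eta>" using d1 d2 \<eta> by (auto simp: d_def)
  show "\<exists>d>0. \<forall>x'\<in>M. dist x' z < d \<longrightarrow> dist (expo x' T) (expo z T) < e"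
  proof (intro exI[of _ d] conjI ballI impI d(1))
    fix z' assume z': "z' \<in> M" and dist: "dist z' z < d"
    have dfst: "dist (fst z') (fst z) < d" and dsnd: "\<bar>snd z' - snd z\<bar> < d"
      using dist dist_fst_le[of z' z] dist_snd_le[of z' z] by (auto simp: dist_real_def)
    define u where "u s = snd (skew_flow \<sigma> f s z')" for s
    define w where "w s = snd (skew_flow \<sigma> f s z)" for s
    have uR: "\<bar>u s\<bar> \<le> R" and wR: "\<bar>w s\<bar> \<le> R" for s
      unfolding u_def w_def by (intro R invariant_step[OF M] z z')+
    have near: "\<bar>u s - w s\<bar> < d2" if s: "0 \<le> s" "s \<le> T" for s
    proof -
      have "(u s - w s)\<^sup>2 \<le> ((u 0 - w 0)\<^sup>2 + \<eta>\<^sup>2) * exp ((2 * L + 1) * s)"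
      proof (rule gronwall_perturbed[where e = "\<lambda>s. u s - w s" and
            e' = "\<lambda>s. f (\<sigma> s (fst z')) (u s) - f (\<sigma> s (fst z)) (w s)"])
        fix q assume q: "0 \<le> q" "q \<le> s"
        show "((\<lambda>s. u s - w s) has_real_derivative f (\<sigma> q (fst z')) (u q) - f (\<sigma> q (fst z)) (w q)) (at q)"
          unfolding u_def w_def by (intro DERIV_diff snd_skew_flow_deriv[OF M] z z')
        have "\<bar>f (\<sigma> q (fst z')) (u q) - f (\<sigma> q (fst z')) (w q)\<bar> \<le> L * \<bar>u q - w q\<bar>"
          by (intro L(2) uR wR)
        moreover have "\<bar>f (\<sigma> q (fst z')) (w q) - f (\<sigma> q (fst z)) (w q)\<bar> < \<eta>"
          using q s dfst d d1(1) by (intro d1(2) wR) auto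
        ultimately show "\<bar>f (\<sigma> q (fst z')) (u q) - f (\<sigma> q (fst z)) (w q)\<bar> \<le> L * \<bar>u q - w q\<bar> + \<eta>"
          by linarith
      qed (use s L in auto)
      also have "\<dots> \<le> (\<eta>\<^sup>2 + \<eta>\<^sup>2) * E"
      proof (intro mult_mono add_mono)
        have "u 0 - w 0 = snd z' - snd z" using skew_flow_0[OF M] z z' by (simp add: u_def w_def)
        then have "\<bar>u 0 - w 0\<bar> \<le> \<bar>\<eta>\<bar>" using dsnd d \<eta> by linarith
        then show "(u 0 - w 0)\<^sup>2 \<le> \<eta>\<^sup>2" by (simp add: abs_le_square_iff)
        show "exp ((2 * L + 1) * s) \<le> E" unfolding E_def using s L by (auto intro: mult_left_mono)
      qed auto
      also have "\<dots> = d2\<^sup>2 / (2 * E)" using E by (simp add: \<eta>_def power2_eq_square field_simps)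
      also have "\<dots> < d2\<^sup>2" using E d2(1) by (simp add: divide_less_eq)
      finally have "\<bar>u s - w s\<bar>\<^sup>2 < d2\<^sup>2" by simp
      then show ?thesis by (rule power2_less_imp_less) (use d2(1) in simp)
    qed
    have "norm ((expo z' T - expo z T) - (expo z' 0 - expo z 0)) \<le> r * norm (T - 0)"
    proof (rule field_differentiable_bound[of "{0..T}" "\<lambda>s. expo z' s - expo z s"
          "\<lambda>s. rate (skew_flow \<sigma> f s z') - rate (skew_flow \<sigma> f s z)"])
      fix s assume s: "s \<in> {0..T}"
      show "((\<lambda>s. expo z' s - expo z s) has_field_derivative
          rate (skew_flow \<sigma> f s z') - rate (skew_flow \<sigma> f s z)) (at s within {0..T})"
        by (rule has_field_derivative_at_within[OF DERIV_diff[OF expo_deriv[OF M z'] expo_deriv[OF M z]]])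
      have "\<bar>fx f (\<sigma> s (fst z')) (u s) - fx f (\<sigma> s (fst z)) (w s)\<bar> < r"
        using s dfst d by (intro d2(2) uR wR near) auto
      then show "norm (rate (skew_flow \<sigma> f s z') - rate (skew_flow \<sigma> f s z)) \<le> r"
        by (simp add: rate_def u_def w_def skew_flow_def split: prod.splits)
    qed (use T in auto)
    then have "\<bar>expo z' T - expo z T\<bar> \<le> r * T" using T by (simp add: expo_def)
    then show "dist (expo z' T) (expo z T) < e" using r(2) by (simp add: dist_real_def)
  qed
qed

end

section \<open>Concavity and the sum of exponents on two minimal sets\<close>

text \<open>
A concave function is above its chord, so the integral is at least that of the chord. Equality would force \<open>g\<close> to coincide with the
chord on the open interval, and an affine function has vanishing second differences.
\<close>

lemma concave_trapezoid:
  fixes F g :: "real \<Rightarrow> real"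
  assumes conc: "concave_on UNIV g" and der: "\<And>t. (F has_real_derivative g t) (at t)" and xy: "x < y"
  shows "(g x + g y) / 2 * (y - x) \<le> F y - F x"
    and "x < p - h \<Longrightarrow> p + h < y \<Longrightarrow> h > 0 \<Longrightarrow> 0 < 2 * g p - g (p - h) - g (p + h) \<Longrightarrow>
      (g x + g y) / 2 * (y - x) < F y - F x"
proof -
  define m where "m = (g y - g x) / (y - x)"
  define c where "c t = m * (t - x) + g x" for t
  define H where "H t = F t - F x - (m * (t - x)\<^sup>2 / 2 + g x * (t - x))" for t
  have chord: "c t \<le> g t" if "t \<in> {x..y}" for t
  proof -
    have "concave_on {x..y} g"
      using conc unfolding concave_on_def by (rule convex_on_subset) auto
    from concave_onD_Icc'[OF this that] show ?thesis by (simp add: c_def m_def)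
  qed
  have dH: "(H has_real_derivative g t - c t) (at t)" for t
    unfolding H_def c_def by (auto intro!: derivative_eq_intros der simp: field_simps)
  have mono: "H a \<le> H b" if "x \<le> a" "a \<le> b" "b \<le> y" for a b
    by (rule DERIV_nonneg_imp_nondecreasing[OF that(2)]) (use dH chord that in force)
  have Hx: "H x = 0" by (simp add: H_def)
  have "m * (y - x)\<^sup>2 = (g y - g x) * (y - x)" using xy by (simp add: m_def power2_eq_square)
  then have Hy: "H y = F y - F x - (g x + g y) / 2 * (y - x)" by (simp add: H_def field_simps)
  show "(g x + g y) / 2 * (y - x) \<le> F y - F x" using mono[of x y] xy Hx Hy by simp
  assume p: "x < p - h" "p + h < y" "h > 0" and strict: "0 < 2 * g p - g (p - h) - g (p + h)"
  have "H y \<noteq> 0"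
  proof
    assume Hy0: "H y = 0"
    have "g t = c t" if t: "x < t" "t < y" for t
    proof -
      have "H s = 0" if "s \<in> {x<..<y}" for s
        using mono[of x s] mono[of s y] that Hx Hy0 by simp
      then have "(H has_real_derivative 0) (at t)"
        using t by (intro has_field_derivative_transform_within_open[of "\<lambda>_. 0" 0 t "{x<..<y}" H]) auto
      from DERIV_unique[OF dH this] show ?thesis by simp
    qed
    then have "2 * g p - g (p - h) - g (p + h) = 2 * c p - c (p - h) - c (p + h)" using p by simp
    also have "\<dots> = 0" by (simp add: c_def algebra_simps)
    finally show False using strict by simp
  qed
  then show "(g x + g y) / 2 * (y - x) < F y - F x" using mono[of x y] xy Hx Hy by simp
qed

lemma b_fun_pos_imp:
  assumes conc: "concave_on UNIV (fx f \<omega>)" and b: "b_fun f c d \<epsilon> \<omega> > 0" and "\<epsilon> > 0"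
    and x: "{x - \<epsilon> / 2..x + \<epsilon> / 2} \<subseteq> {c..d}"
  shows "0 < 2 * fx f \<omega> x - fx f \<omega> (x - \<epsilon> / 2) - fx f \<omega> (x + \<epsilon> / 2)"
proof -
  define S where "S = {x. {x - \<epsilon> / 2..x + \<epsilon> / 2} \<subseteq> {c..d}}"
  define q where "q x = 2 * fx f \<omega> x - fx f \<omega> (x - \<epsilon> / 2) - fx f \<omega> (x + \<epsilon> / 2)" for x
  have "q x \<ge> 0" for x
    using concave_onD[OF conc, of "1/2" "x - \<epsilon> / 2" "x + \<epsilon> / 2"] by (simp add: q_def field_simps)
  then have bdd: "bdd_below (q ` S)" by (intro bdd_belowI2[of _ 0])
  have b': "\<epsilon> / (4 * (d - c)\<^sup>2) * (INF x\<in>S. q x) > 0" using b unfolding b_fun_def S_def q_def .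
  then have "\<epsilon> / (4 * (d - c)\<^sup>2) \<noteq> 0" by (metis mult_zero_left less_irrefl)
  moreover have "\<epsilon> / (4 * (d - c)\<^sup>2) \<ge> 0" using \<open>\<epsilon> > 0\<close> by simp
  ultimately have "(INF x\<in>S. q x) > 0" using zero_less_mult_pos[OF b'] by linarith
  also have "(INF x\<in>S. q x) \<le> q x" using x by (intro cINF_lower bdd) (simp add: S_def)
  finally show ?thesis by (simp add: q_def)
qed

lemma compact_disjoint_separated:
  fixes S T :: "'b::metric_space set"
  assumes "compact S" "compact T" "S \<inter> T = {}"
  obtains d where "d > 0" "\<And>x y. x \<in> S \<Longrightarrow> y \<in> T \<Longrightarrow> d \<le> dist x y"
proof (cases "S \<times> T = {}")
  case False
  have "continuous_on (S \<times> T) (\<lambda>p. dist (fst p) (snd p))" by (intro continuous_intros)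
  from continuous_attains_inf[OF compact_Times[OF assms(1,2)] False this]
  obtain p where p: "p \<in> S \<times> T" "\<And>q. q \<in> S \<times> T \<Longrightarrow> dist (fst p) (snd p) \<le> dist (fst q) (snd q)"
    by blast
  have "fst p \<noteq> snd p" using p(1) assms(3) by auto
  then show thesis using p(2) by (intro that[of "dist (fst p) (snd p)"]) force+
qed (use that[of 1] in auto)

text \<open>
Finitely many preimages of a small ball cover the base by compactness, so every orbit visits the ball within a bounded time.
Shifting by the largest of the times involved makes all visits happen at nonnegative times, and continuity of the flow at
\<open>(0, \<omega>0)\<close> keeps the orbit near \<open>\<omega>0\<close> for the time \<open>h\<close>.
\<close>

lemma minimal_flow_recurrence:
  fixes \<sigma> :: "real \<Rightarrow> 'a::metric_space \<Rightarrow> 'a"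
  assumes cpt: "compact (UNIV :: 'a set)" and flow: "continuous_flow \<sigma>" and min: "minimal_flow \<sigma>" and r: "r > 0"
  obtains T h where "T > 0" "h > 0"
    "\<And>\<omega>. \<exists>t\<ge>0. t + h \<le> T \<and> (\<forall>s. t \<le> s \<and> s \<le> t + h \<longrightarrow> dist (\<sigma> s \<omega>) \<omega>0 < r)"
proof -
  have "continuous_on UNIV (\<lambda>p. \<sigma> (fst p) (snd p))" by (intro flow_cont_joint[OF flow] continuous_intros)
  then have "isCont (\<lambda>p. \<sigma> (fst p) (snd p)) (0, \<omega>0)" by (simp add: continuous_on_eq_continuous_at)
  then obtain d where d: "d > 0" "\<And>p. dist p (0, \<omega>0) < d \<Longrightarrow> dist (\<sigma> (fst p) (snd p)) \<omega>0 < r"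
    unfolding continuous_at_eps_delta using r by (metis flow_zero[OF flow] fst_conv snd_conv)
  have near: "dist (\<sigma> s \<omega>) \<omega>0 < r" if "0 \<le> s" "s \<le> d / 4" "dist \<omega> \<omega>0 < d / 2" for s \<omega>
  proof -
    have "dist (s, \<omega>) (0, \<omega>0) \<le> \<bar>s\<bar> + dist \<omega> \<omega>0"
      using sqrt_sum_squares_le_sum[of "\<bar>s\<bar>" "dist \<omega> \<omega>0"] by (simp add: dist_Pair_Pair dist_real_def)
    also have "\<dots> < d" using that d(1) by linarith
    finally show ?thesis using d(2)[of "(s, \<omega>)"] by simp
  qed
  define V where "V t = \<sigma> t -` ball \<omega>0 (d / 2)" for t
  have "open (V t)" for t
    unfolding V_def using open_vimage[OF open_ball flow_cont[OF flow]] by simp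
  moreover have "UNIV \<subseteq> (\<Union>t\<in>UNIV. V t)"
  proof
    fix \<omega>
    have "\<omega>0 \<in> closure (range (\<lambda>t. \<sigma> t \<omega>))" using min by (simp add: minimal_flow_def)
    then have "\<exists>y\<in>range (\<lambda>t. \<sigma> t \<omega>). dist y \<omega>0 < d / 2"
      using half_gt_zero[OF d(1)] unfolding closure_approachable by blast
    then obtain t where "dist (\<sigma> t \<omega>) \<omega>0 < d / 2" by blast
    then show "\<omega> \<in> (\<Union>t\<in>UNIV. V t)" by (auto simp: V_def dist_commute)
  qed
  ultimately obtain D where D: "finite D" "UNIV \<subseteq> (\<Union>t\<in>D. V t)"
    using compactE_image[OF cpt, of UNIV V] by metis
  define S where "S = (\<Sum>t\<in>D. \<bar>t\<bar>)"
  have S: "\<bar>t\<bar> \<le> S" if "t \<in> D" for t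
    unfolding S_def using D(1) that by (intro member_le_sum) auto
  have S0: "S \<ge> 0" by (simp add: S_def sum_nonneg)
  show thesis
  proof (rule that[of "2 * S + d / 4" "d / 4"])
    fix \<omega>
    obtain u where u: "u \<in> D" "\<sigma> S \<omega> \<in> V u" using D(2) by blast
    have "dist (\<sigma> s \<omega>) \<omega>0 < r" if s: "u + S \<le> s" "s \<le> u + S + d / 4" for s
    proof -
      have "\<sigma> s \<omega> = \<sigma> (s - (u + S)) (\<sigma> u (\<sigma> S \<omega>))"
        by (simp flip: flow_add[OF flow])
      moreover have "dist (\<sigma> (s - (u + S)) (\<sigma> u (\<sigma> S \<omega>))) \<omega>0 < r"
        using s u(2) by (intro near) (auto simp: V_def dist_commute)
      ultimately show ?thesis by simp
    qed
    then show "\<exists>t\<ge>0. t + d / 4 \<le> 2 * S + d / 4 \<and> (\<forall>s. t \<le> s \<and> s \<le> t + d / 4 \<longrightarrow> dist (\<sigma> s \<omega>) \<omega>0 < r)"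
      using S[OF u(1)] by (intro exI[of _ "u + S"]) (auto simp: abs_le_iff)
  qed (use S0 d(1) in auto)
qed

context C1_skew_ode
begin

text \<open>
The mean of \<open>f\<^sub>x(\<omega>,\<cdot>)\<close> on the segment from \<open>x\<close> to \<open>y\<close> minus its trapezoidal approximation.
\<close>

definition defect :: "'a \<Rightarrow> real \<Rightarrow> real \<Rightarrow> real" where
  "defect \<omega> x y = (f \<omega> y - f \<omega> x) / (y - x) - (fx f \<omega> x + fx f \<omega> y) / 2"

lemma defect_commute: "defect \<omega> x y = defect \<omega> y x"
proof -
  have "(f \<omega> y - f \<omega> x) / (y - x) = (f \<omega> x - f \<omega> y) / (x - y)"
    by (metis minus_diff_eq minus_divide_divide)
  then show ?thesis by (simp add: defect_def)
qed

lemma defect_nonneg: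
  assumes "concave_on UNIV (fx f \<omega>)" and "x \<noteq> y"
  shows "defect \<omega> x y \<ge> 0"
proof -
  have "defect \<omega> x y \<ge> 0" if "x < y" for x y
    using concave_trapezoid(1)[OF assms(1) f_deriv that] that by (simp add: defect_def field_simps)
  then show ?thesis using assms(2) defect_commute by (metis linorder_neqE)
qed

text \<open>
A window of length \<open>\<epsilon>\<close> around the midpoint fits strictly between \<open>x\<close> and \<open>y\<close>, and the second difference of \<open>f\<^sub>x\<close>
over this window is positive.
\<close>

lemma defect_pos:
  assumes conc: "concave_on UNIV (fx f \<omega>)" and b: "b_fun f (- R) R \<epsilon> \<omega> > 0" and \<epsilon>: "\<epsilon> > 0"
    and xy: "\<bar>x\<bar> \<le> R" "\<bar>y\<bar> \<le> R" "\<bar>x - y\<bar> > \<epsilon>"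
  shows "defect \<omega> x y > 0"
proof -
  have *: "defect \<omega> x y > 0" if "\<bar>x\<bar> \<le> R" "\<bar>y\<bar> \<le> R" "y - x > \<epsilon>" for x y
  proof -
    define p where "p = (x + y) / 2"
    have lt: "x < y" using that \<epsilon> by simp
    have p: "x < p - \<epsilon> / 2" "p + \<epsilon> / 2 < y" using that by (auto simp: p_def field_simps)
    have "{p - \<epsilon> / 2..p + \<epsilon> / 2} \<subseteq> {- R..R}" using p that by auto
    from b_fun_pos_imp[OF conc b \<epsilon> this]
    have "(fx f \<omega> x + fx f \<omega> y) / 2 * (y - x) < f \<omega> y - f \<omega> x"
      using concave_trapezoid(2)[OF conc f_deriv lt p] \<epsilon> by simp
    then show ?thesis using lt by (simp add: defect_def field_simps)
  qed
  show ?thesis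
  proof (cases "y - x > \<epsilon>")
    case False
    then have "x - y > \<epsilon>" using xy(3) by linarith
    from *[OF xy(2,1) this] show ?thesis by (simp add: defect_commute)
  qed (rule *[OF xy(1,2)])
qed

text \<open>
At \<open>\<omega>0\<close> the defect has a positive minimum on the compact set of pairs at distance at least \<open>d0\<close>; half of it survives nearby by
uniform continuity.
\<close>

lemma defect_locally_bounded_below:
  assumes conc: "\<And>\<omega>. concave_on UNIV (fx f \<omega>)" and b: "b_fun f (- R) R \<epsilon> \<omega>0 > 0" and \<epsilon>: "\<epsilon> > 0"
    and d0: "d0 > \<epsilon>"
  obtains r \<kappa> where "r > 0" "\<kappa> > 0" "\<And>\<omega> x y. dist \<omega> \<omega>0 < r \<Longrightarrow> \<bar>x\<bar> \<le> R \<Longrightarrow> \<bar>y\<bar> \<le> R \<Longrightarrow> \<bar>x - y\<bar> \<ge> d0 \<Longrightarrow>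
    defect \<omega> x y \<ge> \<kappa>"
proof -
  define K where "K = ({- R..R} \<times> {- R..R}) \<inter> {p. d0 \<le> \<bar>fst p - snd p\<bar>}"
  have "closed {p :: real \<times> real. d0 \<le> \<bar>fst p - snd p\<bar>}" by (intro closed_Collect_le continuous_intros)
  then have K: "compact K" unfolding K_def by (intro compact_Int_closed compact_Times compact_Icc)
  have ne: "snd p - fst p \<noteq> 0" if "p \<in> K" for p using that d0 \<epsilon> by (auto simp: K_def)
  define D where "D q = defect (fst q) (fst (snd q)) (snd (snd q))" for q
  have Dc: "continuous_on (UNIV \<times> K) D"
    unfolding D_def defect_def
    by (intro continuous_intros f_cont_compose fx_cont_compose) (use ne in auto)
  have pos: "D (\<omega>0, p) > 0" if "p \<in> K" for p
    unfolding D_def using that d0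
    by (auto simp: K_def abs_le_iff intro!: defect_pos[OF conc b \<epsilon>])
  obtain \<kappa> where \<kappa>: "\<kappa> > 0" "\<And>p. p \<in> K \<Longrightarrow> \<kappa> \<le> D (\<omega>0, p)"
  proof (cases "K = {}")
    case False
    have "continuous_on K (\<lambda>p. D (\<omega>0, p))"
      by (rule continuous_on_compose2[OF Dc]) (auto intro!: continuous_intros)
    from continuous_attains_inf[OF K False this] show thesis using pos that by metis
  qed (use that[of 1] in auto)
  have "uniformly_continuous_on (UNIV \<times> K) D"
    by (intro compact_uniformly_continuous Dc compact_Times cpt K)
  then obtain r where r: "r > 0" "\<And>p q. p \<in> UNIV \<times> K \<Longrightarrow> q \<in> UNIV \<times> K \<Longrightarrow> dist q p < r \<Longrightarrow> dist (D q) (D p) < \<kappa> / 2"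
    unfolding uniformly_continuous_on_def using \<kappa>(1) by (metis half_gt_zero)
  show thesis
  proof (rule that[of r "\<kappa> / 2"])
    fix \<omega> x y assume *: "dist \<omega> \<omega>0 < r" "\<bar>x\<bar> \<le> R" "\<bar>y\<bar> \<le> R" "\<bar>x - y\<bar> \<ge> d0"
    then have xy: "(x, y) \<in> K" by (auto simp: K_def abs_le_iff)
    have "dist (D (\<omega>, x, y)) (D (\<omega>0, x, y)) < \<kappa> / 2"
      using xy *(1) by (intro r(2)) (auto simp: dist_Pair_Pair)
    then have "\<bar>defect \<omega> x y - defect \<omega>0 x y\<bar> < \<kappa> / 2" by (simp add: dist_real_def D_def)
    moreover have "\<kappa> \<le> defect \<omega>0 x y" using \<kappa>(2)[OF xy] by (simp add: D_def)
    ultimately show "\<kappa> / 2 \<le> defect \<omega> x y" by linarith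
  qed (use r \<kappa> in auto)
qed

lemma half_log_square_deriv:
  fixes e :: "real \<Rightarrow> real"
  assumes "(e has_real_derivative e') (at t)" "e t \<noteq> 0"
  shows "((\<lambda>t. ln ((e t)\<^sup>2) / 2) has_real_derivative e' / e t) (at t)"
proof -
  have "0 < e t * e t" using assms(2) by (metis not_real_square_gt_zero)
  then show ?thesis
    using assms by (auto intro!: derivative_eq_intros simp: power2_eq_square)
qed

text \<open>
\<open>Q\<close> is \<open>ln \<bar>x - y\<bar>\<close> minus half of the sum of the two integrals of \<open>f\<^sub>x\<close>. Its derivative is the defect, so it is
nondecreasing, and it gains at least \<open>\<kappa> * h\<close> in every time interval of length \<open>T\<close>, namely during a visit of
the base orbit near \<open>\<omega>0\<close>. As the logarithm is bounded, the sum of the integrals has to make up for the gain.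
\<close>

theorem exponent_sum_estimate:
  assumes M1: "compact M1" "skew_invariant \<sigma> f M1" and M2: "compact M2" "skew_invariant \<sigma> f M2"
    and disj: "M1 \<inter> M2 = {}" and min: "minimal_flow \<sigma>" and SDC: "SDC \<sigma> f"
  obtains T C \<eta> where "T > 0" "\<eta> > 0"
    "\<And>z1 z2 m. z1 \<in> M1 \<Longrightarrow> z2 \<in> M2 \<Longrightarrow> fst z1 = fst z2 \<Longrightarrow> expo z1 (real m * T) + expo z2 (real m * T) \<le> C - real m * \<eta>"
proof -
  obtain R1 where R1: "\<And>z. z \<in> M1 \<Longrightarrow> \<bar>snd z\<bar> \<le> R1" using bounded_fibres[OF M1] by metis
  obtain R2 where R2: "\<And>z. z \<in> M2 \<Longrightarrow> \<bar>snd z\<bar> \<le> R2" using bounded_fibres[OF M2] by metis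
  define R where "R = max 1 (max R1 R2)"
  have R: "R > 0" "\<And>z. z \<in> M1 \<Longrightarrow> \<bar>snd z\<bar> \<le> R" "\<And>z. z \<in> M2 \<Longrightarrow> \<bar>snd z\<bar> \<le> R"
    using R1 R2 by (auto simp: R_def le_max_iff_disj)
  have conc: "concave_on UNIV (fx f \<omega>)" for \<omega> using SDC by (simp add: SDC_def DC_def)
  obtain d0 where d0: "d0 > 0" "\<And>z1 z2. z1 \<in> M1 \<Longrightarrow> z2 \<in> M2 \<Longrightarrow> d0 \<le> dist z1 z2"
    using compact_disjoint_separated[OF M1(1) M2(1) disj] by metis
  \<comment> \<open>Smaller than the distance of the sets, and at most half the length of the interval \<open>[- R, R]\<close> as (SDC) demands.\<close>
  define \<epsilon> where "\<epsilon> = min (d0 / 2) R"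
  have \<epsilon>: "\<epsilon> > 0" "\<epsilon> < d0" "\<epsilon> \<le> (R - (- R)) / 2" using d0 R by (auto simp: \<epsilon>_def)
  obtain \<mu> where "ergodic_measure \<sigma> \<mu>" using ergodic_measure_exists[OF cpt flow] by blast
  then have "measure \<mu> {\<omega>. b_fun f (- R) R \<epsilon> \<omega> > 0} > 0"
    using SDC \<epsilon> R(1) unfolding SDC_def by simp
  then have "{\<omega>. b_fun f (- R) R \<epsilon> \<omega> > 0} \<noteq> {}" by (metis measure_empty less_irrefl)
  then obtain \<omega>0 where \<omega>0: "b_fun f (- R) R \<epsilon> \<omega>0 > 0" by blast
  obtain r \<kappa> where r: "r > 0" "\<kappa> > 0" "\<And>\<omega> x y. dist \<omega> \<omega>0 < r \<Longrightarrow> \<bar>x\<bar> \<le> R \<Longrightarrow> \<bar>y\<bar> \<le> R \<Longrightarrow> \<bar>x - y\<bar> \<ge> d0 \<Longrightarrow>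
    defect \<omega> x y \<ge> \<kappa>"
    using defect_locally_bounded_below[OF conc \<omega>0 \<epsilon>(1,2)] by metis
  obtain T h where T: "T > 0" "h > 0"
    "\<And>\<omega>. \<exists>t\<ge>0. t + h \<le> T \<and> (\<forall>s. t \<le> s \<and> s \<le> t + h \<longrightarrow> dist (\<sigma> s \<omega>) \<omega>0 < r)"
    using minimal_flow_recurrence[OF cpt flow min r(1), of \<omega>0] by metis
  define C where "C = ln ((2 * R)\<^sup>2) - ln (d0\<^sup>2)"
  have "expo z1 (real m * T) + expo z2 (real m * T) \<le> C - real m * (2 * \<kappa> * h)"
    if z: "z1 \<in> M1" "z2 \<in> M2" "fst z1 = fst z2" for z1 z2 m
  proof -
    define w where "w = fst z1"
    define x where "x t = snd (skew_flow \<sigma> f t z1)" for t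
    define y where "y t = snd (skew_flow \<sigma> f t z2)" for t
    have xR: "\<bar>x t\<bar> \<le> R" and yR: "\<bar>y t\<bar> \<le> R" for t
      unfolding x_def y_def using R(2)[OF invariant_step[OF M1 z(1)]] R(3)[OF invariant_step[OF M2 z(2)]] by auto
    have sep: "d0 \<le> \<bar>x t - y t\<bar>" for t
      using d0(2)[OF invariant_step[OF M1 z(1), of t] invariant_step[OF M2 z(2), of t]] z(3)
      by (simp add: dist_prod_def dist_real_def x_def y_def)
    have ne: "x t - y t \<noteq> 0" for t using sep[of t] d0(1) by auto
    \<comment> \<open>This is \<open>ln \<bar>x t - y t\<bar>\<close>, written with a square, which is differentiable whichever orbit is above.\<close>
    define P where "P t = ln ((x t - y t)\<^sup>2) / 2" for t
    define Q where "Q t = P t - (expo z1 t + expo z2 t) / 2" for t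
    have dx: "(x has_real_derivative f (\<sigma> t w) (x t)) (at t)" for t
      unfolding x_def w_def by (rule snd_skew_flow_deriv[OF M1 z(1)])
    have dy: "(y has_real_derivative f (\<sigma> t w) (y t)) (at t)" for t
      unfolding y_def w_def using snd_skew_flow_deriv[OF M2 z(2), of t] z(3) by simp
    have e1: "(expo z1 has_real_derivative fx f (\<sigma> t w) (x t)) (at t)" for t
      using expo_deriv[OF M1 z(1), of t] by (simp add: rate_def x_def w_def)
    have e2: "(expo z2 has_real_derivative fx f (\<sigma> t w) (y t)) (at t)" for t
      using expo_deriv[OF M2 z(2), of t] by (simp add: rate_def y_def w_def z(3))
    have dQ: "(Q has_real_derivative defect (\<sigma> t w) (x t) (y t)) (at t)" for t
    proof -
      have "(P has_real_derivative (f (\<sigma> t w) (x t) - f (\<sigma> t w) (y t)) / (x t - y t)) (at t)"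
        unfolding P_def by (rule half_log_square_deriv[OF DERIV_diff[OF dx dy] ne])
      then have "(Q has_real_derivative defect (\<sigma> t w) (y t) (x t)) (at t)"
        unfolding Q_def defect_def by (auto intro!: derivative_eq_intros e1 e2 simp: add.commute)
      then show ?thesis by (simp add: defect_commute)
    qed
    have dnn: "0 \<le> defect (\<sigma> t w) (x t) (y t)" for t
      using ne[of t] by (intro defect_nonneg[OF conc]) auto
    have mono: "Q a \<le> Q b" if "a \<le> b" for a b
      by (rule DERIV_nonneg_imp_nondecreasing[OF that]) (use dQ dnn in blast)
    have gain: "Q a + \<kappa> * h \<le> Q (a + T)" for a
    proof -
      obtain t where t: "t \<ge> 0" "t + h \<le> T" "\<And>s. t \<le> s \<Longrightarrow> s \<le> t + h \<Longrightarrow> dist (\<sigma> s (\<sigma> a w)) \<omega>0 < r"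
        using T(3)[of "\<sigma> a w"] by blast
      have "Q (a + t) - \<kappa> * (a + t) \<le> Q (a + t + h) - \<kappa> * (a + t + h)"
      proof (rule DERIV_nonneg_imp_nondecreasing[where f = "\<lambda>s. Q s - \<kappa> * s"])
        fix s assume s: "a + t \<le> s" "s \<le> a + t + h"
        have "\<sigma> s w = \<sigma> (s - a) (\<sigma> a w)" by (simp flip: flow_add[OF flow])
        then have "dist (\<sigma> s w) \<omega>0 < r" using t(3)[of "s - a"] s by simp
        then have "\<kappa> \<le> defect (\<sigma> s w) (x s) (y s)" by (intro r(3) xR yR sep)
        moreover have "((\<lambda>s. Q s - \<kappa> * s) has_real_derivative defect (\<sigma> s w) (x s) (y s) - \<kappa>) (at s)"
          by (auto intro!: derivative_eq_intros dQ)
        ultimately show "\<exists>y. ((\<lambda>s. Q s - \<kappa> * s) has_real_derivative y) (at s) \<and> 0 \<le> y"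
          by (intro exI[of _ "defect (\<sigma> s w) (x s) (y s) - \<kappa>"]) simp
      qed (use T(2) in simp)
      moreover have "Q a \<le> Q (a + t)" "Q (a + t + h) \<le> Q (a + T)" using t by (auto intro!: mono)
      ultimately show ?thesis by (simp add: algebra_simps)
    qed
    have iter: "Q 0 + real m * (\<kappa> * h) \<le> Q (real m * T)"
    proof (induction m)
      case (Suc m)
      then show ?case using gain[of "real m * T"] by (simp add: algebra_simps)
    qed simp
    have up: "P t \<le> ln ((2 * R)\<^sup>2) / 2" for t
    proof -
      have "\<bar>x t - y t\<bar> \<le> \<bar>2 * R\<bar>" using xR[of t] yR[of t] by linarith
      then have "(x t - y t)\<^sup>2 \<le> (2 * R)\<^sup>2" by (simp add: abs_le_square_iff)
      moreover have "0 < (x t - y t)\<^sup>2" "0 < (2 * R)\<^sup>2" using ne[of t] R(1) by auto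
      ultimately have "ln ((x t - y t)\<^sup>2) \<le> ln ((2 * R)\<^sup>2)" by (simp only: ln_le_cancel_iff)
      then show ?thesis unfolding P_def by (intro divide_right_mono) auto
    qed
    have low: "P t \<ge> ln (d0\<^sup>2) / 2" for t
    proof -
      have "\<bar>d0\<bar> \<le> \<bar>x t - y t\<bar>" using sep[of t] d0(1) by simp
      then have "d0\<^sup>2 \<le> (x t - y t)\<^sup>2" by (simp add: abs_le_square_iff)
      moreover have "0 < (x t - y t)\<^sup>2" "0 < d0\<^sup>2" using ne[of t] d0(1) by auto
      ultimately have "ln (d0\<^sup>2) \<le> ln ((x t - y t)\<^sup>2)" by (simp only: ln_le_cancel_iff)
      then show ?thesis unfolding P_def by (intro divide_right_mono) auto
    qed
    have arith: "x1 + x2 \<le> u - l - 2 * q"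
      if "p0 + q \<le> p - (x1 + x2) / 2" "p \<le> u / 2" "l / 2 \<le> p0" for x1 x2 u l q p p0 :: real
      using that by (simp add: field_simps)
    have "P 0 + real m * (\<kappa> * h) \<le> P (real m * T) - (expo z1 (real m * T) + expo z2 (real m * T)) / 2"
      using iter unfolding Q_def by simp
    then have "expo z1 (real m * T) + expo z2 (real m * T) \<le> C - 2 * (real m * (\<kappa> * h))"
      unfolding C_def by (rule arith[OF _ up low])
    also have "2 * (real m * (\<kappa> * h)) = real m * (2 * \<kappa> * h)" by simp
    finally show ?thesis .
  qed
  then show thesis using T r(2) by (intro that[of T "2 * \<kappa> * h" C]) auto
qed

lemma decay_of_multiples:
  assumes M: "compact M" "skew_invariant \<sigma> f M" and T: "T > 0" and \<eta>: "\<eta> > 0"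
    and le: "\<And>z m. z \<in> M \<Longrightarrow> expo z (real m * T) \<le> C - real m * \<eta>"
  obtains K \<delta> where "\<delta> > 0" "\<And>z t. z \<in> M \<Longrightarrow> t \<ge> 0 \<Longrightarrow> expo z t \<le> K - \<delta> * t"
proof -
  obtain A where A: "A \<ge> 0" "\<And>z s t. z \<in> M \<Longrightarrow> \<bar>expo z t - expo z s\<bar> \<le> A * \<bar>t - s\<bar>"
    using expo_lipschitz[OF M] by metis
  have "expo z t \<le> (C + \<eta> + A * T) - \<eta> / T * t" if z: "z \<in> M" and t: "t \<ge> 0" for z t
  proof -
    define m where "m = nat \<lfloor>t / T\<rfloor>"
    have q: "t / T \<ge> 0" using t T by simp
    have m: "real m \<le> t / T" "t / T < real m + 1" using q by (auto simp: m_def)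
    have mt: "real m * T \<le> t" "t < real m * T + T" using m T by (auto simp: field_simps)
    have "expo z t \<le> expo z (real m * T) + A * \<bar>t - real m * T\<bar>"
      using A(2)[OF z, of t "real m * T"] by linarith
    also have "\<dots> \<le> (C - real m * \<eta>) + A * T"
      using mt A(1) by (intro add_mono le z mult_left_mono) auto
    also have "\<dots> \<le> (C + \<eta> + A * T) - \<eta> / T * t"
    proof -
      have "(t / T - 1) * \<eta> \<le> real m * \<eta>" using m(2) \<eta> by (intro mult_right_mono) auto
      then show ?thesis by (simp add: algebra_simps)
    qed
    finally show ?thesis .
  qed
  moreover have "\<eta> / T > 0" using T \<eta> by simp
  ultimately show thesis using that by blast
qed

end

section \<open>The spectrum and attractive minimal sets\<close>

lemma linear_growth_le:
  fixes a K :: real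
  assumes "\<And>t. t \<ge> 0 \<Longrightarrow> a * t \<le> K"
  shows "a \<le> 0"
proof (rule ccontr)
  assume "\<not> a \<le> 0"
  then have a: "a > 0" by simp
  have "K \<ge> 0" using assms[of 0] by simp
  then have "a * ((K + 1) / a) \<le> K" using a by (intro assms) auto
  then show False using a by simp
qed

context C1_skew_ode
begin

lemma LBINT_rate_shift:
  assumes M: "compact M" "skew_invariant \<sigma> f M" and z: "z \<in> M"
  shows "(LBINT s=ereal 0..ereal t. (\<lambda>(\<omega>, x). fx f \<omega> x) (skew_flow \<sigma> f s z) - l) = expo z t - l * t"
proof -
  have eq: "(\<lambda>(\<omega>, x). fx f \<omega> x) = rate" by (auto simp: rate_def fun_eq_iff)
  have c: "continuous_on UNIV (\<lambda>s. rate (skew_flow \<sigma> f s z) - l)"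
    by (intro continuous_intros rate_cont[OF M z])
  define F where "F u = (LBINT s=ereal 0..ereal u. rate (skew_flow \<sigma> f s z) - l)" for u
  have "(F has_real_derivative rate (skew_flow \<sigma> f u z) - l) (at u)" for u
    unfolding F_def by (rule antiderivative_from_0[OF c])
  then have "\<forall>u. ((\<lambda>u. F u - (expo z u - l * u)) has_real_derivative 0) (at u)"
    by (auto intro!: derivative_eq_intros expo_deriv[OF M z])
  from DERIV_isconst_all[OF this, of t 0] show ?thesis by (simp add: F_def eq)
qed

text \<open>
The two types of exponential dichotomy, both expressed for positive times. The second type is moved from \<open>- t\<close> to \<open>t\<close> by
starting at the point reached at time \<open>t\<close>.
\<close>

lemma not_in_spectrum_cases:
  assumes M: "compact M" "skew_invariant \<sigma> f M" and l: "l \<notin> fx_spectrum \<sigma> f M"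
  obtains (stable) K \<delta> where "\<delta> > 0" "\<And>z t. z \<in> M \<Longrightarrow> t \<ge> 0 \<Longrightarrow> expo z t \<le> K + (l - \<delta>) * t"
    | (unstable) K \<delta> where "\<delta> > 0" "\<And>z t. z \<in> M \<Longrightarrow> t \<ge> 0 \<Longrightarrow> expo z t \<ge> (l + \<delta>) * t - K"
proof -
  have "exp_dichotomy M (skew_flow \<sigma> f) (\<lambda>y. (\<lambda>(\<omega>, x). fx f \<omega> x) y - l)"
    using l by (simp add: fx_spectrum_def sacker_sell_spectrum_def)
  then obtain k \<delta> where k: "k \<ge> 1" "\<delta> > 0" and
    dich: "(\<forall>z\<in>M. \<forall>t\<ge>0. exp (expo z t - l * t) \<le> k * exp (- \<delta> * t)) \<or>
           (\<forall>z\<in>M. \<forall>t\<le>0. exp (expo z t - l * t) \<le> k * exp (\<delta> * t))"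
    unfolding exp_dichotomy_def using LBINT_rate_shift[OF M] by (auto simp: Ball_def)
  have ln: "a \<le> ln k + b" if "exp a \<le> k * exp b" for a b
  proof -
    have "exp a \<le> exp (ln k + b)" using that k(1) by (simp add: exp_add)
    then show ?thesis by simp
  qed
  from dich show thesis
  proof
    assume a: "\<forall>z\<in>M. \<forall>t\<ge>0. exp (expo z t - l * t) \<le> k * exp (- \<delta> * t)"
    show thesis
    proof (rule stable[OF k(2)])
      fix z t assume "z \<in> M" "(t :: real) \<ge> 0"
      then have "expo z t - l * t \<le> ln k + (- \<delta> * t)" using a by (intro ln) blast
      then show "expo z t \<le> ln k + (l - \<delta>) * t" by (simp add: algebra_simps)
    qed
  next
    assume a: "\<forall>z\<in>M. \<forall>t\<le>0. exp (expo z t - l * t) \<le> k * exp (\<delta> * t)"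
    show thesis
    proof (rule unstable[OF k(2)])
      fix z t assume z: "z \<in> M" and t: "(t :: real) \<ge> 0"
      have "expo (skew_flow \<sigma> f t z) (- t) - l * (- t) \<le> ln k + \<delta> * (- t)"
        using a invariant_step[OF M z, of t] t by (intro ln) (metis neg_le_0_iff_le)
      moreover have "expo z t + expo (skew_flow \<sigma> f t z) (- t) = 0"
        using expo_add[OF M z, of t "- t"] by simp
      ultimately show "expo z t \<ge> (l + \<delta>) * t - ln k" by (simp add: algebra_simps)
    qed
  qed
qed

definition lower_rate :: "('a \<times> real) set \<Rightarrow> real \<Rightarrow> bool" where
  "lower_rate M l \<longleftrightarrow> (\<exists>K. \<forall>z\<in>M. \<forall>t\<ge>0. l * t - K \<le> expo z t)"

text \<open>
The supremum \<open>s\<close> of the uniform lower rates is in the spectrum: a dichotomy at \<open>s\<close> would either push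
all integrals below a rate smaller than \<open>s\<close>, or make a rate larger than \<open>s\<close> a lower rate.
\<close>

lemma lower_spectral_point:
  assumes M: "compact M" "skew_invariant \<sigma> f M" and ne: "M \<noteq> {}"
  obtains s where "s \<in> fx_spectrum \<sigma> f M" "\<And>l. l < s \<Longrightarrow> lower_rate M l" "\<And>l. lower_rate M l \<Longrightarrow> l \<le> s"
proof -
  obtain A where A: "A \<ge> 0" "\<And>z s t. z \<in> M \<Longrightarrow> \<bar>expo z t - expo z s\<bar> \<le> A * \<bar>t - s\<bar>"
    using expo_lipschitz[OF M] by metis
  have At: "\<bar>expo z t\<bar> \<le> A * t" if "z \<in> M" "t \<ge> 0" for z t using A(2)[OF that(1), of t 0] that(2) by simp
  obtain z0 where z0: "z0 \<in> M" using ne by blast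
  define S where "S = {l. lower_rate M l}"
  have "lower_rate M (- A)"
    unfolding lower_rate_def by (intro exI[of _ 0]) (use At in \<open>force simp: abs_le_iff\<close>)
  then have Sne: "S \<noteq> {}" by (auto simp: S_def)
  have "l \<le> A" if "lower_rate M l" for l
  proof -
    obtain K where K: "\<And>t. t \<ge> 0 \<Longrightarrow> l * t - K \<le> expo z0 t"
      using \<open>lower_rate M l\<close> z0 unfolding lower_rate_def by blast
    have "(l - A) * t \<le> K" if "t \<ge> 0" for t
      using K[OF that] At[OF z0 that] by (simp add: algebra_simps abs_le_iff)
    then have "l - A \<le> 0" by (rule linear_growth_le)
    then show ?thesis by simp
  qed
  then have Sbdd: "bdd_above S" by (intro bdd_aboveI[of _ A]) (auto simp: S_def)
  define s where "s = Sup S"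
  have le: "l \<le> s" if "lower_rate M l" for l
    unfolding s_def using that Sbdd by (intro cSup_upper) (auto simp: S_def)
  have less: "lower_rate M l" if "l < s" for l
  proof -
    obtain l' where l': "lower_rate M l'" "l < l'"
      using \<open>l < s\<close> less_cSup_iff[OF Sne Sbdd, of l] unfolding s_def S_def by auto
    then obtain K where K: "\<And>z t. z \<in> M \<Longrightarrow> t \<ge> 0 \<Longrightarrow> l' * t - K \<le> expo z t" unfolding lower_rate_def by blast
    have "l * t - K \<le> expo z t" if "z \<in> M" "t \<ge> 0" for z t
      using K[OF that] mult_right_mono[of l l' t] l'(2) that(2) by linarith
    then show ?thesis unfolding lower_rate_def by blast
  qed
  have "s \<in> fx_spectrum \<sigma> f M"
  proof (rule ccontr)
    assume "s \<notin> fx_spectrum \<sigma> f M"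
    with M show False
    proof (cases rule: not_in_spectrum_cases)
      case (stable K \<delta>)
      have "lower_rate M (s - \<delta> / 2)" using stable(1) by (intro less) simp
      then obtain K' where K': "\<And>t. t \<ge> 0 \<Longrightarrow> (s - \<delta> / 2) * t - K' \<le> expo z0 t"
        using z0 unfolding lower_rate_def by blast
      have "\<delta> / 2 * t \<le> K + K'" if "t \<ge> 0" for t
        using K'[OF that] stable(2)[OF z0 that] by (simp add: algebra_simps)
      then have "\<delta> / 2 \<le> 0" by (rule linear_growth_le)
      then show False using stable(1) by simp
    next
      case (unstable K \<delta>)
      have "lower_rate M (s + \<delta>)" unfolding lower_rate_def using unstable(2) by blast
      from le[OF this] show False using unstable(1) by simp
    qed
  qed
  then show thesis using less le that by blast
qed

lemma minimal_setD:
  assumes "minimal_set \<sigma> f M"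
  shows "compact M" "skew_invariant \<sigma> f M" "M \<noteq> {}"
  using assms by (auto simp: minimal_set_def)

lemma minimal_sets_disjoint:
  assumes M1: "minimal_set \<sigma> f M1" and M2: "minimal_set \<sigma> f M2" and ne: "M1 \<noteq> M2"
  shows "M1 \<inter> M2 = {}"
proof (rule ccontr)
  assume K: "M1 \<inter> M2 \<noteq> {}"
  note D1 = minimal_setD(1,2)[OF M1] and D2 = minimal_setD(1,2)[OF M2]
  have sub: "skew_flow \<sigma> f t ` (M1 \<inter> M2) \<subseteq> M1 \<inter> M2" for t
    using invariant_step[OF D1] invariant_step[OF D2] by blast
  have sup: "M1 \<inter> M2 \<subseteq> skew_flow \<sigma> f t ` (M1 \<inter> M2)" for t
  proof
    fix z assume z: "z \<in> M1 \<inter> M2"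
    then have "skew_flow \<sigma> f t (skew_flow \<sigma> f (- t) z) = z"
      using skew_flow_add[OF D1, of z t "- t"] skew_flow_0[OF D1, of z] by simp
    moreover have "skew_flow \<sigma> f (- t) z \<in> M1 \<inter> M2" using sub z by blast
    ultimately show "z \<in> skew_flow \<sigma> f t ` (M1 \<inter> M2)" by (metis imageI)
  qed
  have "skew_invariant \<sigma> f (M1 \<inter> M2)"
    unfolding skew_invariant_def
  proof (intro conjI allI)
    show "\<forall>(\<omega>, x)\<in>M1 \<inter> M2. max_interval \<sigma> f \<omega> x = UNIV"
      using D1(2) by (auto simp: skew_invariant_def)
    show "skew_flow \<sigma> f t ` (M1 \<inter> M2) = M1 \<inter> M2" for t using sub sup by blast
  qed
  moreover have "compact (M1 \<inter> M2)" using D1 D2 by (simp add: compact_Int)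
  ultimately have "\<not> M1 \<inter> M2 \<subset> M1" "\<not> M1 \<inter> M2 \<subset> M2"
    using M1 M2 K unfolding minimal_set_def by blast+
  then show False using ne by blast
qed

text \<open>
The projection is compact and contains a dense orbit.
\<close>

lemma invariant_set_covers_base:
  assumes M: "compact M" "skew_invariant \<sigma> f M" and ne: "M \<noteq> {}" and min: "minimal_flow \<sigma>"
  obtains z where "z \<in> M" "fst z = \<omega>"
proof -
  obtain z0 where z0: "z0 \<in> M" using ne by blast
  have "range (\<lambda>t. \<sigma> t (fst z0)) \<subseteq> fst ` M"
    using invariant_step[OF M z0] by (metis fst_skew_flow image_eqI image_subsetI)
  moreover have "closed (fst ` M)"
    by (intro compact_imp_closed compact_continuous_image M continuous_intros)
  ultimately have "closure (range (\<lambda>t. \<sigma> t (fst z0))) \<subseteq> fst ` M" by (rule closure_minimal)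
  then have "\<omega> \<in> fst ` M" using min unfolding minimal_flow_def by blast
  then show thesis using that by blast
qed

text \<open>
Over every base point there is a point of \<open>M1\<close>, and the integral of \<open>f\<^sub>x\<close> along its orbit decreases at most slowly; by
\<open>exponent_sum_estimate\<close> the integral over \<open>M2\<close> must then decrease linearly.
\<close>

theorem attractive_of_nonneg_spectrum:
  assumes M1: "minimal_set \<sigma> f M1" and M2: "minimal_set \<sigma> f M2" and ne: "M1 \<noteq> M2"
    and min: "minimal_flow \<sigma>" and SDC: "SDC \<sigma> f" and Co: "Co f"
    and lower: "\<And>l. l < 0 \<Longrightarrow> lower_rate M1 l"
  shows "hyperbolic_attractive \<sigma> f M2"
proof -
  note D1 = minimal_setD[OF M1] and D2 = minimal_setD[OF M2]
  obtain T C \<eta> where T: "T > 0" "\<eta> > 0"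
    "\<And>z1 z2 m. z1 \<in> M1 \<Longrightarrow> z2 \<in> M2 \<Longrightarrow> fst z1 = fst z2 \<Longrightarrow> expo z1 (real m * T) + expo z2 (real m * T) \<le> C - real m * \<eta>"
    using exponent_sum_estimate[OF D1(1,2) D2(1,2) minimal_sets_disjoint[OF M1 M2 ne] min SDC] by metis
  \<comment> \<open>The sum of the integrals decreases at the rate \<open>\<eta> / T\<close>; at most half of it is due to \<open>M1\<close>.\<close>
  have "- (\<eta> / (2 * T)) < 0" using T by simp
  from lower[OF this] obtain K where K: "\<And>z t. z \<in> M1 \<Longrightarrow> t \<ge> 0 \<Longrightarrow> - (\<eta> / (2 * T)) * t - K \<le> expo z t"
    unfolding lower_rate_def by blast
  have "expo z (real m * T) \<le> (C + K) - real m * (\<eta> / 2)" if z: "z \<in> M2" for z m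
  proof -
    obtain z1 where z1: "z1 \<in> M1" "fst z1 = fst z" using invariant_set_covers_base[OF D1 min] by metis
    have "- (\<eta> / (2 * T)) * (real m * T) = - (real m * (\<eta> / 2))" using T(1) by (simp add: field_simps)
    then have "- (real m * (\<eta> / 2)) - K \<le> expo z1 (real m * T)"
      using K[OF z1(1), of "real m * T"] T(1) by (simp add: mult.commute)
    then show ?thesis using T(3)[OF z1(1) z z1(2), of m] by (simp add: field_simps)
  qed
  moreover have "\<eta> / 2 > 0" using T by simp
  ultimately obtain K \<delta> where "\<delta> > 0" "\<And>z t. z \<in> M2 \<Longrightarrow> t \<ge> 0 \<Longrightarrow> expo z t \<le> K - \<delta> * t"
    using decay_of_multiples[OF D2(1,2) T(1)] by metis
  then show ?thesis using hyperbolic_attractive_of_decay[OF D2(1,2) Co] by blast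
qed

text \<open>
If \<open>l < 0\<close>, there is a dichotomy at \<open>l / 2\<close>. It cannot be of the unstable type, which would make \<open>l / 2\<close> a lower rate, while
\<open>l\<close> is the largest one; the stable type is a uniform decrease.
\<close>

theorem attractive_of_singleton_spectrum:
  assumes M1: "minimal_set \<sigma> f M1" and M2: "minimal_set \<sigma> f M2" and ne: "M1 \<noteq> M2"
    and min: "minimal_flow \<sigma>" and SDC: "SDC \<sigma> f" and Co: "Co f"
    and spec: "fx_spectrum \<sigma> f M1 = {l}"
  shows "hyperbolic_attractive \<sigma> f M1 \<or> hyperbolic_attractive \<sigma> f M2"
proof -
  note D1 = minimal_setD[OF M1]
  obtain s where s: "s \<in> fx_spectrum \<sigma> f M1" "\<And>l. l < s \<Longrightarrow> lower_rate M1 l" "\<And>l. lower_rate M1 l \<Longrightarrow> l \<le> s"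
    using lower_spectral_point[OF D1] by metis
  then have sl: "s = l" using spec by simp
  show ?thesis
  proof (cases "l \<ge> 0")
    case True
    have "hyperbolic_attractive \<sigma> f M2"
      by (rule attractive_of_nonneg_spectrum[OF M1 M2 ne min SDC Co]) (use s(2) sl True in auto)
    then show ?thesis ..
  next
    case False
    then have "l / 2 \<notin> fx_spectrum \<sigma> f M1" using spec by simp
    with D1(1,2) have "hyperbolic_attractive \<sigma> f M1"
    proof (cases rule: not_in_spectrum_cases)
      case (stable K \<delta>)
      have "expo z t \<le> K - (\<delta> - l / 2) * t" if "z \<in> M1" "t \<ge> 0" for z t
        using stable(2)[OF that] by (simp add: algebra_simps)
      moreover have "\<delta> - l / 2 > 0" using stable(1) False by simp
      ultimately show ?thesis using hyperbolic_attractive_of_decay[OF D1(1,2) Co] by blast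
    next
      case (unstable K \<delta>)
      have "lower_rate M1 (l / 2 + \<delta>)" unfolding lower_rate_def using unstable(2) by blast
      from s(3)[OF this] show ?thesis using unstable(1) False sl by simp
    qed
    then show ?thesis ..
  qed
qed

text \<open>
Average the hypothesis over the times of a list that witnesses the negative upper mean, and sum it along steps of length \<open>T\<close>: the left side
telescopes, and shifting by a time of the list changes the integral of \<open>f\<^sub>x\<close> by a bounded amount only.
\<close>

lemma decay_of_upper_mean_neg:
  assumes M: "compact M" "skew_invariant \<sigma> f M" and T: "T > 0"
    and le: "\<And>z. z \<in> M \<Longrightarrow> expo z T \<le> apply_bcontfun g (fst z)" and neg: "upper_mean \<sigma> g < 0"
  obtains K \<delta> where "\<delta> > 0" "\<And>z t. z \<in> M \<Longrightarrow> t \<ge> 0 \<Longrightarrow> expo z t \<le> K - \<delta> * t"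
proof -
  obtain ts c where ts: "ts \<noteq> []" "c < 0" "\<And>\<omega>. flow_avg \<sigma> ts (apply_bcontfun g) \<omega> \<le> c"
    using upper_mean_negE[OF neg] by metis
  obtain A where A: "A \<ge> 0" "\<And>z s t. z \<in> M \<Longrightarrow> \<bar>expo z t - expo z s\<bar> \<le> A * \<bar>t - s\<bar>"
    using expo_lipschitz[OF M] by metis
  define n where "n = real (length ts)"
  have n: "n > 0" using ts(1) by (simp add: n_def)
  define S where "S = (\<Sum>t\<leftarrow>ts. \<bar>t\<bar>)"
  have "expo z (real m * T) \<le> (2 * A * S / n) - real m * (- c)" if z: "z \<in> M" for z m
  proof -
    have step: "(\<Sum>t\<leftarrow>ts. expo z (t + s + T) - expo z (t + s)) \<le> c * n" for s
    proof -
      have "(\<Sum>t\<leftarrow>ts. expo z (t + s + T) - expo z (t + s)) \<le> (\<Sum>t\<leftarrow>ts. apply_bcontfun g (\<sigma> t (\<sigma> s (fst z))))"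
      proof (rule sum_list_mono)
        fix t
        have "expo z (t + s + T) - expo z (t + s) = expo (skew_flow \<sigma> f (t + s) z) T"
          using expo_add[OF M z, of "t + s" T] by simp
        also have "\<dots> \<le> apply_bcontfun g (\<sigma> (t + s) (fst z))"
          using le[OF invariant_step[OF M z, of "t + s"]] by simp
        finally show "expo z (t + s + T) - expo z (t + s) \<le> apply_bcontfun g (\<sigma> t (\<sigma> s (fst z)))"
          by (simp add: flow_add[OF flow])
      qed
      also have "\<dots> \<le> c * n"
        using ts(3)[of "\<sigma> s (fst z)"] n by (simp add: flow_avg_def n_def divide_le_eq)
      finally show ?thesis .
    qed
    have tele: "(\<Sum>t\<leftarrow>ts. expo z (t + real m * T) - expo z t) \<le> real m * (c * n)"
    proof (induction m)
      case (Suc m)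
      have "(\<Sum>t\<leftarrow>ts. expo z (t + real (Suc m) * T) - expo z t) =
          (\<Sum>t\<leftarrow>ts. expo z (t + real m * T + T) - expo z (t + real m * T)) + (\<Sum>t\<leftarrow>ts. expo z (t + real m * T) - expo z t)"
        by (simp add: algebra_simps flip: sum_list_addf)
      then show ?case using step[of "real m * T"] Suc by (simp add: algebra_simps)
    qed simp
    have "(\<Sum>t\<leftarrow>ts. expo z (real m * T)) \<le> (\<Sum>t\<leftarrow>ts. (expo z (t + real m * T) - expo z t) + 2 * A * \<bar>t\<bar>)"
    proof (rule sum_list_mono)
      fix t
      show "expo z (real m * T) \<le> (expo z (t + real m * T) - expo z t) + 2 * A * \<bar>t\<bar>"
        using A(2)[OF z, of "t + real m * T" "real m * T"] A(2)[OF z, of t 0] by (simp add: abs_le_iff)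
    qed
    also have "\<dots> = (\<Sum>t\<leftarrow>ts. expo z (t + real m * T) - expo z t) + 2 * A * S"
      by (simp add: sum_list_addf sum_list_const_mult S_def)
    also have "\<dots> \<le> real m * (c * n) + 2 * A * S" using tele by simp
    also have "(\<Sum>t\<leftarrow>ts. expo z (real m * T)) = n * expo z (real m * T)"
      unfolding n_def by (induction ts) (auto simp: algebra_simps)
    finally show ?thesis using n by (simp add: field_simps)
  qed
  moreover have "- c > 0" using ts(2) by simp
  ultimately show thesis using decay_of_multiples[OF M T] that by metis
qed

text \<open>
\<open>G\<close> is the smallest \<open>n\<close>-Lipschitz function on the base that lies above the integrals over \<open>M1\<close>. For large \<open>n\<close> it stays
below the required bound over \<open>M2\<close>, because a pair of points with sum of integrals above \<open>- 1\<close> has base points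
at a definite distance, by compactness.
\<close>

lemma continuous_separation:
  assumes M1: "compact M1" "skew_invariant \<sigma> f M1" "M1 \<noteq> {}" and M2: "compact M2" "skew_invariant \<sigma> f M2" "M2 \<noteq> {}"
    and T: "T \<ge> 0"
    and sum: "\<And>z1 z2. z1 \<in> M1 \<Longrightarrow> z2 \<in> M2 \<Longrightarrow> fst z1 = fst z2 \<Longrightarrow> expo z1 T + expo z2 T \<le> - 2"
  obtains g :: "'a \<Rightarrow>\<^sub>C real" where "\<And>z. z \<in> M1 \<Longrightarrow> expo z T \<le> apply_bcontfun g (fst z)"
    "\<And>z. z \<in> M2 \<Longrightarrow> expo z T \<le> - apply_bcontfun g (fst z) - 1"
proof -
  obtain A1 where A1: "\<And>z s t. z \<in> M1 \<Longrightarrow> \<bar>expo z t - expo z s\<bar> \<le> A1 * \<bar>t - s\<bar>"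
    using expo_lipschitz[OF M1(1,2)] by metis
  obtain A2 where A2: "\<And>z s t. z \<in> M2 \<Longrightarrow> \<bar>expo z t - expo z s\<bar> \<le> A2 * \<bar>t - s\<bar>"
    using expo_lipschitz[OF M2(1,2)] by metis
  define B where "B = max 0 (max (A1 * T) (A2 * T))"
  have B: "B \<ge> 0" "\<And>z. z \<in> M1 \<Longrightarrow> expo z T \<le> B" "\<And>z. z \<in> M2 \<Longrightarrow> expo z T \<le> B"
    using A1[of _ T 0] A2[of _ T 0] T by (force simp: B_def le_max_iff_disj abs_le_iff)+
  define N where "N = {p \<in> M1 \<times> M2. - 1 \<le> expo (fst p) T + expo (snd p) T}"
  have c12: "continuous_on (M1 \<times> M2) (\<lambda>p. expo (fst p) T + expo (snd p) T)"
    by (intro continuous_on_add continuous_on_compose2[OF expo_continuous[OF M1(1,2) T]]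
        continuous_on_compose2[OF expo_continuous[OF M2(1,2) T]]) (auto intro!: continuous_intros)
  have "closed N" unfolding N_def
    by (intro continuous_on_closed_Collect_le continuous_on_const c12 compact_imp_closed compact_Times M1 M2)
  then have "compact N"
    using compact_Int_closed[OF compact_Times[OF M1(1) M2(1)], of N] by (simp add: N_def Int_absorb1 subset_iff)
  obtain d where d: "d > 0" "\<And>p. p \<in> N \<Longrightarrow> d \<le> dist (fst (fst p)) (fst (snd p))"
  proof (cases "N = {}")
    case False
    have "continuous_on N (\<lambda>p. dist (fst (fst p)) (fst (snd p)))" by (intro continuous_intros)
    from continuous_attains_inf[OF \<open>compact N\<close> False this]
    obtain p where p: "p \<in> N" "\<And>q. q \<in> N \<Longrightarrow> dist (fst (fst p)) (fst (snd p)) \<le> dist (fst (fst q)) (fst (snd q))" by blast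
    have "fst (fst p) \<noteq> fst (snd p)" using p(1) sum[of "fst p" "snd p"] by (auto simp: N_def)
    then show thesis using p(2) that by (metis zero_less_dist_iff)
  qed (use that[of 1] in auto)
  \<comment> \<open>At distance at least \<open>d\<close> the penalty \<open>n * d\<close> outweighs the largest possible sum \<open>2 * B\<close> of two integrals by 1.\<close>
  define n where "n = (2 * B + 1) / d"
  have n: "n > 0" using B(1) d(1) by (simp add: n_def)
  have pair: "expo z1 T - n * dist (fst z2) (fst z1) \<le> - expo z2 T - 1" if z: "z1 \<in> M1" "z2 \<in> M2" for z1 z2
  proof (cases "(z1, z2) \<in> N")
    case True
    have "2 * B + 1 = n * d" using d(1) by (simp add: n_def)
    also have "\<dots> \<le> n * dist (fst z2) (fst z1)"
      using d(2)[OF True] n by (intro mult_left_mono) (auto simp: dist_commute)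
    finally show ?thesis using B(2)[OF z(1)] B(3)[OF z(2)] by linarith
  next
    case False
    then have "expo z1 T + expo z2 T < - 1" using z by (auto simp: N_def)
    moreover have "n * dist (fst z2) (fst z1) \<ge> 0" using n by simp
    ultimately show ?thesis by linarith
  qed
  define G where "G \<omega> = (SUP z\<in>M1. expo z T - n * dist \<omega> (fst z))" for \<omega>
  have bdd: "bdd_above ((\<lambda>z. expo z T - n * dist \<omega> (fst z)) ` M1)" for \<omega>
  proof (rule bdd_aboveI2)
    fix z assume "z \<in> M1"
    then show "expo z T - n * dist \<omega> (fst z) \<le> B" using B(2)[of z] n by (smt (verit) mult_nonneg_nonneg zero_le_dist)
  qed
  have G_upper: "expo z T - n * dist \<omega> (fst z) \<le> G \<omega>" if "z \<in> M1" for z \<omega>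
    unfolding G_def using that by (intro cSUP_upper bdd)
  have G_least: "G \<omega> \<le> c" if "\<And>z. z \<in> M1 \<Longrightarrow> expo z T - n * dist \<omega> (fst z) \<le> c" for \<omega> c
    unfolding G_def using that M1(3) by (intro cSUP_least)
  have lip: "G \<omega> \<le> G \<omega>' + n * dist \<omega> \<omega>'" for \<omega> \<omega>'
  proof (rule G_least)
    fix z assume z: "z \<in> M1"
    have "n * dist \<omega>' (fst z) \<le> n * (dist \<omega> (fst z) + dist \<omega> \<omega>')"
      using n dist_triangle3[of \<omega>' "fst z" \<omega>] by (intro mult_left_mono) auto
    then show "expo z T - n * dist \<omega> (fst z) \<le> G \<omega>' + n * dist \<omega> \<omega>'"
      using G_upper[OF z, of \<omega>'] by (simp add: algebra_simps)
  qed
  have "continuous_on UNIV G"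
    unfolding continuous_on_iff
  proof (intro ballI allI impI)
    fix \<omega> e assume e: "(e :: real) > 0"
    have "dist (G \<omega>') (G \<omega>) < e" if "dist \<omega>' \<omega> < e / n" for \<omega>'
    proof -
      have "n * dist \<omega>' \<omega> < e" using that n by (simp add: field_simps)
      then show ?thesis using lip[of \<omega> \<omega>'] lip[of \<omega>' \<omega>] by (simp add: dist_real_def dist_commute abs_less_iff)
    qed
    then show "\<exists>d>0. \<forall>x'\<in>UNIV. dist x' \<omega> < d \<longrightarrow> dist (G x') (G \<omega>) < e"
      using e n by (intro exI[of _ "e / n"]) auto
  qed
  then have G: "apply_bcontfun (Bcontfun G) = G" by (rule apply_Bcontfun_compact[OF cpt])
  show thesis
  proof (rule that[of "Bcontfun G"])
    show "expo z T \<le> apply_bcontfun (Bcontfun G) (fst z)" if "z \<in> M1" for z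
      using G_upper[OF that, of "fst z"] by (simp add: G)
    show "expo z T \<le> - apply_bcontfun (Bcontfun G) (fst z) - 1" if z: "z \<in> M2" for z
      using G_least[of "fst z" "- expo z T - 1"] pair[OF _ z] by (simp add: G)
  qed
qed

text \<open>
The upper means of \<open>g\<close> and of \<open>- g - 1\<close> add up to at most \<open>- 1\<close> when the upper mean is odd, so one of them is negative.
\<close>

theorem attractive_of_uniquely_ergodic:
  assumes M1: "minimal_set \<sigma> f M1" and M2: "minimal_set \<sigma> f M2" and ne: "M1 \<noteq> M2"
    and min: "minimal_flow \<sigma>" and SDC: "SDC \<sigma> f" and Co: "Co f" and ue: "uniquely_ergodic \<sigma>"
  shows "hyperbolic_attractive \<sigma> f M1 \<or> hyperbolic_attractive \<sigma> f M2"
proof -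
  note D1 = minimal_setD[OF M1] and D2 = minimal_setD[OF M2]
  obtain T C \<eta> where T: "T > 0" "\<eta> > 0"
    "\<And>z1 z2 m. z1 \<in> M1 \<Longrightarrow> z2 \<in> M2 \<Longrightarrow> fst z1 = fst z2 \<Longrightarrow> expo z1 (real m * T) + expo z2 (real m * T) \<le> C - real m * \<eta>"
    using exponent_sum_estimate[OF D1(1,2) D2(1,2) minimal_sets_disjoint[OF M1 M2 ne] min SDC] by metis
  obtain m0 where m0: "(C + 2) / \<eta> < real m0" using reals_Archimedean2 by blast
  \<comment> \<open>The successor makes the time \<open>m * T\<close> positive.\<close>
  define m where "m = Suc m0"
  have "C - real m * \<eta> \<le> - 2" using m0 T(2) by (simp add: m_def field_simps)
  define T' where "T' = real m * T"
  have T': "T' > 0" using T(1) by (simp add: T'_def m_def)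
  have sum: "expo z1 T' + expo z2 T' \<le> - 2" if "z1 \<in> M1" "z2 \<in> M2" "fst z1 = fst z2" for z1 z2
    using T(3)[OF that, of m] \<open>C - real m * \<eta> \<le> - 2\<close> by (simp add: T'_def)
  obtain g :: "'a \<Rightarrow>\<^sub>C real" where g: "\<And>z. z \<in> M1 \<Longrightarrow> expo z T' \<le> apply_bcontfun g (fst z)"
    "\<And>z. z \<in> M2 \<Longrightarrow> expo z T' \<le> - apply_bcontfun g (fst z) - 1"
    using continuous_separation[OF D1 D2 less_imp_le[OF T'] sum] by metis
  define h where "h = - g + const_bcontfun (- 1)"
  have hx: "apply_bcontfun h x = - apply_bcontfun g x - 1" for x by (simp add: h_def const_bcontfun.rep_eq)
  have "upper_mean \<sigma> h \<le> upper_mean \<sigma> (- g) + upper_mean \<sigma> (const_bcontfun (- 1))"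
    unfolding h_def by (rule sublinearD(1)[OF sublinear_upper_mean[OF flow]])
  also have "upper_mean \<sigma> (const_bcontfun (- 1)) \<le> - 1"
    by (intro upper_mean_le avg_bounds_const) (simp add: const_bcontfun.rep_eq)
  also have "upper_mean \<sigma> (- g) = - upper_mean \<sigma> g"
    by (rule uniquely_ergodic_upper_mean_neg[OF cpt flow ue])
  finally have "upper_mean \<sigma> g < 0 \<or> upper_mean \<sigma> h < 0" by linarith
  then show ?thesis
  proof
    assume "upper_mean \<sigma> g < 0"
    then obtain K \<delta> where "\<delta> > 0" "\<And>z t. z \<in> M1 \<Longrightarrow> t \<ge> 0 \<Longrightarrow> expo z t \<le> K - \<delta> * t"
      using decay_of_upper_mean_neg[OF D1(1,2) T' g(1)] by metis
    then show ?thesis using hyperbolic_attractive_of_decay[OF D1(1,2) Co] by blast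
  next
    assume "upper_mean \<sigma> h < 0"
    then obtain K \<delta> where "\<delta> > 0" "\<And>z t. z \<in> M2 \<Longrightarrow> t \<ge> 0 \<Longrightarrow> expo z t \<le> K - \<delta> * t"
      using decay_of_upper_mean_neg[OF D2(1,2) T', of h] g(2) hx by metis
    then show ?thesis using hyperbolic_attractive_of_decay[OF D2(1,2) Co] by blast
  qed
qed

end

lemma C1_skew_odeI:
  fixes \<sigma> :: "real \<Rightarrow> 'a::metric_space \<Rightarrow> 'a"
  assumes "compact (UNIV :: 'a set)" "continuous_flow \<sigma>" "C0k 2 f"
  shows "C1_skew_ode \<sigma> f"
proof
  have cont: "continuous_on UNIV (\<lambda>(\<omega>, x). (deriv ^^ j) (f \<omega>) x)" if "j \<le> 2" for j
    using assms(3) that by (simp add: C0k_def)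
  show "continuous_on UNIV (\<lambda>(\<omega>, x). f \<omega> x)" using cont[of 0] by simp
  show "continuous_on UNIV (\<lambda>(\<omega>, x). fx f \<omega> x)" using cont[of 1] by (simp add: fx_def)
  fix \<omega> x
  have "(deriv ^^ 0) (f \<omega>) differentiable (at x)" using assms(3) unfolding C0k_def by (metis pos2)
  then show "(f \<omega> has_real_derivative fx f \<omega> x) (at x)"
    unfolding fx_def by (simp add: DERIV_deriv_iff_real_differentiable)
qed (fact assms)+

theorem theorem5p13:
  fixes \<sigma> :: "real \<Rightarrow> 'a::metric_space \<Rightarrow> 'a"
    and f :: "'a \<Rightarrow> real \<Rightarrow> real"
    and M1 M2 :: "('a \<times> real) set"
  assumes "compact (UNIV :: 'a set)"
    and "continuous_flow \<sigma>" and "minimal_flow \<sigma>"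
    and "C0k 2 f" and "SDC \<sigma> f" and "Co f"
    and "minimal_set \<sigma> f M1" and "minimal_set \<sigma> f M2" and "M1 \<noteq> M2"
  shows "(fx_spectrum \<sigma> f M1 \<subseteq> {0..} \<longrightarrow> hyperbolic_attractive \<sigma> f M2) \<and>
    ((\<exists>l. fx_spectrum \<sigma> f M1 = {l}) \<or> (\<exists>l. fx_spectrum \<sigma> f M2 = {l}) \<longrightarrow>
       hyperbolic_attractive \<sigma> f M1 \<or> hyperbolic_attractive \<sigma> f M2) \<and>
    (uniquely_ergodic \<sigma> \<longrightarrow>
       hyperbolic_attractive \<sigma> f M1 \<or> hyperbolic_attractive \<sigma> f M2)"
proof -
  interpret C1_skew_ode \<sigma> f by (rule C1_skew_odeI) fact+
  note M = assms(7,8) and data = assms(3,5,6)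
  have "hyperbolic_attractive \<sigma> f M2" if "fx_spectrum \<sigma> f M1 \<subseteq> {0..}"
  proof -
    obtain s where "s \<in> fx_spectrum \<sigma> f M1" "\<And>l. l < s \<Longrightarrow> lower_rate M1 l"
      using lower_spectral_point[OF minimal_setD[OF M(1)]] by metis
    with that have "\<And>l. l < 0 \<Longrightarrow> lower_rate M1 l" by force
    then show ?thesis by (rule attractive_of_nonneg_spectrum[OF M assms(9) data])
  qed
  moreover have "hyperbolic_attractive \<sigma> f M1 \<or> hyperbolic_attractive \<sigma> f M2"
    if "(\<exists>l. fx_spectrum \<sigma> f M1 = {l}) \<or> (\<exists>l. fx_spectrum \<sigma> f M2 = {l})"
    using that attractive_of_singleton_spectrum[OF M assms(9) data]
      attractive_of_singleton_spectrum[OF M(2,1) assms(9)[symmetric] data] by blast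
  moreover have "hyperbolic_attractive \<sigma> f M1 \<or> hyperbolic_attractive \<sigma> f M2" if "uniquely_ergodic \<sigma>"
    by (rule attractive_of_uniquely_ergodic[OF M assms(9) data that])
  ultimately show ?thesis by blast
qed

end
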